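(* Let $\Delta\ge3$ be an integer or $\Delta=+\infty$, and let $\beta,\gamma,\lambda$ be reals with $0\le\beta\le\gamma$, $\gamma>0$ and $\lambda>0$. Suppose there is a general $(\alpha,c)$-potential function with respect to $\Delta$ and $(\beta,\gamma,\lambda)$ for some $\alpha\in(0,1)$ and $c>0$. Then for every $n$-vertex graph $G$ of maximum degree $\Delta$ (arbitrary maximum degree if $\Delta=+\infty$), the mixing time of the Glauber dynamics for the $2$-spin system on $G$ with parameters $(\beta,\gamma,\lambda)$ is $O(n^{2+2c/\alpha})$ (the implied constant not depending on $n$ or on $G$).
   Context: 2-spin system: for a finite graph $G=(V,E)$, $\mu_G(\sigma)\propto\beta^{m_1(\sigma)}\gamma^{m_0(\sigma)}\lambda^{n_1(\sigma)}$ on $\{0,1\}^V$ ($0^0=1$), where $m_s(\sigma)$ counts edges with both endpoints of spin $s$ and $n_1(\sigma)$ counts vertices of spin $1$. Glauber dynamics: pick a uniformly random vertex and resample its spin from the conditional distribution given all other spins. Mixing time: $\max_{x_0}\min\{t\ge0:\|P^t(x_0,\cdot)-\mu_G\|_{\mathrm{TV}}\le1/4\}$. For integers $d\ge1$ and $(y_1,\dots,y_d)\in[-\infty,+\infty]^d$ let $H_d(y_1,\dots,y_d)=\log\lambda+\sum_{i=1}^d\log\frac{\beta e^{y_i}+1}{e^{y_i}+\gamma}$, and $h(y)=-\frac{(1-\beta\gamma)e^y}{(\beta e^y+1)(e^y+\gamma)}$. For integers $d\ge0$ let $J_d$ be the closed interval with endpoints $\log(\lambda\beta^d)$ and $\log(\lambda/\gamma^d)$.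 Definition: let $\Psi:[-\infty,+\infty]\to(-\infty,+\infty)$ be differentiable and increasing with image $S$ and derivative $\psi=\Psi'$. For $\alpha\in(0,1)$, $c>0$, $\Psi$ is a general $(\alpha,c)$-potential function with respect to $\Delta$ and $(\beta,\gamma,\lambda)$ if: (Contraction) for every integer $1\le d<\Delta$ and every $(\tilde y_1,\dots,\tilde y_d)\in S^d$, $\sum_{i=1}^d\frac{\psi(y)}{\psi(y_i)}|h(y_i)|\le1-\alpha$, where $y_i=\Psi^{-1}(\tilde y_i)$ and $y=H_d(y_1,\dots,y_d)$ (this sum equals $\|\nabla(\Psi\circ H_d\circ\Psi^{-1})(\tilde y_1,\dots,\tilde y_d)\|_1$); (General Boundedness) for all integers $0\le d_1,d_2<\Delta$ and all $y_1\in J_{d_1}$, $y_2\in J_{d_2}$, $\frac{\psi(y_2)}{\psi(y_1)}|h(y_1)|\le\frac{2c}{d_1+d_2+2}$. *)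

theory Defs
  imports "HOL-Probability.Probability"
begin

section \<open>The 2-spin system\<close>

definition simple_graph :: "nat set \<Rightarrow> nat set set \<Rightarrow> bool" where
  "simple_graph V E \<longleftrightarrow> finite V \<and> (\<forall>e\<in>E. e \<subseteq> V \<and> card e = 2)"

definition vdegree :: "nat set set \<Rightarrow> nat \<Rightarrow> nat" where
  "vdegree E v = card {e \<in> E. v \<in> e}"

text \<open>Configurations are functions \<open>V \<rightarrow> {0, 1}\<close>, extended by \<open>undefined\<close> outside \<open>V\<close>.\<close>

definition configs :: "nat set \<Rightarrow> (nat \<Rightarrow> nat) set" where
  "configs V = V \<rightarrow>\<^sub>E {0, 1}"

definition mono_edges :: "nat set set \<Rightarrow> nat \<Rightarrow> (nat \<Rightarrow> nat) \<Rightarrow> nat" where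
  "mono_edges E s \<sigma> = card {e \<in> E. \<forall>v\<in>e. \<sigma> v = s}"

definition spin_weight ::
  "nat set \<Rightarrow> nat set set \<Rightarrow> real \<Rightarrow> real \<Rightarrow> real \<Rightarrow> (nat \<Rightarrow> nat) \<Rightarrow> real" where
  "spin_weight V E \<beta> \<gamma> lam \<sigma> =
     \<beta> ^ mono_edges E 1 \<sigma> * \<gamma> ^ mono_edges E 0 \<sigma> * lam ^ card {v \<in> V. \<sigma> v = 1}"

definition partition_fun :: "nat set \<Rightarrow> nat set set \<Rightarrow> real \<Rightarrow> real \<Rightarrow> real \<Rightarrow> real" where
  "partition_fun V E \<beta> \<gamma> lam = (\<Sum>\<sigma>\<in>configs V. spin_weight V E \<beta> \<gamma> lam \<sigma>)"

definition gibbs :: "nat set \<Rightarrow> nat set set \<Rightarrow> real \<Rightarrow> real \<Rightarrow> real \<Rightarrow> (nat \<Rightarrow> nat) pmf" where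
  "gibbs V E \<beta> \<gamma> lam = embed_pmf (\<lambda>\<sigma>.
     if \<sigma> \<in> configs V then spin_weight V E \<beta> \<gamma> lam \<sigma> / partition_fun V E \<beta> \<gamma> lam else 0)"

lemma finite_configs: "finite V \<Longrightarrow> finite (configs V)"
  by (auto simp: configs_def intro: finite_PiE)

lemma partition_fun_pos:
  assumes "simple_graph V E" "0 \<le> \<beta>" "0 < \<gamma>" "0 < lam"
  shows "0 < partition_fun V E \<beta> \<gamma> lam"
proof -
  define z where "z = (\<lambda>v. if v \<in> V then 0 else undefined :: nat)"
  have z: "z \<in> configs V" by (auto simp: z_def configs_def)
  have none: "{e \<in> E. \<forall>v\<in>e. z v = 1} = {}"
  proof -
    have "\<exists>v\<in>e. z v \<noteq> 1" if "e \<in> E" for e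
    proof -
      have "e \<subseteq> V" "e \<noteq> {}" using assms(1) that by (auto simp: simple_graph_def)
      then show ?thesis by (auto simp: z_def)
    qed
    then show ?thesis by auto
  qed
  have "0 < spin_weight V E \<beta> \<gamma> lam z"
    unfolding spin_weight_def mono_edges_def none using assms by simp
  moreover have "0 \<le> spin_weight V E \<beta> \<gamma> lam \<sigma>" for \<sigma>
    using assms by (simp add: spin_weight_def)
  ultimately show ?thesis
    unfolding partition_fun_def using assms(1) z
    by (intro sum_pos2[of _ z]) (auto simp: simple_graph_def finite_configs)
qed

lemma pmf_gibbs:
  assumes "simple_graph V E" "0 \<le> \<beta>" "0 < \<gamma>" "0 < lam"
  shows "pmf (gibbs V E \<beta> \<gamma> lam) \<sigma> =
    (if \<sigma> \<in> configs V then spin_weight V E \<beta> \<gamma> lam \<sigma> / partition_fun V E \<beta> \<gamma> lam else 0)"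
proof -
  let ?p = "\<lambda>\<sigma>. if \<sigma> \<in> configs V
    then spin_weight V E \<beta> \<gamma> lam \<sigma> / partition_fun V E \<beta> \<gamma> lam else 0"
  have Z: "0 < partition_fun V E \<beta> \<gamma> lam" using assms by (rule partition_fun_pos)
  have nonneg: "0 \<le> ?p \<tau>" for \<tau> using assms Z by (simp add: spin_weight_def)
  have fin: "finite (configs V)" using assms(1) by (auto simp: simple_graph_def finite_configs)
  have "(\<integral>\<^sup>+\<tau>. ennreal (?p \<tau>) \<partial>count_space UNIV) = (\<Sum>\<tau>\<in>configs V. ennreal (?p \<tau>))"
    by (rule nn_integral_count_space'[OF fin]) auto
  also have "\<dots> = ennreal (\<Sum>\<tau>\<in>configs V. ?p \<tau>)"
    by (rule sum_ennreal) (rule nonneg)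
  also have "(\<Sum>\<tau>\<in>configs V. ?p \<tau>) = 1"
    using Z by (simp add: partition_fun_def flip: sum_divide_distrib)
  finally show ?thesis
    unfolding gibbs_def using nonneg by (subst pmf_embed_pmf) auto
qed

section \<open>Glauber dynamics and mixing time\<close>

text \<open>Resampling the spin at \<open>v\<close> given all other spins of \<open>\<sigma>\<close> amounts to drawing a
  configuration from the Gibbs distribution conditioned on agreeing with \<open>\<sigma>\<close> off \<open>v\<close>.
  The conditioning event has positive probability whenever \<open>\<sigma>\<close> is in the support of the
  Gibbs distribution, and the chain never leaves this support.\<close>

definition glauber_step ::
  "nat set \<Rightarrow> nat set set \<Rightarrow> real \<Rightarrow> real \<Rightarrow> real \<Rightarrow> (nat \<Rightarrow> nat) \<Rightarrow> (nat \<Rightarrow> nat) pmf" where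
  "glauber_step V E \<beta> \<gamma> lam \<sigma> = bind_pmf (pmf_of_set V)
     (\<lambda>v. cond_pmf (gibbs V E \<beta> \<gamma> lam) {\<tau>. \<forall>u\<in>V - {v}. \<tau> u = \<sigma> u})"

definition iterate_kernel :: "('s \<Rightarrow> 's pmf) \<Rightarrow> nat \<Rightarrow> 's \<Rightarrow> 's pmf" where
  "iterate_kernel P t x = ((\<lambda>p. bind_pmf p P) ^^ t) (return_pmf x)"

definition tv_dist :: "'s pmf \<Rightarrow> 's pmf \<Rightarrow> real" where
  "tv_dist p q = (SUP A. \<bar>measure_pmf.prob p A - measure_pmf.prob q A\<bar>)"

text \<open>The state space is the support of the Gibbs distribution (for \<open>\<beta> = 0\<close> the conditional
  distributions are not defined at arbitrary configurations). A chain that does not mix has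
  mixing time \<open>\<infinity>\<close>.\<close>

definition mixing_time :: "nat set \<Rightarrow> nat set set \<Rightarrow> real \<Rightarrow> real \<Rightarrow> real \<Rightarrow> enat" where
  "mixing_time V E \<beta> \<gamma> lam =
     (SUP x\<in>set_pmf (gibbs V E \<beta> \<gamma> lam).
        INF t\<in>{t. tv_dist (iterate_kernel (glauber_step V E \<beta> \<gamma> lam) t x)
                            (gibbs V E \<beta> \<gamma> lam) \<le> 1/4}. enat t)"

section \<open>The tree recursion on the extended reals\<close>

definition log_ext :: "real \<Rightarrow> ereal" where
  "log_ext x = (if x = 0 then -\<infinity> else ereal (ln x))"

text \<open>The value of \<open>(\<beta> e\<^sup>y + 1) / (e\<^sup>y + \<gamma>)\<close>, by its limit at \<open>y = \<plusminus>\<infinity>\<close>.\<close>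

definition edge_ratio :: "real \<Rightarrow> real \<Rightarrow> ereal \<Rightarrow> real" where
  "edge_ratio \<beta> \<gamma> y = (case y of
       ereal x \<Rightarrow> (\<beta> * exp x + 1) / (exp x + \<gamma>)
     | PInfty \<Rightarrow> \<beta>
     | MInfty \<Rightarrow> 1 / \<gamma>)"

definition tree_rec :: "real \<Rightarrow> real \<Rightarrow> real \<Rightarrow> nat \<Rightarrow> (nat \<Rightarrow> ereal) \<Rightarrow> ereal" where
  "tree_rec \<beta> \<gamma> lam d y = log_ext lam + (\<Sum>i=1..d. log_ext (edge_ratio \<beta> \<gamma> (y i)))"

definition h_fun :: "real \<Rightarrow> real \<Rightarrow> real \<Rightarrow> real" where
  "h_fun \<beta> \<gamma> y = - ((1 - \<beta> * \<gamma>) * exp y) / ((\<beta> * exp y + 1) * (exp y + \<gamma>))"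

definition J_int :: "real \<Rightarrow> real \<Rightarrow> real \<Rightarrow> nat \<Rightarrow> ereal set" where
  "J_int \<beta> \<gamma> lam d =
     (let a = log_ext (lam * \<beta> ^ d); b = log_ext (lam / \<gamma> ^ d) in {min a b..max a b})"

section \<open>General potential functions\<close>

text \<open>Since \<open>\<Psi>\<close> is real-valued (hence bounded) and increasing on \<open>[-\<infinity>, \<infinity>]\<close>, the only value by
  which its derivative could extend continuously to \<open>\<plusminus>\<infinity>\<close> is 0.\<close>

definition pot_deriv :: "(ereal \<Rightarrow> real) \<Rightarrow> ereal \<Rightarrow> real" where
  "pot_deriv \<Psi> y = (case y of
       ereal x \<Rightarrow> deriv (\<lambda>t. \<Psi> (ereal t)) x
     | PInfty \<Rightarrow> 0
     | MInfty \<Rightarrow> 0)"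

text \<open>The quotients \<open>\<psi>(\<cdot>) / \<psi>(y) * \<bar>h(y)\<bar>\<close> are of the form 0/0 at \<open>y = \<plusminus>\<infinity>\<close>, where they are
  read as limits in \<open>y\<close>; the upper limit is used so that existence need not be assumed.\<close>

definition at_ext :: "(real \<Rightarrow> real) \<Rightarrow> ereal \<Rightarrow> ereal" where
  "at_ext F y = (case y of
       ereal x \<Rightarrow> ereal (F x)
     | PInfty \<Rightarrow> Limsup at_top (\<lambda>x. ereal (F x))
     | MInfty \<Rightarrow> Limsup at_bot (\<lambda>x. ereal (F x)))"

definition contraction_term ::
  "real \<Rightarrow> real \<Rightarrow> real \<Rightarrow> (ereal \<Rightarrow> real) \<Rightarrow> nat \<Rightarrow> (nat \<Rightarrow> ereal) \<Rightarrow> nat \<Rightarrow> ereal" where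
  "contraction_term \<beta> \<gamma> lam \<Psi> d y i =
     at_ext (\<lambda>x. pot_deriv \<Psi> (tree_rec \<beta> \<gamma> lam d (y(i := ereal x))) / pot_deriv \<Psi> (ereal x)
               * \<bar>h_fun \<beta> \<gamma> x\<bar>) (y i)"

definition boundedness_term ::
  "real \<Rightarrow> real \<Rightarrow> (ereal \<Rightarrow> real) \<Rightarrow> ereal \<Rightarrow> ereal \<Rightarrow> ereal" where
  "boundedness_term \<beta> \<gamma> \<Psi> y1 y2 =
     at_ext (\<lambda>x. pot_deriv \<Psi> y2 / pot_deriv \<Psi> (ereal x) * \<bar>h_fun \<beta> \<gamma> x\<bar>) y1"

text \<open>Positivity of the derivative at finite points is what makes the quotients meaningful
  (every real number occurs as some \<open>y\<^sub>i\<close> in the contraction condition); without it, division by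
  zero would make the conditions void at critical points of \<open>\<Psi>\<close>.\<close>

definition general_potential ::
  "enat \<Rightarrow> real \<Rightarrow> real \<Rightarrow> real \<Rightarrow> real \<Rightarrow> real \<Rightarrow> (ereal \<Rightarrow> real) \<Rightarrow> bool" where
  "general_potential \<Delta> \<beta> \<gamma> lam \<alpha> c \<Psi> \<longleftrightarrow>
     strict_mono \<Psi> \<and> continuous_on UNIV \<Psi> \<and>
     (\<forall>x. (\<lambda>t. \<Psi> (ereal t)) differentiable (at x)) \<and>
     (\<forall>x. 0 < pot_deriv \<Psi> (ereal x)) \<and>
     (\<forall>d::nat. 1 \<le> d \<and> enat d < \<Delta> \<longrightarrow>
        (\<forall>z. (\<forall>i\<in>{1..d}. z i \<in> range \<Psi>) \<longrightarrow>
           (\<Sum>i=1..d. contraction_term \<beta> \<gamma> lam \<Psi> d (\<lambda>j. inv \<Psi> (z j)) i) \<le> ereal (1 - \<alpha>))) \<and>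
     (\<forall>d1 d2::nat. enat d1 < \<Delta> \<and> enat d2 < \<Delta> \<longrightarrow>
        (\<forall>y1\<in>J_int \<beta> \<gamma> lam d1. \<forall>y2\<in>J_int \<beta> \<gamma> lam d2.
           boundedness_term \<beta> \<gamma> \<Psi> y1 y2 \<le> ereal (2 * c / (real d1 + real d2 + 2))))"

end

theory Submission
  imports Defs
begin

text \<open>Encode a configuration by its set of ones. Pinning a vertex to 1 multiplies the fields of
  its neighbours by \<open>\<beta> \<gamma>\<close>, pinning it to 0 deletes it, so the weights of the system with arbitrary
  pinnings form a family closed under conditioning. Exposing the neighbours of a root one by one to
  a change of its spin expresses the influence of the root through influences of its neighbours
  in the smaller system. The contraction condition turns this recursion into a geometric series, and
  general boundedness at its two ends gives \<open>\<Sum>\<^sub>v \<omega> v \<bar>I(r, v)\<bar> \<le> (2 c / \<alpha>) \<omega> r\<close> with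
  \<open>\<omega> = max 1 deg\<close> for the influences \<open>I\<close> under every pinning.

  By AM-GM and duality, such a bound with constant \<open>\<eta>\<close> implies that conditioning on one uniformly
  random spin among \<open>n\<close> removes in expectation at most the fraction \<open>(1 + \<eta>) / n\<close> of a variance.
  Conditioning on one spin after the other loses the product of the factors
  \<open>(k - 1) / (k - 1 - \<eta>)\<close>, which is \<open>O(n\<^sup>\<eta>)\<close>, and so the spectral gap is at least of order
  \<open>n\<^sup>-\<^sup>1\<^sup>-\<^sup>\<eta>\<close>. The small values of \<open>k\<close> are covered by a crude bound
  that only uses that spin 0 has conditional probability bounded away from 0.\<close>

section \<open>Variance decomposition\<close>

text \<open>All weights are unnormalised set functions. Conditioning on the spin of \<open>u\<close>
  is restriction to \<open>Pow (U - {u})\<close> or composition with \<open>insert u\<close>,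
  decompositions of variances become plain sums, and an infeasible pinning, possible for \<beta> =
  0, is just the weight 0.

  The root of the influence recursion may have \<Delta> free neighbours, one more than the
  contraction condition covers. So its first level is unfolded separately, and contraction is
  applied only to vertices that have lost their parent. The number of children of the root is what
  makes degrees the natural weights.

  Passing from the gap to the mixing time costs the logarithm of the inverse probability of the
  starting point. This should be O(n), but for unbounded degrees it can be of order n^2, which would
  raise the exponent by one. A Lyapunov function that weighs the ones by their degrees shows that
  n^2 steps lead to typical configurations, for which the cost is O(n) again. This keeps the
  exponent at 2 + \<eta>.\<close>

definition tot :: "'a set \<Rightarrow> ('a set \<Rightarrow> real) \<Rightarrow> real" where
  "tot U w = sum w (Pow U)"

definition wsum :: "'a set \<Rightarrow> ('a set \<Rightarrow> real) \<Rightarrow> ('a set \<Rightarrow> real) \<Rightarrow> real" where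
  "wsum U w f = (\<Sum>A\<in>Pow U. w A * f A)"

definition wmean :: "'a set \<Rightarrow> ('a set \<Rightarrow> real) \<Rightarrow> ('a set \<Rightarrow> real) \<Rightarrow> real" where
  "wmean U w f = wsum U w f / tot U w"

text \<open>The covariance times the total weight. Without normalisation the contributions of the
  two spins of a vertex add up with no mixing coefficients. For a nonnegative weight of total 0 the
  value is 0.\<close>

definition wcov ::
  "'a set \<Rightarrow> ('a set \<Rightarrow> real) \<Rightarrow> ('a set \<Rightarrow> real) \<Rightarrow> ('a set \<Rightarrow> real) \<Rightarrow> real" where
  "wcov U w f g = wsum U w (\<lambda>A. f A * g A) - wsum U w f * wsum U w g / tot U w"

abbreviation wvar :: "'a set \<Rightarrow> ('a set \<Rightarrow> real) \<Rightarrow> ('a set \<Rightarrow> real) \<Rightarrow> real" where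
  "wvar U w f \<equiv> wcov U w f f"

text \<open>For \<open>f = occ v\<close> this is the influence I(u, v): the effect of the spin of
  \<open>u\<close> on the probability of spin 1 at \<open>v\<close>.\<close>

definition mean_diff ::
  "'a set \<Rightarrow> ('a set \<Rightarrow> real) \<Rightarrow> 'a \<Rightarrow> ('a set \<Rightarrow> real) \<Rightarrow> real" where
  "mean_diff U w u f =
     wmean (U - {u}) (w \<circ> insert u) (f \<circ> insert u) - wmean (U - {u}) w f"

text \<open>a b / (a + b) = (a + b) p (1 - p) with p = b / (a + b): the variance of
  \<open>occ u\<close> times the total weight. For nonnegative weights it is positive exactly if
  both spins of \<open>u\<close> are possible.\<close>

definition spin_var :: "'a set \<Rightarrow> ('a set \<Rightarrow> real) \<Rightarrow> 'a \<Rightarrow> real" where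
  "spin_var U w u = tot (U - {u}) w * tot (U - {u}) (w \<circ> insert u)
     / (tot (U - {u}) w + tot (U - {u}) (w \<circ> insert u))"

definition occ :: "'a \<Rightarrow> 'a set \<Rightarrow> real" where
  "occ v A = of_bool (v \<in> A)"

text \<open>Each summand is the unnormalised variance of \<open>f\<close> when \<open>v\<close> is
  resampled while the other spins are held at \<open>A\<close>.\<close>

definition dirich :: "'a \<Rightarrow> 'a set \<Rightarrow> ('a set \<Rightarrow> real) \<Rightarrow> ('a set \<Rightarrow> real) \<Rightarrow> real" where
  "dirich v U w f = (\<Sum>A\<in>Pow (U - {v}).
     w A * w (insert v A) / (w A + w (insert v A)) * (f (insert v A) - f A)\<^sup>2)"

lemma sum_Pow_split:
  assumes "finite U" "u \<in> U"
  shows "sum F (Pow U) = (\<Sum>A\<in>Pow (U - {u}). F A + F (insert u A))"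
proof -
  have U: "U = insert u (U - {u})" using assms by auto
  have inj: "inj_on (insert u) (Pow (U - {u}))" by (auto simp: inj_on_def)
  have "sum F (Pow U) = sum F (Pow (U - {u}) \<union> insert u ` Pow (U - {u}))"
    using Pow_insert[of u "U - {u}"] U by argo
  also have "\<dots> = sum F (Pow (U - {u})) + sum F (insert u ` Pow (U - {u}))"
    using assms by (intro sum.union_disjoint) auto
  also have "sum F (insert u ` Pow (U - {u})) = (\<Sum>A\<in>Pow (U - {u}). F (insert u A))"
    using inj by (simp add: sum.reindex)
  finally show ?thesis by (simp add: sum.distrib)
qed

lemma tot_split:
  assumes "finite U" "u \<in> U"
  shows "tot U w = tot (U - {u}) w + tot (U - {u}) (w \<circ> insert u)"
  using assms by (simp add: tot_def sum_Pow_split sum.distrib)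

lemma wsum_split:
  assumes "finite U" "u \<in> U"
  shows "wsum U w f = wsum (U - {u}) w f + wsum (U - {u}) (w \<circ> insert u) (f \<circ> insert u)"
  using assms by (simp add: wsum_def sum_Pow_split sum.distrib)

lemma tot_nonneg: "(\<And>A. A \<subseteq> U \<Longrightarrow> 0 \<le> w A) \<Longrightarrow> 0 \<le> tot U w"
  by (auto simp: tot_def intro!: sum_nonneg)

lemma wsum_mono:
  assumes "\<And>A. A \<subseteq> U \<Longrightarrow> 0 \<le> w A" "\<And>A. A \<subseteq> U \<Longrightarrow> f A \<le> g A"
  shows "wsum U w f \<le> wsum U w g"
  using assms by (auto simp: wsum_def intro!: sum_mono mult_left_mono)

lemma tot_eq_0:
  assumes "finite U" "\<And>A. A \<subseteq> U \<Longrightarrow> 0 \<le> w A" "tot U w = 0" "A \<subseteq> U"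
  shows "w A = 0"
proof -
  have "\<forall>A\<in>Pow U. w A = 0"
    using assms by (subst sum_nonneg_eq_0_iff[symmetric]) (auto simp: tot_def)
  with assms show ?thesis by auto
qed

lemma wsum_eq_0:
  assumes "finite U" "\<And>A. A \<subseteq> U \<Longrightarrow> 0 \<le> w A" "tot U w = 0"
  shows "wsum U w f = 0"
  using tot_eq_0[OF assms] by (auto simp: wsum_def)

lemma wsum_sum: "wsum U w (\<lambda>A. \<Sum>i\<in>I. f i A) = (\<Sum>i\<in>I. wsum U w (f i))"
  unfolding wsum_def by (simp add: sum_distrib_left) (rule sum.swap)

lemma wsum_diff: "wsum U w (\<lambda>A. f A - g A) = wsum U w f - wsum U w g"
  by (simp add: wsum_def algebra_simps sum_subtractf)

lemma wsum_add: "wsum U w (\<lambda>A. f A + g A) = wsum U w f + wsum U w g"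
  by (simp add: wsum_def algebra_simps sum.distrib)

lemma wsum_cmult: "wsum U w (\<lambda>A. c * f A) = c * wsum U w f"
  by (simp add: wsum_def sum_distrib_left algebra_simps)

lemma wsum_const: "wsum U w (\<lambda>A. c) = c * tot U w"
  by (simp add: wsum_def tot_def sum_distrib_left mult.commute)

lemma wsum_sq_dev:
  "wsum U w (\<lambda>A. (f A - c)\<^sup>2) = wsum U w (\<lambda>A. f A * f A) - 2 * c * wsum U w f + c\<^sup>2 * tot U w"
proof -
  have "(\<lambda>A. (f A - c)\<^sup>2) = (\<lambda>A. (f A * f A - (2 * c) * f A) + c\<^sup>2)"
    by (auto simp: power2_eq_square algebra_simps)
  then show ?thesis
    by (simp only: wsum_add wsum_diff wsum_cmult wsum_const)
qed

lemma wvar_eq_dev: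
  assumes "finite U" "\<And>A. A \<subseteq> U \<Longrightarrow> 0 \<le> w A"
  shows "wvar U w f = wsum U w (\<lambda>A. (f A - wmean U w f)\<^sup>2)"
proof (cases "tot U w = 0")
  case True
  then show ?thesis using wsum_eq_0[OF assms] by (simp add: wcov_def)
next
  case False
  then show ?thesis
    unfolding wsum_sq_dev wcov_def wmean_def by (simp add: field_simps power2_eq_square)
qed

lemma wvar_le_dev:
  assumes "finite U" "\<And>A. A \<subseteq> U \<Longrightarrow> 0 \<le> w A"
  shows "wvar U w f \<le> wsum U w (\<lambda>A. (f A - c)\<^sup>2)"
proof (cases "tot U w = 0")
  case True
  then show ?thesis using wsum_eq_0[OF assms] by (simp add: wcov_def)
next
  case False
  then have pos: "0 < tot U w" using tot_nonneg[of U w] assms by (simp add: less_le)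
  have "wsum U w (\<lambda>A. (f A - c)\<^sup>2) - wvar U w f = (wsum U w f - c * tot U w)\<^sup>2 / tot U w"
    unfolding wsum_sq_dev wcov_def using False by (simp add: field_simps power2_eq_square)
  also have "\<dots> \<ge> 0" using pos by simp
  finally show ?thesis by simp
qed

lemma wvar_nonneg:
  assumes "finite U" "\<And>A. A \<subseteq> U \<Longrightarrow> 0 \<le> w A"
  shows "0 \<le> wvar U w f"
proof -
  have "0 \<le> wsum U w (\<lambda>A. (f A - wmean U w f)\<^sup>2)"
    unfolding wsum_def using assms by (auto intro!: sum_nonneg)
  then show ?thesis using wvar_eq_dev[of U w f] assms by simp
qed

lemma wcov_commute: "wcov U w f g = wcov U w g f"
  by (simp add: wcov_def mult.commute)

lemma wcov_sum_right: "wcov U w f (\<lambda>A. \<Sum>i\<in>I. g i A) = (\<Sum>i\<in>I. wcov U w f (g i))"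
  by (simp add: wcov_def sum_distrib_left wsum_sum sum_subtractf sum_divide_distrib)

lemma wcov_cmult_right: "wcov U w f (\<lambda>A. c * g A) = c * wcov U w f g"
proof -
  have "(\<lambda>A. f A * (c * g A)) = (\<lambda>A. c * (f A * g A))" by (auto simp: algebra_simps)
  then show ?thesis by (simp add: wcov_def wsum_cmult algebra_simps)
qed

lemma wvar_diff_cmult:
  "wvar U w (\<lambda>A. f A - t * g A) = wvar U w f - 2 * t * wcov U w f g + t\<^sup>2 * wvar U w g"
proof -
  have "(\<lambda>A. (f A - t * g A) * (f A - t * g A)) =
      (\<lambda>A. (f A * f A - (2 * t) * (f A * g A)) + t\<^sup>2 * (g A * g A))"
    by (auto simp: power2_eq_square algebra_simps)
  then show ?thesis
    unfolding wcov_def by (simp only: wsum_add wsum_diff wsum_cmult)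
      (simp add: algebra_simps power2_eq_square diff_divide_distrib add_divide_distrib)
qed

text \<open>Law of total variance for the partition by the spin of \<open>u\<close>; the last term
  is the variance between the two classes.\<close>

lemma total_variance:
  assumes "finite U" "u \<in> U" "\<And>A. A \<subseteq> U \<Longrightarrow> 0 \<le> w A"
  shows "wvar U w f = wvar (U - {u}) w f + wvar (U - {u}) (w \<circ> insert u) (f \<circ> insert u)
    + spin_var U w u * (mean_diff U w u f)\<^sup>2"
proof -
  define a b where "a = tot (U - {u}) w" and "b = tot (U - {u}) (w \<circ> insert u)"
  define s t where "s = wsum (U - {u}) w f"
    and "t = wsum (U - {u}) (w \<circ> insert u) (f \<circ> insert u)"
  have a0: "0 \<le> a" "0 \<le> b" unfolding a_def b_def using assms
    by (auto intro!: tot_nonneg simp: subset_Diff_insert)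
  \<comment> \<open>A class of total weight 0 has weighted sum 0, so the quotients by zero below
    take the right value.\<close>
  have za: "a = 0 \<Longrightarrow> s = 0" unfolding a_def s_def using assms by (intro wsum_eq_0) auto
  have zb: "b = 0 \<Longrightarrow> t = 0" unfolding b_def t_def using assms
    by (intro wsum_eq_0) (auto simp: subset_Diff_insert)
  have key: "- ((s + t) * (s + t) / (a + b)) = - (s * s / a) - (t * t / b)
      + a * b / (a + b) * (t / b - s / a)\<^sup>2"
  proof (cases "a = 0 \<or> b = 0")
    case True then show ?thesis using za zb by auto
  next
    case False
    then have "0 < a" "0 < b" using a0 by auto
    then have "a + b \<noteq> 0" "a \<noteq> 0" "b \<noteq> 0" by auto
    then show ?thesis
      by (simp add: divide_simps) (simp add: power2_eq_square algebra_simps)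
  qed
  show ?thesis
    unfolding wcov_def spin_var_def mean_diff_def wmean_def
    using key assms(1,2) by (simp add: wsum_split[of U u] tot_split[of U u] o_def
      flip: a_def b_def s_def t_def)
      (simp add: a_def b_def s_def t_def o_def)
qed

text \<open>\<open>occ u\<close> is constant on either class of the partition by the spin of
  \<open>u\<close>, so it is correlated with \<open>f\<close> only through the two class
  means.\<close>

lemma wcov_occ:
  assumes "finite U" "u \<in> U" "\<And>A. A \<subseteq> U \<Longrightarrow> 0 \<le> w A"
  shows "wcov U w f (occ u) = spin_var U w u * mean_diff U w u f"
proof -
  define a b where "a = tot (U - {u}) w" and "b = tot (U - {u}) (w \<circ> insert u)"
  define s t where "s = wsum (U - {u}) w f"
    and "t = wsum (U - {u}) (w \<circ> insert u) (f \<circ> insert u)"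
  have a0: "0 \<le> a" "0 \<le> b" unfolding a_def b_def using assms
    by (auto intro!: tot_nonneg simp: subset_Diff_insert)
  have za: "a = 0 \<Longrightarrow> s = 0" unfolding a_def s_def using assms by (intro wsum_eq_0) auto
  have zb: "b = 0 \<Longrightarrow> t = 0" unfolding b_def t_def using assms
    by (intro wsum_eq_0) (auto simp: subset_Diff_insert)
  have key: "t - (s + t) * b / (a + b) = a * b / (a + b) * (t / b - s / a)"
  proof (cases "a = 0 \<or> b = 0")
    case True then show ?thesis using za zb by auto
  next
    case False
    then have "0 < a" "0 < b" using a0 by auto
    then have "a + b \<noteq> 0" "a \<noteq> 0" "b \<noteq> 0" by auto
    then show ?thesis by (simp add: divide_simps) (simp add: algebra_simps)
  qed
  have 1: "wsum U w (\<lambda>A. f A * occ u A) = t"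
    using assms(1,2) by (subst wsum_split[of U u]) (auto simp: wsum_def t_def occ_def intro!: sum.neutral)
  have 2: "wsum U w (occ u) = b"
    using assms(1,2) by (subst wsum_split[of U u])
      (auto simp: wsum_def b_def tot_def occ_def intro!: sum.neutral)
  have 3: "wsum U w f = s + t" "tot U w = a + b"
    using assms(1,2) by (auto simp: wsum_split[of U u] tot_split[of U u] a_def b_def s_def t_def)
  show ?thesis
    unfolding wcov_def 1 2 3 key spin_var_def mean_diff_def wmean_def
    by (simp add: a_def b_def s_def t_def)
qed

lemma dirich_nonneg:
  assumes "v \<in> U" "\<And>A. A \<subseteq> U \<Longrightarrow> 0 \<le> w A"
  shows "0 \<le> dirich v U w f"
  unfolding dirich_def using assms
  by (intro sum_nonneg mult_nonneg_nonneg divide_nonneg_nonneg add_nonneg_nonneg)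
    (auto simp: subset_Diff_insert)

lemma dirich_split:
  assumes "finite U" "u \<in> U" "v \<in> U" "u \<noteq> v"
  shows "dirich v U w f
    = dirich v (U - {u}) w f + dirich v (U - {u}) (w \<circ> insert u) (f \<circ> insert u)"
proof -
  have *: "U - {v} - {u} = U - {u} - {v}" by auto
  show ?thesis
    unfolding dirich_def using assms
    by (subst sum_Pow_split[of _ u]) (auto simp: * sum.distrib insert_commute)
qed

text \<open>Duality: \<open>f\<close> is tested against the linear statistic \<open>g\<close> whose coefficients are the
  effects of the single spins on the mean of \<open>f\<close>.\<close>

lemma influence_bound_imp_variance_bound:
  fixes \<omega> :: "'a \<Rightarrow> real"
  assumes fin: "finite U" and w: "\<And>A. A \<subseteq> U \<Longrightarrow> 0 \<le> w A" and "0 \<le> \<eta>"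
    and \<omega>: "\<And>v. v \<in> U \<Longrightarrow> 0 < \<omega> v"
    and infl: "\<And>u. u \<in> U \<Longrightarrow> 0 < spin_var U w u \<Longrightarrow>
      (\<Sum>v\<in>U - {u}. \<omega> v * \<bar>mean_diff U w u (occ v)\<bar>) \<le> \<eta> * \<omega> u"
  shows "(\<Sum>u\<in>U. spin_var U w u * (mean_diff U w u f)\<^sup>2) \<le> (1 + \<eta>) * wvar U w f"
proof -
  let ?K = "spin_var U w" and ?b = "\<lambda>u. mean_diff U w u f"
  let ?c = "\<lambda>u v. wcov U w (occ u) (occ v)"
  define g where "g = (\<lambda>A. \<Sum>u\<in>U. ?b u * occ u A)"
  define S where "S = (\<Sum>u\<in>U. ?K u * (?b u)\<^sup>2)"
  have K0: "0 \<le> ?K u" if "u \<in> U" for u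
    unfolding spin_var_def using w that
    by (intro divide_nonneg_nonneg mult_nonneg_nonneg add_nonneg_nonneg tot_nonneg)
      (auto simp: subset_Diff_insert)
  have c: "?c v u = ?K u * mean_diff U w u (occ v)" if "u \<in> U" for u v
    using wcov_occ[OF fin that w] by simp
  have diag: "?c u u = ?K u" if u: "u \<in> U" for u
  proof (cases "?K u = 0")
    case False
    have "wmean (U - {u}) w (occ u) = 0"
      by (auto simp: wmean_def wsum_def occ_def intro!: sum.neutral)
    moreover have "wmean (U - {u}) (w \<circ> insert u) (occ u \<circ> insert u) = 1"
      using False by (simp add: wmean_def occ_def o_def wsum_const spin_var_def)
    ultimately show ?thesis using c[OF u] by (simp add: mean_diff_def)
  qed (use c[OF u] in simp)
  have Sg: "wcov U w f g = S"
    unfolding g_def wcov_sum_right wcov_cmult_right S_def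
    using wcov_occ[OF fin _ w] by (intro sum.cong) (auto simp: power2_eq_square)
  have vg: "wvar U w g = (\<Sum>u\<in>U. \<Sum>v\<in>U. ?b u * ?b v * ?c u v)"
  proof -
    have "wvar U w g = (\<Sum>u\<in>U. ?b u * wcov U w g (occ u))"
      by (subst (2) g_def) (simp add: wcov_sum_right wcov_cmult_right)
    also have "\<dots> = (\<Sum>u\<in>U. ?b u * wcov U w (occ u) g)" by (simp add: wcov_commute)
    also have "\<dots> = (\<Sum>u\<in>U. \<Sum>v\<in>U. ?b u * ?b v * ?c u v)"
      unfolding g_def by (simp add: wcov_sum_right wcov_cmult_right sum_distrib_left mult.assoc)
    finally show ?thesis .
  qed
  \<comment> \<open>AM-GM with weight \<omega> v / \<omega> u: the symmetric covariance is charged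
    half to row \<open>u\<close> and half to row \<open>v\<close>, so that bounds on weighted row
    sums suffice.\<close>
  have amgm: "?b u * ?b v * ?c u v \<le> ((?b u)\<^sup>2 * (\<omega> v / \<omega> u) * \<bar>?c u v\<bar>
      + (?b v)\<^sup>2 * (\<omega> u / \<omega> v) * \<bar>?c v u\<bar>) / 2" if "u \<in> U" "v \<in> U" for u v
  proof -
    have p: "0 < \<omega> v / \<omega> u" using \<omega> that by simp
    define q where "q = \<omega> v / \<omega> u"
    have q: "0 < q" "\<omega> u / \<omega> v = 1 / q" using p by (auto simp: q_def)
    have sq: "(q * x - y)\<^sup>2 / q = x\<^sup>2 * q + y\<^sup>2 * (1 / q) - 2 * (x * y)" for x y :: real
      using q by (simp add: power2_diff power_mult_distrib diff_divide_distrib add_divide_distrib)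
        (simp add: power2_eq_square)
    have "0 \<le> (q * \<bar>?b u\<bar> - \<bar>?b v\<bar>)\<^sup>2 / q" using q by simp
    also have "\<dots> = (?b u)\<^sup>2 * q + (?b v)\<^sup>2 * (1 / q) - 2 * \<bar>?b u * ?b v\<bar>"
      unfolding sq by (simp add: abs_mult)
    finally have "2 * \<bar>?b u * ?b v\<bar> * \<bar>?c u v\<bar> \<le> ((?b u)\<^sup>2 * q + (?b v)\<^sup>2 * (1 / q)) * \<bar>?c u v\<bar>"
      by (intro mult_right_mono) auto
    moreover have "?b u * ?b v * ?c u v \<le> \<bar>?b u * ?b v\<bar> * \<bar>?c u v\<bar>"
      by (metis abs_ge_self abs_mult)
    ultimately show ?thesis
      unfolding q(2) by (simp add: wcov_commute[of U w "occ v"] flip: q_def) (simp add: algebra_simps)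
  qed
  have row: "(\<Sum>v\<in>U - {u}. (?b u)\<^sup>2 * (\<omega> v / \<omega> u) * \<bar>?c u v\<bar>) \<le> \<eta> * (?K u * (?b u)\<^sup>2)"
    if u: "u \<in> U" for u
  proof (cases "?K u = 0")
    case True
    then show ?thesis using c[OF u] by (simp add: wcov_commute[of U w "occ u"])
  next
    case False
    then have K: "0 < ?K u" using K0[OF u] by simp
    have "(\<Sum>v\<in>U - {u}. (?b u)\<^sup>2 * (\<omega> v / \<omega> u) * \<bar>?c u v\<bar>)
      = (?b u)\<^sup>2 * ?K u / \<omega> u * (\<Sum>v\<in>U - {u}. \<omega> v * \<bar>mean_diff U w u (occ v)\<bar>)"
      unfolding sum_distrib_left
      using K c[OF u] by (intro sum.cong refl) (simp add: wcov_commute[of U w "occ u"] abs_mult)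
    also have "\<dots> \<le> (?b u)\<^sup>2 * ?K u / \<omega> u * (\<eta> * \<omega> u)"
      using infl[OF u K] \<omega>[OF u] K by (intro mult_left_mono) auto
    also have "\<dots> = \<eta> * (?K u * (?b u)\<^sup>2)" using \<omega>[OF u] by simp
    finally show ?thesis .
  qed
  have swap: "(\<Sum>u\<in>U. \<Sum>v\<in>U - {u}. F u v) = (\<Sum>u\<in>U. \<Sum>v\<in>U - {u}. F v u)"
    for F :: "'a \<Rightarrow> 'a \<Rightarrow> real"
  proof -
    have e: "(\<Sum>v\<in>U - {u}. F u v) = (\<Sum>v\<in>U. of_bool (u \<noteq> v) * F u v)" for u and F :: "'a \<Rightarrow> 'a \<Rightarrow> real"
      using fin by (intro sum.mono_neutral_cong_left) auto
    have "(\<Sum>u\<in>U. \<Sum>v\<in>U. of_bool (u \<noteq> v) * F u v) = (\<Sum>v\<in>U. \<Sum>u\<in>U. of_bool (u \<noteq> v) * F u v)"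
      by (rule sum.swap)
    also have "\<dots> = (\<Sum>u\<in>U. \<Sum>v\<in>U. of_bool (u \<noteq> v) * F v u)"
      by (intro sum.cong refl) auto
    finally show ?thesis unfolding e[where F = F] e[where F = "\<lambda>u v. F v u"] .
  qed
  have "wvar U w g = (\<Sum>u\<in>U. (?b u)\<^sup>2 * ?K u + (\<Sum>v\<in>U - {u}. ?b u * ?b v * ?c u v))"
    unfolding vg
  proof (intro sum.cong refl)
    fix u assume u: "u \<in> U"
    show "(\<Sum>v\<in>U. ?b u * ?b v * ?c u v)
        = (?b u)\<^sup>2 * ?K u + (\<Sum>v\<in>U - {u}. ?b u * ?b v * ?c u v)"
      unfolding sum.remove[OF fin u] diag[OF u] by (simp add: power2_eq_square)
  qed
  also have "\<dots> = S + (\<Sum>u\<in>U. \<Sum>v\<in>U - {u}. ?b u * ?b v * ?c u v)"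
    by (simp add: sum.distrib S_def mult.commute)
  finally have vg': "wvar U w g = S + (\<Sum>u\<in>U. \<Sum>v\<in>U - {u}. ?b u * ?b v * ?c u v)" .
  define R where "R = (\<lambda>u v. (?b u)\<^sup>2 * (\<omega> v / \<omega> u) * \<bar>?c u v\<bar>)"
  have "(\<Sum>u\<in>U. \<Sum>v\<in>U - {u}. ?b u * ?b v * ?c u v)
     \<le> (\<Sum>u\<in>U. \<Sum>v\<in>U - {u}. (R u v + R v u) / 2)"
    unfolding R_def using amgm by (intro sum_mono) auto
  also have "\<dots> = ((\<Sum>u\<in>U. \<Sum>v\<in>U - {u}. R u v) + (\<Sum>u\<in>U. \<Sum>v\<in>U - {u}. R v u)) / 2"
    by (simp only: sum.distrib flip: sum_divide_distrib)
  also have "\<dots> = (\<Sum>u\<in>U. \<Sum>v\<in>U - {u}. R u v)" using swap[of R] by simp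
  also have "\<dots> \<le> (\<Sum>u\<in>U. \<eta> * (?K u * (?b u)\<^sup>2))"
    unfolding R_def using row by (intro sum_mono)
  also have "\<dots> = \<eta> * S" by (simp add: S_def sum_distrib_left)
  finally have vS: "wvar U w g \<le> (1 + \<eta>) * S" unfolding vg' by (simp add: algebra_simps)
  \<comment> \<open>This \<open>t\<close> minimises the upper bound Var f - 2 t S + t^2 (1 + \<eta>)
    S for the variance of f - t g.\<close>
  define t where "t = 1 / (1 + \<eta>)"
  have t: "0 < t" "t * (1 + \<eta>) = 1" using \<open>0 \<le> \<eta>\<close> by (auto simp: t_def)
  have "0 \<le> wvar U w (\<lambda>A. f A - t * g A)" by (rule wvar_nonneg[OF fin w])
  also have "\<dots> = wvar U w f - 2 * t * S + t\<^sup>2 * wvar U w g"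
    by (simp add: wvar_diff_cmult Sg)
  also have "\<dots> \<le> wvar U w f - 2 * t * S + t\<^sup>2 * ((1 + \<eta>) * S)"
    using vS by (simp add: mult_left_mono)
  also have "t\<^sup>2 * ((1 + \<eta>) * S) = t * (t * (1 + \<eta>)) * S" by (simp add: power2_eq_square)
  also have "\<dots> = t * S" using t by simp
  finally have "t * S \<le> wvar U w f" by (simp add: mult.commute)
  then have "(1 + \<eta>) * (t * S) \<le> (1 + \<eta>) * wvar U w f"
    using \<open>0 \<le> \<eta>\<close> by (intro mult_left_mono) auto
  moreover have "(1 + \<eta>) * (t * S) = S"
    using t(2) by (metis mult.assoc mult.commute mult_1_left)
  ultimately show ?thesis by (simp only: S_def)
qed

section \<open>Poincare inequality by induction on the number of free vertices\<close>

abbreviation dirichlet :: "'a set \<Rightarrow> ('a set \<Rightarrow> real) \<Rightarrow> ('a set \<Rightarrow> real) \<Rightarrow> real" where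
  "dirichlet U w f \<equiv> (\<Sum>v\<in>U. dirich v U w f)"

lemma dirichlet_nonneg:
  assumes "\<And>A. A \<subseteq> U \<Longrightarrow> 0 \<le> w A"
  shows "0 \<le> dirichlet U w f"
  using dirich_nonneg[of _ U w f] assms by (auto intro!: sum_nonneg)

text \<open>The vertices are set to spin 0 one after the other; each replacement distorts the measure
  by a factor of at most \<open>1 + F\<close>.\<close>

lemma crude_variance_bound:
  assumes fin: "finite U" and w: "\<And>A. A \<subseteq> U \<Longrightarrow> 0 \<le> w A" and "0 \<le> F"
    and F: "\<And>v A. v \<in> U \<Longrightarrow> A \<subseteq> U - {v} \<Longrightarrow> w (insert v A) \<le> F * w A"
  shows "wvar U w f \<le> (2 * (1 + F)) ^ card U * (1 + F) * dirichlet U w f"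
proof -
  let ?X = "\<lambda>v. wsum U w (\<lambda>A. (f A - f (A - {v}))\<^sup>2)"
  \<comment> \<open>The factor 2 is lost in splitting the square of a sum, the factor
    \<open>1 + F\<close> in \<open>remove\<close>.\<close>
  define G where "G = 2 * (1 + F)"
  have G: "2 \<le> G" using \<open>0 \<le> F\<close> by (simp add: G_def)
  \<comment> \<open>Setting \<open>v\<close> to 0 moves the mass w A + w (insert v A) to
    \<open>A\<close>, and this is at most (1 + F) w A.\<close>
  have remove: "wsum U w (\<lambda>A. g (A - {v})) \<le> (1 + F) * wsum U w g"
    if v: "v \<in> U" and g: "\<And>A. 0 \<le> g A" for v g
  proof -
    have "wsum U w (\<lambda>A. g (A - {v})) = (\<Sum>A\<in>Pow (U - {v}). (w A + w (insert v A)) * g A)"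
      unfolding wsum_def sum_Pow_split[OF fin v]
      by (intro sum.cong refl) (auto simp: algebra_simps subset_Diff_insert)
    also have "\<dots> \<le> (\<Sum>A\<in>Pow (U - {v}). (1 + F) * (w A * g A + w (insert v A) * g (insert v A)))"
    proof (intro sum_mono)
      fix A assume A: "A \<in> Pow (U - {v})"
      then have "w A + w (insert v A) \<le> (1 + F) * w A" using F[OF v] by (auto simp: algebra_simps)
      then have "(w A + w (insert v A)) * g A \<le> (1 + F) * w A * g A"
        using g by (rule mult_right_mono)
      moreover have "0 \<le> (1 + F) * (w (insert v A) * g (insert v A))"
        using A v g w \<open>0 \<le> F\<close> by (auto simp: subset_Diff_insert)
      ultimately show "(w A + w (insert v A)) * g A
          \<le> (1 + F) * (w A * g A + w (insert v A) * g (insert v A))"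
        by (simp add: algebra_simps)
    qed
    also have "\<dots> = (1 + F) * wsum U w g"
      unfolding wsum_def sum_Pow_split[OF fin v] by (simp add: sum_distrib_left)
    finally show ?thesis .
  qed
  have X0: "0 \<le> ?X v" for v using w by (auto simp: wsum_def intro!: sum_nonneg)
  have zero_out: "wsum U w (\<lambda>A. (f A - f (A - S))\<^sup>2) \<le> G ^ card S * (\<Sum>v\<in>S. ?X v)"
    if "finite S" "S \<subseteq> U" for S
    using that
  proof (induction S rule: finite_induct)
    case empty
    then show ?case by (simp add: wsum_def)
  next
    case (insert v S)
    let ?g = "\<lambda>A. (f A - f (A - S))\<^sup>2"
    have "(f A - f (A - insert v S))\<^sup>2 \<le> 2 * (f A - f (A - {v}))\<^sup>2 + 2 * ?g (A - {v})" for A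
    proof -
      have "A - insert v S = A - {v} - S" by auto
      moreover have "(x + y)\<^sup>2 \<le> 2 * x\<^sup>2 + 2 * y\<^sup>2" for x y :: real
        using zero_le_power2[of "x - y"] by (simp add: power2_eq_square algebra_simps)
      from this[of "f A - f (A - {v})" "f (A - {v}) - f (A - {v} - S)"]
      have "(f A - f (A - {v} - S))\<^sup>2 \<le> 2 * (f A - f (A - {v}))\<^sup>2 + 2 * ?g (A - {v})" by simp
      ultimately show ?thesis by simp
    qed
    then have "wsum U w (\<lambda>A. (f A - f (A - insert v S))\<^sup>2)
      \<le> wsum U w (\<lambda>A. 2 * (f A - f (A - {v}))\<^sup>2 + 2 * ?g (A - {v}))"
      by (intro wsum_mono w)
    also have "\<dots> = 2 * ?X v + 2 * wsum U w (\<lambda>A. ?g (A - {v}))"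
      by (simp only: wsum_add wsum_cmult)
    also have "\<dots> \<le> 2 * ?X v + G * wsum U w ?g"
      using remove[of v ?g] insert.prems by (simp add: G_def algebra_simps)
    also have "\<dots> \<le> 2 * ?X v + G * (G ^ card S * (\<Sum>v\<in>S. ?X v))"
      using insert G by (intro add_left_mono mult_left_mono) auto
    finally have *: "wsum U w (\<lambda>A. (f A - f (A - insert v S))\<^sup>2)
        \<le> 2 * ?X v + G * (G ^ card S * (\<Sum>v\<in>S. ?X v))" .
    have "2 * ?X v \<le> G ^ card (insert v S) * ?X v"
    proof (intro mult_right_mono X0)
      have "G ^ 1 \<le> G ^ card (insert v S)"
        using insert.hyps G by (intro power_increasing) auto
      then show "2 \<le> G ^ card (insert v S)" using G by simp
    qed
    with * show ?case using insert.hyps by (simp add: algebra_simps)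
  qed
  have X: "?X v \<le> (1 + F) * dirich v U w f" if v: "v \<in> U" for v
  proof -
    have "?X v = (\<Sum>A\<in>Pow (U - {v}). w (insert v A) * (f (insert v A) - f A)\<^sup>2)"
      unfolding wsum_def sum_Pow_split[OF fin v]
      by (intro sum.cong refl) (auto simp: subset_Diff_insert)
    also have "\<dots> \<le> (\<Sum>A\<in>Pow (U - {v}). (1 + F) * (w A * w (insert v A) / (w A + w (insert v A))
        * (f (insert v A) - f A)\<^sup>2))"
    proof (intro sum_mono)
      fix A assume A: "A \<in> Pow (U - {v})"
      have w01: "0 \<le> w A" "0 \<le> w (insert v A)" "w (insert v A) \<le> F * w A"
        using A w F v by (auto simp: subset_Diff_insert)
      have "w (insert v A) \<le> (1 + F) * (w A * w (insert v A) / (w A + w (insert v A)))"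
      proof (cases "w A + w (insert v A) = 0")
        case False
        then have "0 < w A + w (insert v A)" using w01 by linarith
        moreover have "w (insert v A) * (w A + w (insert v A)) \<le> w (insert v A) * ((1 + F) * w A)"
          using w01 by (intro mult_left_mono) (auto simp: algebra_simps)
        ultimately show ?thesis by (simp add: pos_le_divide_eq algebra_simps)
      qed (use w01 in simp)
      then have "w (insert v A) * (f (insert v A) - f A)\<^sup>2 \<le>
        (1 + F) * (w A * w (insert v A) / (w A + w (insert v A))) * (f (insert v A) - f A)\<^sup>2"
        by (intro mult_right_mono) auto
      then show "w (insert v A) * (f (insert v A) - f A)\<^sup>2
        \<le> (1 + F) * (w A * w (insert v A) / (w A + w (insert v A)) * (f (insert v A) - f A)\<^sup>2)"
        by (simp only: mult.assoc)
    qed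
    also have "\<dots> = (1 + F) * dirich v U w f" by (simp add: dirich_def sum_distrib_left)
    finally show ?thesis .
  qed
  have "wvar U w f \<le> wsum U w (\<lambda>A. (f A - f {})\<^sup>2)" by (intro wvar_le_dev fin w)
  also have "\<dots> = wsum U w (\<lambda>A. (f A - f (A - U))\<^sup>2)"
    unfolding wsum_def by (intro sum.cong refl) (auto simp: Diff_eq_empty_iff[THEN iffD2])
  also have "\<dots> \<le> G ^ card U * (\<Sum>v\<in>U. ?X v)" using zero_out fin by simp
  also have "\<dots> \<le> G ^ card U * (\<Sum>v\<in>U. (1 + F) * dirich v U w f)"
    using X G by (intro mult_left_mono sum_mono) auto
  finally show ?thesis by (simp add: G_def sum_distrib_left mult.assoc)
qed

text \<open>A class of weighted systems closed under fixing one spin either way, whose members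
  satisfy the variance form of spectral independence with the same \<eta>. The predicate
  \<open>Q\<close> separates the induction from the spin model.\<close>

definition si_family ::
  "real \<Rightarrow> real \<Rightarrow> ('a set \<Rightarrow> ('a set \<Rightarrow> real) \<Rightarrow> bool) \<Rightarrow> bool" where
  "si_family \<eta> F Q \<longleftrightarrow> (\<forall>U w. Q U w \<longrightarrow>
     (\<forall>A\<subseteq>U. 0 \<le> w A) \<and>
     (\<forall>v\<in>U. \<forall>A\<subseteq>U - {v}. w (insert v A) \<le> F * w A) \<and>
     (\<forall>f. (\<Sum>u\<in>U. spin_var U w u * (mean_diff U w u f)\<^sup>2) \<le> (1 + \<eta>) * wvar U w f) \<and>
     (\<forall>u\<in>U. Q (U - {u}) w \<and> Q (U - {u}) (w \<circ> insert u)))"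

text \<open>Averaging the law of total variance over all \<open>u\<close> leaves, after spectral
  independence, the fraction (n - 1 - \<eta>) / n of the variance to the systems with one vertex
  fixed. The local term of \<open>v\<close> occurs for the n - 1 choices u \<noteq> v.\<close>

lemma si_family_step:
  assumes Q: "si_family \<eta> F Q" "Q U w" and fin: "finite U"
    and \<eta>: "\<eta> < real (card U) - 1"
    and IH: "\<And>u w f. u \<in> U \<Longrightarrow> Q (U - {u}) w \<Longrightarrow> wvar (U - {u}) w f \<le> C * dirichlet (U - {u}) w f"
  shows "wvar U w f \<le> C * ((real (card U) - 1) / (real (card U) - 1 - \<eta>)) * dirichlet U w f"
proof -
  let ?n = "real (card U)"
  have w: "\<And>A. A \<subseteq> U \<Longrightarrow> 0 \<le> w A"
    and si: "(\<Sum>u\<in>U. spin_var U w u * (mean_diff U w u f)\<^sup>2) \<le> (1 + \<eta>) * wvar U w f"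
    and cl: "\<And>u. u \<in> U \<Longrightarrow> Q (U - {u}) w" "\<And>u. u \<in> U \<Longrightarrow> Q (U - {u}) (w \<circ> insert u)"
    using Q unfolding si_family_def by auto
  have double: "(\<Sum>u\<in>U. \<Sum>v\<in>U - {u}. dirich v U w f) = (?n - 1) * dirichlet U w f"
  proof -
    have "(\<Sum>u\<in>U. \<Sum>v\<in>U - {u}. dirich v U w f) = (\<Sum>u\<in>U. dirichlet U w f - dirich u U w f)"
      using fin by (intro sum.cong refl) (simp add: sum_diff1)
    then show ?thesis by (simp add: sum_subtractf algebra_simps)
  qed
  have split: "(\<Sum>v\<in>U - {u}. dirich v U w f)
      = dirichlet (U - {u}) w f + dirichlet (U - {u}) (w \<circ> insert u) (f \<circ> insert u)"
    if u: "u \<in> U" for u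
    unfolding sum.distrib[symmetric] using dirich_split[OF fin u] by (intro sum.cong) auto
  have "?n * wvar U w f = (\<Sum>u\<in>U. wvar U w f)" by simp
  also have "\<dots> = (\<Sum>u\<in>U. wvar (U - {u}) w f
        + wvar (U - {u}) (w \<circ> insert u) (f \<circ> insert u))
      + (\<Sum>u\<in>U. spin_var U w u * (mean_diff U w u f)\<^sup>2)"
    unfolding sum.distrib[symmetric] using total_variance[OF fin _ w] by (intro sum.cong) auto
  also have "\<dots> \<le> (\<Sum>u\<in>U. C * dirichlet (U - {u}) w f
        + C * dirichlet (U - {u}) (w \<circ> insert u) (f \<circ> insert u)) + (1 + \<eta>) * wvar U w f"
    using IH cl si by (intro add_mono sum_mono) auto
  also have "\<dots> = (\<Sum>u\<in>U. C * (\<Sum>v\<in>U - {u}. dirich v U w f)) + (1 + \<eta>) * wvar U w f"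
    using split by (simp add: distrib_left)
  also have "\<dots> = C * (\<Sum>u\<in>U. \<Sum>v\<in>U - {u}. dirich v U w f) + (1 + \<eta>) * wvar U w f"
    by (simp only: sum_distrib_left)
  finally have "(?n - 1 - \<eta>) * wvar U w f \<le> C * ((?n - 1) * dirichlet U w f)"
    unfolding double by (simp add: algebra_simps)
  with \<eta> show ?thesis by (simp add: pos_le_divide_eq mult.commute mult.left_commute)
qed

text \<open>The power m^\<eta> alone grows too slowly to absorb m / (m - \<eta>); the deficit is of
  order 1 / m^2 in the logarithm. The correction \<open>exp (- B / m)\<close> supplies B / (m (m +
  1)): the part \<eta> of \<open>B\<close> pays for replacing 1 / m by 1 / (m + 1), the part 4
  \<eta>^2 for the quadratic term of the logarithm.\<close>

lemma growth_step:
  fixes m \<eta> :: real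
  assumes "0 < \<eta>" "2 * \<eta> \<le> m" "1 \<le> m"
  defines "B \<equiv> 4 * \<eta>\<^sup>2 + \<eta>"
  shows "m powr \<eta> * exp (- B / m) * (m / (m - \<eta>)) \<le> (m + 1) powr \<eta> * exp (- B / (m + 1))"
proof -
  have m: "0 < m" "\<eta> < m" using assms by auto
  define x where "x = \<eta> / m"
  have x: "0 \<le> x" "x \<le> 1 / 2" using assms m by (auto simp: x_def field_simps)
  have 1: "- ln (1 - x) \<le> x + 2 * x\<^sup>2" using ln_one_minus_pos_lower_bound[OF x] by simp
  have 2: "1 / (m + 1) \<le> ln (m + 1) - ln m"
  proof -
    have "ln (m / (m + 1)) \<le> m / (m + 1) - 1" using m by (intro ln_le_minus_one) auto
    also have "\<dots> = - (1 / (m + 1))" using m by (simp add: field_simps)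
    finally show ?thesis using m by (simp add: ln_div)
  qed
  have 3: "x + 2 * x\<^sup>2 \<le> \<eta> * (1 / (m + 1)) + B / m - B / (m + 1)"
  proof -
    have "2 * x\<^sup>2 \<le> 4 * \<eta>\<^sup>2 / (m * (m + 1))"
    proof -
      have "2 * (m * (m + 1)) \<le> 4 * m\<^sup>2" using assms(3) m by (simp add: power2_eq_square)
      then have "\<eta>\<^sup>2 * (2 * (m * (m + 1))) \<le> \<eta>\<^sup>2 * (4 * m\<^sup>2)" by (intro mult_left_mono) auto
      then show ?thesis using m by (simp add: x_def power_divide divide_simps)
    qed
    moreover have "x = \<eta> * (1 / (m + 1)) + \<eta> / (m * (m + 1))"
      using m by (simp add: x_def divide_simps) (simp add: algebra_simps)
    moreover have "B / m - B / (m + 1) = B / (m * (m + 1))"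
      using m by (simp add: divide_simps) (simp add: algebra_simps)
    ultimately show ?thesis by (simp add: B_def add_divide_distrib)
  qed
  have "m / (m - \<eta>) = exp (- ln (1 - x))"
    using m x by (simp add: exp_minus x_def field_simps)
  then have "m powr \<eta> * exp (- B / m) * (m / (m - \<eta>))
      = exp (\<eta> * ln m + - B / m + - ln (1 - x))"
    using m by (simp only: powr_def exp_add) (simp add: mult.commute)
  also have "\<dots> \<le> exp (\<eta> * ln (m + 1) + - B / (m + 1))"
  proof -
    have "\<eta> * (1 / (m + 1)) \<le> \<eta> * (ln (m + 1) - ln m)"
      using 2 assms(1) by (intro mult_left_mono) auto
    then have "\<eta> * ln m + - B / m + - ln (1 - x) \<le> \<eta> * ln (m + 1) + - B / (m + 1)"
      using 1 3 by (simp add: algebra_simps)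
    then show ?thesis by simp
  qed
  also have "\<dots> = (m + 1) powr \<eta> * exp (- B / (m + 1))"
    using m by (simp only: powr_def exp_add) (simp add: mult.commute)
  finally show ?thesis .
qed

lemma poincare_inequality:
  fixes \<eta> F :: real
  assumes "0 < \<eta>" "0 \<le> F"
  shows "\<exists>C\<ge>1. \<forall>Q U w f. si_family \<eta> F Q \<longrightarrow> finite (U :: 'a set) \<longrightarrow> U \<noteq> {} \<longrightarrow> Q U w \<longrightarrow>
    wvar U w f \<le> C * real (card U) powr \<eta> * dirichlet U w f"
proof -
  define B where "B = 4 * \<eta>\<^sup>2 + \<eta>"
  \<comment> \<open>From this size on \<open>growth_step\<close> applies; smaller systems are
    covered by \<open>C0\<close>.\<close>
  define K where "K = nat \<lceil>2 * \<eta>\<rceil> + 1"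
  define C0 where "C0 = (2 * (1 + F)) ^ K * (1 + F)"
  \<comment> \<open>\<open>exp B\<close> compensates the correction \<open>exp (- B / K)\<close> at
    the start of the induction.\<close>
  define C1 where "C1 = C0 * exp B"
  have K: "2 * \<eta> \<le> real K" "1 \<le> K" unfolding K_def by linarith+
  have B: "0 < B" using assms by (simp add: B_def add_nonneg_pos)
  have C0: "1 \<le> C0"
  proof -
    have "1 \<le> (2 * (1 + F)) ^ K" using assms by (intro one_le_power) auto
    then show ?thesis unfolding C0_def using assms mult_mono[of 1 "(2 * (1 + F)) ^ K" 1 "1 + F"] by simp
  qed
  have C1: "C0 \<le> C1" "1 \<le> C1"
  proof -
    show "C0 \<le> C1" using C0 B mult_left_mono[of 1 "exp B" C0] by (simp add: C1_def)
    with C0 show "1 \<le> C1" by simp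
  qed
  have small: "wvar U w f \<le> C0 * dirichlet U w f"
    if Q: "si_family \<eta> F Q" "Q U w" and fin: "finite U" "card U \<le> K"
    for Q and U :: "'a set" and w f
  proof -
    have w: "\<And>A. A \<subseteq> U \<Longrightarrow> 0 \<le> w A" using Q unfolding si_family_def by auto
    have "wvar U w f \<le> (2 * (1 + F)) ^ card U * (1 + F) * dirichlet U w f"
      using Q assms fin by (intro crude_variance_bound) (auto simp: si_family_def)
    also have "\<dots> \<le> C0 * dirichlet U w f"
      unfolding C0_def using dirichlet_nonneg[of U w f] w fin assms
      by (intro mult_right_mono power_increasing) auto
    finally show ?thesis .
  qed
  have large: "wvar U w f \<le> C1 * (real n powr \<eta> * exp (- B / real n)) * dirichlet U w f"
    if "K \<le> n" "si_family \<eta> F Q" "Q U w" "finite U" "card U = n"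
    for n Q and U :: "'a set" and w f
    using that
  proof (induction n arbitrary: U w f rule: dec_induct)
    case base
    have w: "\<And>A. A \<subseteq> U \<Longrightarrow> 0 \<le> w A" using base unfolding si_family_def by auto
    have "C0 \<le> C1 * (real K powr \<eta> * exp (- B / real K))"
    proof -
      have "exp (- B) \<le> exp (- B / real K)" using B K by (simp add: field_simps)
      moreover have "1 \<le> real K powr \<eta>" using K assms by (simp add: ge_one_powr_ge_zero)
      ultimately have "1 * exp (- B) \<le> real K powr \<eta> * exp (- B / real K)" by (intro mult_mono) auto
      then have "C1 * exp (- B) \<le> C1 * (real K powr \<eta> * exp (- B / real K))"
        using C1 by (intro mult_left_mono) auto
      moreover have "C1 * exp (- B) = C0" by (simp add: C1_def exp_minus)
      ultimately show ?thesis by simp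
    qed
    then have "C0 * dirichlet U w f \<le> C1 * (real K powr \<eta> * exp (- B / real K)) * dirichlet U w f"
      using dirichlet_nonneg[of U w f] w by (intro mult_right_mono) auto
    moreover have "wvar U w f \<le> C0 * dirichlet U w f" using small[OF base(1,2,3), of f] base(4) by simp
    ultimately show ?case by linarith
  next
    case (step n)
    let ?\<phi> = "\<lambda>x. x powr \<eta> * exp (- B / x)"
    have w: "\<And>A. A \<subseteq> U \<Longrightarrow> 0 \<le> w A" using step.prems unfolding si_family_def by auto
    have n: "2 * \<eta> \<le> real n" "1 \<le> real n" using K step.hyps by auto
    have "wvar U w f \<le> C1 * ?\<phi> (real n) * ((real (card U) - 1) / (real (card U) - 1 - \<eta>))
        * dirichlet U w f"
      using step n assms by (intro si_family_step[OF step.prems(1,2,3)]) auto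
    also have "\<dots> = C1 * (?\<phi> (real n) * (real n / (real n - \<eta>))) * dirichlet U w f"
      using step.prems by simp
    also have "\<dots> \<le> C1 * ?\<phi> (real n + 1) * dirichlet U w f"
      using growth_step[of \<eta> "real n"] n assms C1 dirichlet_nonneg[of U w f] w
      by (intro mult_right_mono mult_left_mono) (auto simp: B_def)
    finally show ?case by (simp add: add.commute)
  qed
  have "wvar U w f \<le> C1 * real (card U) powr \<eta> * dirichlet U w f"
    if Q: "si_family \<eta> F Q" "finite U" "U \<noteq> {}" "Q U w" for Q and U :: "'a set" and w f
  proof -
    have w: "\<And>A. A \<subseteq> U \<Longrightarrow> 0 \<le> w A" using Q unfolding si_family_def by auto
    have n: "1 \<le> card U" using Q by (simp add: Suc_le_eq card_gt_0_iff)
    have D: "0 \<le> dirichlet U w f" using w by (rule dirichlet_nonneg)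
    have p: "1 \<le> real (card U) powr \<eta>" using n assms by (simp add: ge_one_powr_ge_zero)
    show ?thesis
    proof (cases "card U \<le> K")
      case True
      have "C0 * 1 \<le> C1 * real (card U) powr \<eta>" using C0 C1 p by (intro mult_mono) auto
      then have "C0 * dirichlet U w f \<le> C1 * real (card U) powr \<eta> * dirichlet U w f"
        using D by (intro mult_right_mono) auto
      with small[OF Q(1,4,2) True, of f] show ?thesis by linarith
    next
      case False
      have "exp (- B / real (card U)) \<le> 1" using B by simp
      then have "real (card U) powr \<eta> * exp (- B / real (card U)) \<le> real (card U) powr \<eta> * 1"
        by (intro mult_left_mono) auto
      then have "C1 * (real (card U) powr \<eta> * exp (- B / real (card U))) \<le> C1 * real (card U) powr \<eta>"
        using C1 by (intro mult_left_mono) auto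
      then have "C1 * (real (card U) powr \<eta> * exp (- B / real (card U))) * dirichlet U w f
          \<le> C1 * real (card U) powr \<eta> * dirichlet U w f"
        using D by (intro mult_right_mono) auto
      moreover have "wvar U w f
          \<le> C1 * (real (card U) powr \<eta> * exp (- B / real (card U))) * dirichlet U w f"
        using False Q large[of "card U" Q U w f] by auto
      ultimately show ?thesis by linarith
    qed
  qed
  with C1 show ?thesis by blast
qed

section \<open>The recursion for influences\<close>

definition inc :: "'a set \<Rightarrow> ('a \<Rightarrow> nat) \<Rightarrow> 'a \<Rightarrow> nat" where
  "inc M a v = a v + of_bool (v \<in> M)"

lemma inc_insert: "u \<notin> N \<Longrightarrow> inc (insert u N) a = inc {u} (inc N a)"
  by (auto simp: inc_def fun_eq_iff)

text \<open>Multiplying the weight of one of two classes by \<rho> shifts the mean by the change in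
  the probability of that class times the difference of the class means.\<close>

lemma reweighted_mean_diff:
  fixes \<rho> :: real
  assumes "0 < T0" "0 \<le> T1" "0 \<le> \<rho>" "T1 = 0 \<Longrightarrow> s1 = (0 :: real)"
  shows "(s0 + \<rho> * s1) / (T0 + \<rho> * T1) - (s0 + s1) / (T0 + T1)
    = (\<rho> - 1) * (T1 / T0) / ((1 + \<rho> * (T1 / T0)) * (1 + T1 / T0)) * (s1 / T1 - s0 / T0)"
proof (cases "T1 = 0")
  case False
  then have T: "0 < T1" using assms by auto
  have p: "0 < T0 + \<rho> * T1" "0 < T0 + T1" using assms T by (auto intro: add_pos_nonneg)
  have e: "1 + \<rho> * (T1 / T0) = (T0 + \<rho> * T1) / T0" "1 + T1 / T0 = (T0 + T1) / T0"
    using assms by (auto simp: field_simps)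
  have num: "(s0 + \<rho> * s1) * (T0 + T1) - (s0 + s1) * (T0 + \<rho> * T1)
      = (\<rho> - 1) * (s1 * T0 - s0 * T1)"
    by (simp add: algebra_simps)
  have l: "(s0 + \<rho> * s1) / (T0 + \<rho> * T1) - (s0 + s1) / (T0 + T1)
      = (\<rho> - 1) * (s1 * T0 - s0 * T1) / ((T0 + \<rho> * T1) * (T0 + T1))"
    using p by (simp only: num[symmetric]) (simp add: diff_frac_eq)
  have m: "s1 / T1 - s0 / T0 = (s1 * T0 - s0 * T1) / (T1 * T0)"
    using assms T by (simp add: diff_frac_eq)
  show ?thesis
    unfolding l e m using assms(1) T p by simp
qed (use assms in auto)

section \<open>Weights of the 2-spin system under pinnings\<close>

locale two_spin =
  fixes V :: "nat set" and E :: "nat set set" and \<beta> \<gamma> lam :: real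
  assumes graph: "simple_graph V E"
    and beta: "0 \<le> \<beta>" and gamma: "0 < \<gamma>" and lam: "0 < lam"
begin

abbreviation deg :: "nat \<Rightarrow> nat" where "deg \<equiv> vdegree E"

definition \<rho> :: real where "\<rho> = \<beta> * \<gamma>"

definition nb :: "nat \<Rightarrow> nat set" where "nb v = {u. {v, u} \<in> E}"

definition ecount :: "nat set \<Rightarrow> nat" where "ecount A = card {e \<in> E. e \<subseteq> A}"

text \<open>With j neighbours of spin 1, turning \<open>v\<close> from 0 to 1 changes the weight by
  lam \<beta>^j / \<gamma>^(deg v - j) = lam \<rho>^j / \<gamma>^(deg v). The degree is that of the
  whole graph: deleted neighbours count as zeros.\<close>

definition fld :: "(nat \<Rightarrow> nat) \<Rightarrow> nat \<Rightarrow> real" where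
  "fld a v = lam * \<rho> ^ a v / \<gamma> ^ deg v"

text \<open>The weight of the configuration with set of ones \<open>A\<close>, relative to the all-zero
  configuration, when each \<open>v\<close> has in addition \<open>a v\<close> neighbours pinned to 1. Deleting a vertex from
  the ground set pins it to 0, so that these weights are closed under conditioning.\<close>

definition wt :: "(nat \<Rightarrow> nat) \<Rightarrow> nat set \<Rightarrow> real" where
  "wt a A = \<rho> ^ ecount A * (\<Prod>v\<in>A. fld a v)"

text \<open>The odds of spin 1 at \<open>u\<close>. On a finite ground set the denominator is
  positive, as the empty set has weight 1; the odds can be 0 if \<beta> = 0.\<close>

definition ratio :: "(nat \<Rightarrow> nat) \<Rightarrow> nat set \<Rightarrow> nat \<Rightarrow> real" where
  "ratio a U u = tot (U - {u}) (wt a \<circ> insert u) / tot (U - {u}) (wt a)"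

lemma rho_nonneg: "0 \<le> \<rho>" using beta gamma by (simp add: \<rho>_def)

lemma finite_V: "finite V" using graph by (simp add: simple_graph_def)

lemma finite_E: "finite E"
proof (rule finite_subset)
  show "E \<subseteq> Pow V" using graph by (auto simp: simple_graph_def)
qed (use finite_V in simp)

lemma edge_card: "e \<in> E \<Longrightarrow> card e = 2" using graph by (auto simp: simple_graph_def)

lemma nb_irrefl: "v \<notin> nb v"
  using edge_card[of "{v, v}"] by (auto simp: nb_def)

lemma nb_subset: "nb v \<subseteq> V"
  using graph by (auto simp: simple_graph_def nb_def)

lemma nb_sym: "u \<in> nb v \<longleftrightarrow> v \<in> nb u"
  by (simp add: nb_def insert_commute)

lemma finite_nb: "finite (nb v)"
  using nb_subset finite_V finite_subset by blast

lemma inj_edge: "inj_on (\<lambda>u. {v, u}) S"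
  by (auto simp: inj_on_def doubleton_eq_iff)

lemma edge_at: "e \<in> E \<Longrightarrow> v \<in> e \<Longrightarrow> \<exists>u\<in>nb v. e = {v, u}"
proof -
  assume e: "e \<in> E" "v \<in> e"
  then obtain x y where xy: "e = {x, y}" using edge_card card_2_iff by metis
  with e have "e = {v, x} \<or> e = {v, y}" by auto
  with e show ?thesis by (auto simp: nb_def)
qed

lemma card_nb: "card (nb v) = deg v"
proof -
  have "{e \<in> E. v \<in> e} = (\<lambda>u. {v, u}) ` nb v"
    using edge_at[of _ v] by (auto simp: nb_def)
  then show ?thesis by (simp add: vdegree_def card_image inj_edge)
qed

lemma ecount_insert:
  assumes "r \<notin> A"
  shows "ecount (insert r A) = ecount A + card (nb r \<inter> A)"
proof -
  have "{e \<in> E. e \<subseteq> insert r A} = {e \<in> E. e \<subseteq> A} \<union> (\<lambda>u. {r, u}) ` (nb r \<inter> A)"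
  proof (intro equalityI subsetI)
    fix e assume e: "e \<in> {e \<in> E. e \<subseteq> insert r A}"
    show "e \<in> {e \<in> E. e \<subseteq> A} \<union> (\<lambda>u. {r, u}) ` (nb r \<inter> A)"
    proof (cases "r \<in> e")
      case True
      then obtain u where "u \<in> nb r" "e = {r, u}" using edge_at e by blast
      moreover have "u \<noteq> r" using \<open>u \<in> nb r\<close> nb_irrefl by metis
      ultimately show ?thesis using e by auto
    qed (use e in auto)
  qed (auto simp: nb_def)
  moreover have "card ({e \<in> E. e \<subseteq> A} \<union> (\<lambda>u. {r, u}) ` (nb r \<inter> A))
      = card {e \<in> E. e \<subseteq> A} + card ((\<lambda>u. {r, u}) ` (nb r \<inter> A))"
    using assms finite_E finite_nb by (intro card_Un_disjoint) auto
  ultimately show ?thesis by (simp add: ecount_def card_image inj_edge)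
qed

lemma fld_nonneg: "0 \<le> fld a v"
  using lam gamma rho_nonneg by (simp add: fld_def)

lemma wt_nonneg: "0 \<le> wt a A"
  unfolding wt_def using rho_nonneg fld_nonneg by (intro mult_nonneg_nonneg prod_nonneg) auto

lemma wt_empty: "wt a {} = 1"
proof -
  have "{e \<in> E. e \<subseteq> {}} = {}" using edge_card by fastforce
  then show ?thesis by (simp only: wt_def ecount_def) simp
qed

lemma wt_inc:
  assumes "finite A"
  shows "wt (inc M a) A = \<rho> ^ card (M \<inter> A) * wt a A"
proof -
  have "(\<Prod>v\<in>A. fld (inc M a) v) = (\<Prod>v\<in>A. (if v \<in> M then \<rho> else 1) * fld a v)"
    by (intro prod.cong refl) (auto simp: fld_def inc_def)
  also have "\<dots> = (\<Prod>v\<in>A. if v \<in> M then \<rho> else 1) * (\<Prod>v\<in>A. fld a v)"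
    by (rule prod.distrib)
  finally have "(\<Prod>v\<in>A. fld (inc M a) v)
    = (\<Prod>v\<in>A. if v \<in> M then \<rho> else 1) * (\<Prod>v\<in>A. fld a v)" .
  moreover have "(\<Prod>v\<in>A. if v \<in> M then \<rho> else 1) = (\<Prod>v\<in>A \<inter> M. \<rho>)"
    using prod.inter_restrict[OF assms, of "\<lambda>_. \<rho>" M] by simp
  ultimately show ?thesis by (simp add: wt_def Int_commute)
qed

lemma wt_insert:
  assumes "finite A" "r \<notin> A"
  shows "wt a (insert r A) = fld a r * wt (inc (nb r) a) A"
  using assms by (simp add: wt_inc) (simp add: wt_def ecount_insert power_add)

lemma tot_wt_pos:
  assumes "finite U"
  shows "0 < tot U (wt a)"
  unfolding tot_def using assms wt_nonneg
  by (intro sum_pos2[of _ "{}"]) (auto simp: wt_empty)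

lemma ratio_nonneg: "finite U \<Longrightarrow> 0 \<le> ratio a U u"
  unfolding ratio_def using tot_wt_pos[of "U - {u}" a] tot_nonneg[of "U - {u}" "wt a \<circ> insert u"]
  by (auto simp: wt_nonneg)

text \<open>One more neighbour of spin 1 at \<open>u\<close> multiplies by \<rho> the weight of
  exactly those configurations that contain \<open>u\<close>, so \<open>reweighted_mean_diff\<close>
  applies.\<close>

lemma inc_one:
  fixes f :: "nat set \<Rightarrow> real" and a :: "nat \<Rightarrow> nat" and U :: "nat set" and u :: nat
  assumes "finite U" "u \<in> U"
  defines "R \<equiv> ratio a U u"
  shows "tot U (wt (inc {u} a)) = tot U (wt a) * ((1 + \<rho> * R) / (1 + R))"
    and "wmean U (wt (inc {u} a)) f - wmean U (wt a) f
      = (\<rho> - 1) * R / ((1 + \<rho> * R) * (1 + R)) * mean_diff U (wt a) u f"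
proof -
  define T0 T1 where "T0 = tot (U - {u}) (wt a)" and "T1 = tot (U - {u}) (wt a \<circ> insert u)"
  define s0 s1 where "s0 = wsum (U - {u}) (wt a) f"
    and "s1 = wsum (U - {u}) (wt a \<circ> insert u) (f \<circ> insert u)"
  have R: "R = T1 / T0" by (simp add: R_def ratio_def T0_def T1_def)
  have T: "0 < T0" "0 \<le> T1"
    unfolding T0_def T1_def using tot_wt_pos assms by (auto intro!: tot_nonneg wt_nonneg)
  have z: "T1 = 0 \<Longrightarrow> s1 = 0"
    unfolding T1_def s1_def using assms by (intro wsum_eq_0) (auto simp: wt_nonneg)
  have fin: "finite A" "{u} \<inter> A = {}" if "A \<in> Pow (U - {u})" for A
    using that assms(1) by (auto intro: finite_subset)
  have 0: "wt (inc {u} a) A = wt a A" if "A \<in> Pow (U - {u})" for A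
    using fin[OF that] by (simp add: wt_inc)
  have 1: "wt (inc {u} a) (insert u A) = \<rho> * wt a (insert u A)" if "A \<in> Pow (U - {u})" for A
    using fin[OF that] by (simp add: wt_inc)
  have t: "tot U (wt a) = T0 + T1" "wsum U (wt a) f = s0 + s1"
    using assms by (auto simp: tot_split[of U u] wsum_split[of U u] T0_def T1_def s0_def s1_def)
  have t': "tot U (wt (inc {u} a)) = T0 + \<rho> * T1"
    unfolding tot_split[OF assms(1,2)] unfolding tot_def T0_def T1_def using 0 1
    by (simp add: sum_distrib_left)
  have w': "wsum U (wt (inc {u} a)) f = s0 + \<rho> * s1"
    unfolding wsum_split[OF assms(1,2)] unfolding wsum_def s0_def s1_def using 0 1
    by (simp add: sum_distrib_left mult.assoc)
  have e: "1 + \<rho> * R = (T0 + \<rho> * T1) / T0" "1 + R = (T0 + T1) / T0"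
    using T by (auto simp: R field_simps)
  show "tot U (wt (inc {u} a)) = tot U (wt a) * ((1 + \<rho> * R) / (1 + R))"
    unfolding t t' e using T by simp
  show "wmean U (wt (inc {u} a)) f - wmean U (wt a) f
      = (\<rho> - 1) * R / ((1 + \<rho> * R) * (1 + R)) * mean_diff U (wt a) u f"
    unfolding wmean_def t t' w' mean_diff_def R
    using reweighted_mean_diff[OF T(1,2) rho_nonneg z, of s0]
    by (simp add: T0_def T1_def s0_def s1_def)
qed

definition edge_factor :: "real \<Rightarrow> real" where
  "edge_factor x = (1 + \<rho> * x) / (1 + x)"

text \<open>The derivative of ln (\<open>edge_factor\<close> x) with respect to ln x, hence the
  function h up to a shift of its argument.\<close>

definition edge_influence :: "real \<Rightarrow> real" where
  "edge_influence x = (\<rho> - 1) * x / ((1 + \<rho> * x) * (1 + x))"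

text \<open>The neighbours in \<open>N\<close> are exposed to an additional 1 one after the other; \<open>M u\<close> is the set
  of those treated before \<open>u\<close>. This telescoping replaces Weitz's self-avoiding walk tree.\<close>

lemma inc_telescope:
  assumes "finite U" "finite N" "N \<subseteq> U"
  shows "\<exists>M. (\<forall>u\<in>N. M u \<subseteq> N - {u}) \<and>
    tot U (wt (inc N a)) = tot U (wt a) * (\<Prod>u\<in>N. edge_factor (ratio (inc (M u) a) U u)) \<and>
    (\<forall>f. \<bar>wmean U (wt (inc N a)) f - wmean U (wt a) f\<bar> \<le>
      (\<Sum>u\<in>N. \<bar>edge_influence (ratio (inc (M u) a) U u)\<bar> * \<bar>mean_diff U (wt (inc (M u) a)) u f\<bar>))"
  using assms(2,3)
proof (induction N rule: finite_induct)
  case empty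
  have "inc {} a = a" by (auto simp: inc_def)
  then show ?case by simp
next
  case (insert x N)
  then obtain M where M: "\<forall>u\<in>N. M u \<subseteq> N - {u}"
    and t: "tot U (wt (inc N a)) = tot U (wt a) * (\<Prod>u\<in>N. edge_factor (ratio (inc (M u) a) U u))"
    and m: "\<And>f. \<bar>wmean U (wt (inc N a)) f - wmean U (wt a) f\<bar> \<le>
      (\<Sum>u\<in>N. \<bar>edge_influence (ratio (inc (M u) a) U u)\<bar> * \<bar>mean_diff U (wt (inc (M u) a)) u f\<bar>)"
    by auto
  have x: "x \<in> U" using insert by auto
  \<comment> \<open>\<open>x\<close> is exposed last, when all of \<open>N\<close> already carries
    the additional 1.\<close>
  define M' where "M' = M(x := N)"
  have eq: "M' u = M u" if "u \<in> N" for u using that insert.hyps by (auto simp: M'_def)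
  have "\<forall>u\<in>insert x N. M' u \<subseteq> insert x N - {u}"
    using M insert.hyps eq by (fastforce simp: M'_def)
  moreover have "tot U (wt (inc (insert x N) a))
      = tot U (wt a) * (\<Prod>u\<in>insert x N. edge_factor (ratio (inc (M' u) a) U u))"
    using insert.hyps eq inc_one(1)[OF assms(1) x, of "inc N a"] t
    unfolding inc_insert[OF insert.hyps(2)] by (simp add: edge_factor_def) (simp add: M'_def)
  moreover have "\<bar>wmean U (wt (inc (insert x N) a)) f - wmean U (wt a) f\<bar> \<le>
      (\<Sum>u\<in>insert x N. \<bar>edge_influence (ratio (inc (M' u) a) U u)\<bar>
        * \<bar>mean_diff U (wt (inc (M' u) a)) u f\<bar>)" for f
  proof -
    have "wmean U (wt (inc (insert x N) a)) f - wmean U (wt a) f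
      = edge_influence (ratio (inc N a) U x) * mean_diff U (wt (inc N a)) x f
        + (wmean U (wt (inc N a)) f - wmean U (wt a) f)"
      using insert.hyps inc_one(2)[OF assms(1) x, of "inc N a" f]
      unfolding inc_insert[OF insert.hyps(2)] by (simp add: edge_influence_def)
    then have "\<bar>wmean U (wt (inc (insert x N) a)) f - wmean U (wt a) f\<bar>
      \<le> \<bar>edge_influence (ratio (inc N a) U x) * mean_diff U (wt (inc N a)) x f\<bar>
        + \<bar>wmean U (wt (inc N a)) f - wmean U (wt a) f\<bar>"
      by (simp only: abs_triangle_ineq)
    also have "\<dots> \<le> \<bar>edge_influence (ratio (inc N a) U x)\<bar> * \<bar>mean_diff U (wt (inc N a)) x f\<bar>
      + (\<Sum>u\<in>N. \<bar>edge_influence (ratio (inc (M u) a) U u)\<bar> * \<bar>mean_diff U (wt (inc (M u) a)) u f\<bar>)"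
      using m[of f] by (simp add: abs_mult)
    also have "\<dots> = (\<Sum>u\<in>insert x N. \<bar>edge_influence (ratio (inc (M' u) a) U u)\<bar>
        * \<bar>mean_diff U (wt (inc (M' u) a)) u f\<bar>)"
      using insert.hyps eq by (simp) (simp add: M'_def)
    finally show ?thesis .
  qed
  ultimately show ?case by blast
qed

text \<open>Once \<open>r\<close> is removed, its spin acts only through the fields: spin 0 leaves
  \<open>a\<close>, spin 1 gives \<open>inc N a\<close>. The odds of \<open>r\<close> and its
  influence both compare these two systems on \<open>U - {r}\<close>, which is what
  \<open>inc_telescope\<close> does.\<close>

lemma tree_recursion:
  fixes a :: "nat \<Rightarrow> nat" and U :: "nat set" and r :: nat
  assumes "finite U" "r \<in> U" "0 < ratio a U r"
  defines "N \<equiv> nb r \<inter> U"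
  shows "\<exists>M. (\<forall>u\<in>N. M u \<subseteq> N - {u}) \<and>
    ratio a U r = fld a r * (\<Prod>u\<in>N. edge_factor (ratio (inc (M u) a) (U - {r}) u)) \<and>
    (\<forall>v\<in>U - {r}. \<bar>mean_diff U (wt a) r (occ v)\<bar> \<le>
      (\<Sum>u\<in>N. \<bar>edge_influence (ratio (inc (M u) a) (U - {r}) u)\<bar>
        * \<bar>mean_diff (U - {r}) (wt (inc (M u) a)) u (occ v)\<bar>))"
proof -
  let ?U = "U - {r}"
  have N: "finite N" "N \<subseteq> ?U" "finite ?U" using assms(1) nb_irrefl by (auto simp: N_def)
  obtain M where M: "\<forall>u\<in>N. M u \<subseteq> N - {u}"
    and t: "tot ?U (wt (inc N a)) = tot ?U (wt a) * (\<Prod>u\<in>N. edge_factor (ratio (inc (M u) a) ?U u))"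
    and m: "\<And>f. \<bar>wmean ?U (wt (inc N a)) f - wmean ?U (wt a) f\<bar> \<le>
      (\<Sum>u\<in>N. \<bar>edge_influence (ratio (inc (M u) a) ?U u)\<bar> * \<bar>mean_diff ?U (wt (inc (M u) a)) u f\<bar>)"
    using inc_telescope[OF N(3,1,2), of a] by blast
  have ins: "(wt a \<circ> insert r) A = fld a r * wt (inc N a) A" if "A \<in> Pow ?U" for A
  proof -
    have A: "finite A" "r \<notin> A" using that assms(1) by (auto intro: finite_subset)
    have "nb r \<inter> A = N \<inter> A" using that by (auto simp: N_def)
    then show ?thesis using A by (simp add: wt_insert wt_inc)
  qed
  have tot: "tot ?U (wt a \<circ> insert r) = fld a r * tot ?U (wt (inc N a))"
    unfolding tot_def sum_distrib_left using ins by (intro sum.cong refl)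
  have r: "ratio a U r = fld a r * (\<Prod>u\<in>N. edge_factor (ratio (inc (M u) a) ?U u))"
    unfolding ratio_def tot t using tot_wt_pos[OF N(3), of a] by simp
  \<comment> \<open>For \<beta> = 0 the field of \<open>r\<close> can vanish; positive odds exclude
    this, so it cancels in the conditional mean.\<close>
  have f0: "fld a r \<noteq> 0" using assms(3) unfolding r by auto
  have "mean_diff U (wt a) r (occ v) = wmean ?U (wt (inc N a)) (occ v) - wmean ?U (wt a) (occ v)"
    if "v \<in> ?U" for v
  proof -
    have "wsum ?U (wt a \<circ> insert r) (occ v \<circ> insert r) = fld a r * wsum ?U (wt (inc N a)) (occ v)"
      unfolding wsum_def sum_distrib_left using ins that
      by (intro sum.cong refl) (auto simp: occ_def)
    then show ?thesis using f0 by (simp add: mean_diff_def wmean_def tot)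
  qed
  with M r m show ?thesis by (intro exI[of _ M]) simp
qed

end

section \<open>Tree recursion values and the potential conditions\<close>

lemma log_ext_mult:
  assumes "0 \<le> x" "0 \<le> y"
  shows "log_ext (x * y) = log_ext x + log_ext y"
  using assms by (auto simp: log_ext_def ln_mult)

lemma log_ext_mono:
  assumes "0 \<le> x" "x \<le> y"
  shows "log_ext x \<le> log_ext y"
  using assms by (auto simp: log_ext_def)

lemma log_ext_prod:
  assumes "finite I" "\<And>i. i \<in> I \<Longrightarrow> 0 \<le> f i"
  shows "log_ext (\<Prod>i\<in>I. f i) = (\<Sum>i\<in>I. log_ext (f i))"
  using assms
  by (induction I rule: finite_induct) (simp_all add: log_ext_mult prod_nonneg, simp add: log_ext_def)

lemma edge_ratio_nonneg:
  assumes "0 \<le> \<beta>" "0 < \<gamma>"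
  shows "0 \<le> edge_ratio \<beta> \<gamma> y"
  using assms by (cases y) (auto simp: edge_ratio_def add_pos_pos intro!: divide_nonneg_nonneg add_nonneg_nonneg)

lemma edge_ratio_log_ext:
  assumes "0 \<le> x" "0 < \<gamma>"
  shows "edge_ratio \<beta> \<gamma> (log_ext x) = (\<beta> * x + 1) / (x + \<gamma>)"
  using assms by (auto simp: edge_ratio_def log_ext_def)

lemma tree_rec_eq:
  assumes "0 \<le> \<beta>" "0 < \<gamma>" "0 < lam"
  shows "tree_rec \<beta> \<gamma> lam d y = log_ext (lam * (\<Prod>i=1..d. edge_ratio \<beta> \<gamma> (y i)))"
  using assms edge_ratio_nonneg[OF assms(1,2)]
  by (simp add: tree_rec_def log_ext_mult log_ext_prod prod_nonneg)

text \<open>The value of the tree recursion at a vertex with free children \<open>u \<in> N\<close> of ratios \<open>x u\<close>,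
  \<open>p\<close> children pinned to 1 and \<open>q\<close> children pinned to 0.\<close>

definition rec_value :: "real \<Rightarrow> real \<Rightarrow> real \<Rightarrow> nat \<Rightarrow> nat \<Rightarrow> 'b set \<Rightarrow> ('b \<Rightarrow> real) \<Rightarrow> real" where
  "rec_value \<beta> \<gamma> lam p q N x =
     lam * ((\<Prod>u\<in>N. (\<beta> * x u + 1) / (x u + \<gamma>)) * \<beta> ^ p * (1 / \<gamma>) ^ q)"

text \<open>The factor of a free child is the average of \<beta> and 1 / \<gamma> with weights
  \<open>x u\<close> and \<gamma>, so it lies between them; the factors of pinned children are these
  two values themselves.\<close>

lemma rec_value_in_J_int:
  assumes "0 \<le> \<beta>" "0 < \<gamma>" "0 < lam" "finite N" "\<And>u. u \<in> N \<Longrightarrow> 0 \<le> x u"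
  shows "log_ext (rec_value \<beta> \<gamma> lam p q N x) \<in> J_int \<beta> \<gamma> lam (card N + p + q)"
proof -
  let ?e = "\<lambda>u. (\<beta> * x u + 1) / (x u + \<gamma>)"
  define lo hi where "lo = min \<beta> (1 / \<gamma>)" and "hi = max \<beta> (1 / \<gamma>)"
  have lo: "0 \<le> lo" "lo \<le> \<beta>" "lo \<le> 1 / \<gamma>" and hi: "0 \<le> hi" "\<beta> \<le> hi" "1 / \<gamma> \<le> hi"
    using assms by (auto simp: lo_def hi_def)
  have e: "lo \<le> ?e u" "?e u \<le> hi" if u: "u \<in> N" for u
  proof -
    have x: "0 \<le> x u" "0 < x u + \<gamma>" using assms u by (auto simp: add_nonneg_pos)
    have "lo * x u \<le> \<beta> * x u" "\<beta> * x u \<le> hi * x u"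
      using lo hi x by (auto intro: mult_right_mono)
    moreover have "lo * \<gamma> \<le> 1" "1 \<le> hi * \<gamma>" using lo hi assms by (auto simp: field_simps)
    ultimately show "lo \<le> ?e u" "?e u \<le> hi" using x by (auto simp: field_simps)
  qed
  let ?P = "(\<Prod>u\<in>N. ?e u) * \<beta> ^ p * (1 / \<gamma>) ^ q"
  have P1: "lo ^ (card N + p + q) \<le> ?P"
    unfolding power_add using lo e prod_mono[of N "\<lambda>_. lo" ?e]
    by (intro mult_mono power_mono) (auto intro!: prod_nonneg mult_nonneg_nonneg order_trans[OF lo(1) e(1)])
  have P2: "?P \<le> hi ^ (card N + p + q)"
    unfolding power_add using lo hi e prod_mono[of N ?e "\<lambda>_. hi"] assms
    by (intro mult_mono power_mono)
      (auto intro!: prod_nonneg mult_nonneg_nonneg order_trans[OF lo(1) e(1)])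
  have "lam * lo ^ (card N + p + q) \<le> rec_value \<beta> \<gamma> lam p q N x"
    "rec_value \<beta> \<gamma> lam p q N x \<le> lam * hi ^ (card N + p + q)"
    unfolding rec_value_def using P1 P2 assms(3) by auto
  moreover have "0 \<le> lam * lo ^ (card N + p + q)" using lo assms by simp
  ultimately have *: "log_ext (lam * lo ^ (card N + p + q)) \<le> log_ext (rec_value \<beta> \<gamma> lam p q N x)"
    "log_ext (rec_value \<beta> \<gamma> lam p q N x) \<le> log_ext (lam * hi ^ (card N + p + q))"
    by (auto intro!: log_ext_mono)
  have "lo = \<beta> \<and> hi = 1 / \<gamma> \<or> lo = 1 / \<gamma> \<and> hi = \<beta>" by (auto simp: lo_def hi_def)
  with * show ?thesis
    by (auto simp: J_int_def Let_def power_one_over min_le_iff_disj le_max_iff_disj divide_inverse power_inverse)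
qed

lemma pot_deriv_nonneg:
  assumes "\<forall>x. 0 < pot_deriv \<Psi> (ereal x)"
  shows "0 \<le> pot_deriv \<Psi> y"
proof (cases y)
  case (real r)
  then show ?thesis using assms less_imp_le by blast
qed (auto simp: pot_deriv_def)

lemma at_ext_nonneg:
  assumes "\<And>x. 0 \<le> F x"
  shows "0 \<le> at_ext F y"
  using assms by (cases y) (auto simp: at_ext_def intro!: le_Limsup)

lemma general_potentialD_contraction:
  assumes "general_potential \<Delta> \<beta> \<gamma> lam \<alpha> c \<Psi>" "1 \<le> d" "enat d < \<Delta>" "\<And>i. z i \<in> range \<Psi>"
  shows "(\<Sum>i=1..d. contraction_term \<beta> \<gamma> lam \<Psi> d (\<lambda>j. inv \<Psi> (z j)) i) \<le> ereal (1 - \<alpha>)"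
  using assms unfolding general_potential_def by blast

lemma contraction_sum_le:
  assumes pot: "general_potential \<Delta> \<beta> \<gamma> lam \<alpha> c \<Psi>"
    and par: "0 \<le> \<beta>" "0 < \<gamma>" "0 < lam"
    and N: "finite N" "N \<noteq> {}" "\<And>u. u \<in> N \<Longrightarrow> 0 \<le> x u"
    and d: "enat (card N + p + q) < \<Delta>"
  shows "(\<Sum>u\<in>{u \<in> N. 0 < x u}. pot_deriv \<Psi> (log_ext (rec_value \<beta> \<gamma> lam p q N x))
      / pot_deriv \<Psi> (ereal (ln (x u))) * \<bar>h_fun \<beta> \<gamma> (ln (x u))\<bar>) \<le> 1 - \<alpha>"
    (is "sum ?g _ \<le> _")
proof -
  define n where "n = card N"
  obtain e where e: "bij_betw e {1..n} N"
    using ex_bij_betw_nat_finite_1[OF N(1)] unfolding n_def by blast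
  \<comment> \<open>The argument \<infinity> is a child of spin 1, with edge ratio \<beta>, and
    -\<infinity> a child of spin 0, with edge ratio 1 / \<gamma>. A free child with
    \<open>x u = 0\<close> also sits at -\<infinity>.\<close>
  define y where "y = (\<lambda>i. if i \<le> n then log_ext (x (e i)) else if i \<le> n + p then \<infinity> else -\<infinity>)"
  define I where "I = {i \<in> {1..n}. 0 < x (e i)}"
  have n: "1 \<le> n" using N by (simp add: n_def Suc_le_eq card_gt_0_iff)
  have x: "0 \<le> x (e i)" if "i \<in> {1..n}" for i
    using that e N by (auto simp: bij_betw_def)
  let ?r = "\<lambda>i. edge_ratio \<beta> \<gamma> (y i)" and ?t = "\<lambda>u. (\<beta> * x u + 1) / (x u + \<gamma>)"
  have 1: "prod ?r {1..n} = prod ?t N"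
  proof -
    have "prod ?r {1..n} = (\<Prod>i\<in>{1..n}. ?t (e i))"
    proof (rule prod.cong[OF refl])
      fix i assume i: "i \<in> {1..n}"
      then have "y i = log_ext (x (e i))" by (simp add: y_def)
      then show "?r i = ?t (e i)" using x[OF i] par(2) by (simp only: edge_ratio_log_ext)
    qed
    also have "\<dots> = prod ?t N" by (rule prod.reindex_bij_betw[OF e])
    finally show ?thesis .
  qed
  have 2: "prod ?r {n + 1..n + p} = \<beta> ^ p"
  proof -
    have "prod ?r {n + 1..n + p} = (\<Prod>i\<in>{n + 1..n + p}. \<beta>)"
      by (rule prod.cong[OF refl]) (simp add: y_def edge_ratio_def)
    then show ?thesis by simp
  qed
  have 3: "prod ?r {n + p + 1..n + p + q} = (1 / \<gamma>) ^ q"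
  proof -
    have "prod ?r {n + p + 1..n + p + q} = (\<Prod>i\<in>{n + p + 1..n + p + q}. 1 / \<gamma>)"
      by (rule prod.cong[OF refl]) (simp add: y_def edge_ratio_def)
    then show ?thesis by simp
  qed
  have "prod ?r {1..n + p + q}
      = prod ?r {1..n} * prod ?r {n + 1..n + p} * prod ?r {n + p + 1..n + p + q}"
    by (simp only: prod.ub_add_nat[of 1 "n + p" ?r q] prod.ub_add_nat[of 1 n ?r p] le_add2)
  then have rec: "tree_rec \<beta> \<gamma> lam (n + p + q) y = log_ext (rec_value \<beta> \<gamma> lam p q N x)"
    by (simp only: 1 2 3 tree_rec_eq[OF par] rec_value_def)
  have mono: "strict_mono \<Psi>" and pos: "\<forall>x. 0 < pot_deriv \<Psi> (ereal x)"
    using pot by (auto simp: general_potential_def)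
  have "inj \<Psi>" using mono by (rule strict_mono_imp_inj_on)
  then have inv: "(\<lambda>j. inv \<Psi> (\<Psi> (y j))) = y" by (simp add: inv_f_f)
  have d': "enat (n + p + q) < \<Delta>" using d by (simp add: n_def)
  have "(\<Sum>i=1..n + p + q. contraction_term \<beta> \<gamma> lam \<Psi> (n + p + q) (\<lambda>j. inv \<Psi> (\<Psi> (y j))) i)
      \<le> ereal (1 - \<alpha>)"
    using n d' by (intro general_potentialD_contraction[OF pot]) auto
  then have bound: "(\<Sum>i=1..n + p + q. contraction_term \<beta> \<gamma> lam \<Psi> (n + p + q) y i) \<le> ereal (1 - \<alpha>)"
    unfolding inv .
  have nonneg: "0 \<le> contraction_term \<beta> \<gamma> lam \<Psi> (n + p + q) y i" for i
    unfolding contraction_term_def using pot_deriv_nonneg[OF pos] by (intro at_ext_nonneg) simp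
  have val: "contraction_term \<beta> \<gamma> lam \<Psi> (n + p + q) y i = ereal (?g (e i))" if i: "i \<in> I" for i
  proof -
    have yi: "y i = ereal (ln (x (e i)))" using i by (auto simp: I_def y_def log_ext_def)
    have upd: "y(i := ereal (ln (x (e i)))) = y" using yi by (simp add: fun_upd_idem)
    show ?thesis unfolding contraction_term_def yi at_ext_def by (simp add: upd rec)
  qed
  have "bij_betw e I {u \<in> N. 0 < x u}"
  proof (rule bij_betw_subset[OF e])
    have "N = e ` {1..n}" using e by (simp add: bij_betw_def)
    then show "e ` I = {u \<in> N. 0 < x u}" unfolding I_def by blast
  qed (auto simp: I_def)
  then have "ereal (sum ?g {u \<in> N. 0 < x u}) = ereal (\<Sum>i\<in>I. ?g (e i))"
    using sum.reindex_bij_betw[of e I "{u \<in> N. 0 < x u}" ?g] by simp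
  also have "\<dots> = (\<Sum>i\<in>I. contraction_term \<beta> \<gamma> lam \<Psi> (n + p + q) y i)"
    using val by simp
  also have "\<dots> \<le> (\<Sum>i=1..n + p + q. contraction_term \<beta> \<gamma> lam \<Psi> (n + p + q) y i)"
    using nonneg by (intro sum_mono2) (auto simp: I_def)
  also note bound
  finally show ?thesis by simp
qed

lemma boundedness_le:
  assumes pot: "general_potential \<Delta> \<beta> \<gamma> lam \<alpha> c \<Psi>"
    and "enat d1 < \<Delta>" "enat d2 < \<Delta>" "ereal y1 \<in> J_int \<beta> \<gamma> lam d1" "y2 \<in> J_int \<beta> \<gamma> lam d2"
  shows "pot_deriv \<Psi> y2 / pot_deriv \<Psi> (ereal y1) * \<bar>h_fun \<beta> \<gamma> y1\<bar>
      \<le> 2 * c / (real d1 + real d2 + 2)"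
proof -
  have "boundedness_term \<beta> \<gamma> \<Psi> (ereal y1) y2 \<le> ereal (2 * c / (real d1 + real d2 + 2))"
    using assms unfolding general_potential_def by blast
  then show ?thesis by (simp add: boundedness_term_def at_ext_def)
qed

context two_spin
begin

lemma edge_influence_eq_h_fun:
  assumes "0 < x"
  shows "edge_influence x = h_fun \<beta> \<gamma> (ln (\<gamma> * x))"
proof -
  have "0 < \<gamma> * x" "0 < \<gamma> * x + \<gamma>" "0 < 1 + \<rho> * x"
    using assms gamma rho_nonneg by (auto intro: add_pos_nonneg add_pos_pos)
  moreover have "\<gamma> * x + \<gamma> = \<gamma> * (1 + x)" by (simp add: algebra_simps)
  ultimately show ?thesis
    using gamma assms unfolding edge_influence_def h_fun_def \<rho>_def
    by (simp add: divide_simps) (simp add: algebra_simps)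
qed

text \<open>The \<open>+ 1\<close> in the degree is the deleted parent of \<open>r\<close>. It
  contributes 1 / \<gamma> to the odds but is no child in the tree recursion; hence the recursion
  computes \<gamma> times the odds.\<close>

lemma ratio_eq_rec_value:
  assumes "deg r = a r + card N + q + 1" "finite N" "\<And>u. u \<in> N \<Longrightarrow> 0 \<le> x u"
    "R = fld a r * (\<Prod>u\<in>N. edge_factor (x u))"
  shows "\<gamma> * R = rec_value \<beta> \<gamma> lam (a r) q N (\<lambda>u. \<gamma> * x u)"
proof -
  have "(\<Prod>u\<in>N. edge_factor (x u)) = (\<Prod>u\<in>N. \<gamma> * ((\<beta> * (\<gamma> * x u) + 1) / (\<gamma> * x u + \<gamma>)))"
  proof (intro prod.cong refl)
    fix u assume "u \<in> N"
    have eq: "\<gamma> * x u + \<gamma> = \<gamma> * (1 + x u)" by (simp add: algebra_simps)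
    show "edge_factor (x u) = \<gamma> * ((\<beta> * (\<gamma> * x u) + 1) / (\<gamma> * x u + \<gamma>))"
      unfolding eq edge_factor_def \<rho>_def using gamma by (simp add: ac_simps)
  qed
  then have "(\<Prod>u\<in>N. edge_factor (x u)) = \<gamma> ^ card N * (\<Prod>u\<in>N. (\<beta> * (\<gamma> * x u) + 1) / (\<gamma> * x u + \<gamma>))"
    by (simp only: prod.distrib prod_constant)
  then show ?thesis
    unfolding assms(4) rec_value_def fld_def assms(1) \<rho>_def using gamma
    by (simp add: power_add power_mult_distrib power_one_over)
qed

text \<open>The slack in the inequality plays the role of the number of neighbours pinned to
  0.\<close>

definition consistent :: "(nat \<Rightarrow> nat) \<Rightarrow> nat set \<Rightarrow> bool" where
  "consistent a U \<longleftrightarrow> (\<forall>v\<in>U. a v + card (nb v \<inter> U) \<le> deg v)"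

lemma consistent_remove:
  assumes "finite U" "consistent a U" "r \<in> U" "M \<subseteq> nb r \<inter> U"
  shows "consistent (inc M a) (U - {r})"
  unfolding consistent_def
proof
  fix v assume v: "v \<in> U - {r}"
  have c: "a v + card (nb v \<inter> U) \<le> deg v" using assms v by (auto simp: consistent_def)
  show "inc M a v + card (nb v \<inter> (U - {r})) \<le> deg v"
  proof (cases "v \<in> nb r")
    case True
    then have "r \<in> nb v \<inter> U" using nb_sym assms by auto
    moreover have "nb v \<inter> (U - {r}) = (nb v \<inter> U) - {r}" by auto
    ultimately have "card (nb v \<inter> U) = card (nb v \<inter> (U - {r})) + 1"
      using assms(1) by (metis card_Suc_Diff1 finite_Int Suc_eq_plus1)
    then show ?thesis using c by (simp add: inc_def)
  next
    case False
    then have "v \<notin> M" using assms by auto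
    moreover have "nb v \<inter> (U - {r}) = nb v \<inter> U" using False nb_sym by auto
    ultimately show ?thesis using c by (simp add: inc_def)
  qed
qed

text \<open>As \<open>u\<close> does not belong to \<open>M\<close>, the removed \<open>r\<close>
  acts on it as a neighbour pinned to 0. The slack \<open>+ 1\<close> leaves at most
  \<open>deg u - 1\<close> children, the number that the contraction condition can handle.\<close>

lemma consistent_child:
  assumes "finite U" "consistent a U" "r \<in> U" "u \<in> nb r \<inter> U" "M \<subseteq> nb r \<inter> U - {u}"
  shows "inc M a u + card (nb u \<inter> (U - {r})) + 1 \<le> deg u"
proof -
  have c: "a u + card (nb u \<inter> U) \<le> deg u" using assms by (auto simp: consistent_def)
  have "r \<in> nb u \<inter> U" using nb_sym assms by auto
  moreover have "nb u \<inter> (U - {r}) = (nb u \<inter> U) - {r}" by auto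
  ultimately have "card (nb u \<inter> U) = card (nb u \<inter> (U - {r})) + 1"
    using assms(1) by (metis card_Suc_Diff1 finite_Int Suc_eq_plus1)
  moreover have "u \<notin> M" using assms by auto
  ultimately show ?thesis using c by (simp add: inc_def)
qed

end

section \<open>Bounds on influences from the potential\<close>

locale two_spin_potential = two_spin +
  fixes \<Delta> :: enat and \<alpha> c :: real and \<Psi> :: "ereal \<Rightarrow> real"
  assumes potential: "general_potential \<Delta> \<beta> \<gamma> lam \<alpha> c \<Psi>"
    and alpha: "0 < \<alpha>" "\<alpha> < 1" and c_pos: "0 < c"
    and max_degree: "\<And>v. v \<in> V \<Longrightarrow> enat (deg v) \<le> \<Delta>"
begin

lemma psi_pos: "0 < pot_deriv \<Psi> (ereal x)"
  using potential by (simp add: general_potential_def)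

lemma children_less: "v \<in> V \<Longrightarrow> deg v = Suc d \<Longrightarrow> enat d < \<Delta>"
  using max_degree[of v] by (metis Suc_ile_eq)

lemma log_ratio_in_J_int:
  assumes "finite U" "r \<in> U" "0 < ratio a U r" "a r + card (nb r \<inter> U) + 1 \<le> deg r"
  shows "ereal (ln (\<gamma> * ratio a U r)) \<in> J_int \<beta> \<gamma> lam (deg r - 1)"
proof -
  let ?N = "nb r \<inter> U"
  obtain q where q: "deg r = a r + card ?N + q + 1"
    using assms(4) by (metis add.assoc add.commute le_Suc_ex)
  obtain M where "ratio a U r = fld a r * (\<Prod>u\<in>?N. edge_factor (ratio (inc (M u) a) (U - {r}) u))"
    using tree_recursion[OF assms(1-3)] by blast
  then have "\<gamma> * ratio a U r = rec_value \<beta> \<gamma> lam (a r) q ?N (\<lambda>u. \<gamma> * ratio (inc (M u) a) (U - {r}) u)"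
    using q assms ratio_nonneg by (intro ratio_eq_rec_value) auto
  then have "log_ext (\<gamma> * ratio a U r) \<in> J_int \<beta> \<gamma> lam (card ?N + a r + q)"
    using assms(1) ratio_nonneg[of "U - {r}"] beta gamma lam
    by (simp del: power_Suc) (intro rec_value_in_J_int, auto)
  moreover have "log_ext (\<gamma> * ratio a U r) = ereal (ln (\<gamma> * ratio a U r))"
    using assms(3) gamma by (simp add: log_ext_def)
  ultimately show ?thesis using q by (simp add: ac_simps)
qed

text \<open>Summing over the levels of the recursion, the contraction condition yields a geometric
  series; the test weights \<open>A v\<close> absorb the value of the derivative of the potential at the far
  end of a path.\<close>

lemma weighted_influence_le:
  assumes "finite U" "U \<subseteq> V" "r \<in> U" "consistent a U" "a r + card (nb r \<inter> U) + 1 \<le> deg r"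
    and "0 < ratio a U r"
    and "\<And>v. v \<in> U \<Longrightarrow> 0 \<le> A v"
    and "\<And>v z. v \<in> U \<Longrightarrow> z \<in> J_int \<beta> \<gamma> lam (deg v - 1) \<Longrightarrow> A v * pot_deriv \<Psi> z \<le> 1"
  shows "pot_deriv \<Psi> (ereal (ln (\<gamma> * ratio a U r)))
      * (\<Sum>v\<in>U. A v * \<bar>mean_diff U (wt a) r (occ v)\<bar>) \<le> 1 / \<alpha>"
  using assms
proof (induction "card U" arbitrary: U a r rule: less_induct)
  case less
  let ?U = "U - {r}" and ?N = "nb r \<inter> U"
  let ?psi = "\<lambda>x. pot_deriv \<Psi> (ereal (ln x))"
  note fin = less.prems(1)
  define P where "P = ?psi (\<gamma> * ratio a U r)"
  have P: "0 < P" unfolding P_def by (rule psi_pos)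
  obtain M where M: "\<forall>u\<in>?N. M u \<subseteq> ?N - {u}"
    and R: "ratio a U r = fld a r * (\<Prod>u\<in>?N. edge_factor (ratio (inc (M u) a) ?U u))"
    and I: "\<And>v. v \<in> ?U \<Longrightarrow> \<bar>mean_diff U (wt a) r (occ v)\<bar> \<le>
      (\<Sum>u\<in>?N. \<bar>edge_influence (ratio (inc (M u) a) ?U u)\<bar>
        * \<bar>mean_diff ?U (wt (inc (M u) a)) u (occ v)\<bar>)"
    using tree_recursion[OF fin less.prems(3,6)] by blast
  define x where "x = (\<lambda>u. ratio (inc (M u) a) ?U u)"
  define S where "S = (\<lambda>u. \<Sum>v\<in>?U. A v * \<bar>mean_diff ?U (wt (inc (M u) a)) u (occ v)\<bar>)"
  have x0: "0 \<le> x u" for u using fin by (simp add: x_def ratio_nonneg)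
  have NU: "?N \<subseteq> ?U" using nb_irrefl by auto
  have child: "\<bar>edge_influence (x u)\<bar> * S u \<le> \<bar>h_fun \<beta> \<gamma> (ln (\<gamma> * x u))\<bar> / (\<alpha> * ?psi (\<gamma> * x u))"
    if u: "u \<in> ?N" and xu: "0 < x u" for u
  proof -
    have "?psi (\<gamma> * x u) * S u \<le> 1 / \<alpha>"
      unfolding S_def x_def
    proof (rule less.hyps)
      show "card ?U < card U" using fin less.prems(3) by (intro psubset_card_mono) auto
      show "consistent (inc (M u) a) ?U"
        using consistent_remove[OF fin less.prems(4,3)] M u by blast
      show "inc (M u) a u + card (nb u \<inter> ?U) + 1 \<le> deg u"
        using consistent_child[OF fin less.prems(4,3)] M u by blast
      show "0 < ratio (inc (M u) a) ?U u" using xu by (simp add: x_def)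
    qed (use fin less.prems u NU in auto)
    then have "S u \<le> 1 / \<alpha> / ?psi (\<gamma> * x u)"
      using psi_pos[of "ln (\<gamma> * x u)"] by (simp only: pos_le_divide_eq mult.commute)
    then have "S u \<le> 1 / (\<alpha> * ?psi (\<gamma> * x u))" by simp
    then have "\<bar>edge_influence (x u)\<bar> * S u \<le> \<bar>edge_influence (x u)\<bar> * (1 / (\<alpha> * ?psi (\<gamma> * x u)))"
      by (intro mult_left_mono) auto
    then show ?thesis by (simp add: edge_influence_eq_h_fun[OF xu])
  qed
  have contr: "P * (\<Sum>u\<in>{u \<in> ?N. 0 < x u}. \<bar>h_fun \<beta> \<gamma> (ln (\<gamma> * x u))\<bar> / ?psi (\<gamma> * x u)) \<le> 1 - \<alpha>"
  proof (cases "?N = {}")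
    case False
    obtain q where q: "deg r = a r + card ?N + q + 1"
      using less.prems(5) by (metis add.assoc add.commute le_Suc_ex)
    have rec: "\<gamma> * ratio a U r = rec_value \<beta> \<gamma> lam (a r) q ?N (\<lambda>u. \<gamma> * x u)"
      using q fin x0 R by (intro ratio_eq_rec_value) (auto simp: x_def)
    have log: "log_ext (\<gamma> * ratio a U r) = ereal (ln (\<gamma> * ratio a U r))"
      using less.prems(6) gamma by (simp add: log_ext_def)
    have "enat (card ?N + a r + q) < \<Delta>"
      using q less.prems(2,3) by (intro children_less[of r]) auto
    then have "(\<Sum>u\<in>{u \<in> ?N. 0 < \<gamma> * x u}. pot_deriv \<Psi> (log_ext (rec_value \<beta> \<gamma> lam (a r) q ?N (\<lambda>u. \<gamma> * x u)))
      / ?psi (\<gamma> * x u) * \<bar>h_fun \<beta> \<gamma> (ln (\<gamma> * x u))\<bar>) \<le> 1 - \<alpha>"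
      using fin False x0 gamma beta lam
      by (intro contraction_sum_le[OF potential, where x = "\<lambda>u. \<gamma> * x u"]) auto
    then show ?thesis
      unfolding rec[symmetric] log P_def[symmetric]
      using gamma by (simp add: sum_distrib_left zero_less_mult_iff)
  qed (use alpha in simp)
  have own: "\<bar>mean_diff U (wt a) r (occ r)\<bar> \<le> 1"
  proof -
    have "wsum ?U (wt a) (occ r) = 0" by (auto simp: wsum_def occ_def intro!: sum.neutral)
    moreover have "occ r \<circ> insert r = (\<lambda>_. 1)" by (auto simp: occ_def)
    ultimately show ?thesis by (simp add: mean_diff_def wmean_def wsum_const)
  qed
  have "(\<Sum>v\<in>?U. A v * \<bar>mean_diff U (wt a) r (occ v)\<bar>)
      \<le> (\<Sum>v\<in>?U. A v * (\<Sum>u\<in>?N. \<bar>edge_influence (x u)\<bar>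
        * \<bar>mean_diff ?U (wt (inc (M u) a)) u (occ v)\<bar>))"
    using I less.prems(7) by (intro sum_mono mult_left_mono) (auto simp: x_def)
  also have "\<dots> = (\<Sum>u\<in>?N. \<bar>edge_influence (x u)\<bar> * S u)"
    unfolding S_def sum_distrib_left by (subst sum.swap) (simp add: ac_simps)
  \<comment> \<open>A child of odds 0 is frozen: its edge influence is 0, and the induction
    hypothesis speaks of positive odds only.\<close>
  also have "\<dots> = (\<Sum>u\<in>{u \<in> ?N. 0 < x u}. \<bar>edge_influence (x u)\<bar> * S u)"
    using fin x0 by (intro sum.mono_neutral_right) (auto simp: edge_influence_def less_le)
  also have "\<dots> \<le> (\<Sum>u\<in>{u \<in> ?N. 0 < x u}. \<bar>h_fun \<beta> \<gamma> (ln (\<gamma> * x u))\<bar> / (\<alpha> * ?psi (\<gamma> * x u)))"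
    using child by (intro sum_mono) auto
  also have "\<dots> = (\<Sum>u\<in>{u \<in> ?N. 0 < x u}. \<bar>h_fun \<beta> \<gamma> (ln (\<gamma> * x u))\<bar> / ?psi (\<gamma> * x u)) / \<alpha>"
    by (simp add: sum_divide_distrib mult.commute)
  finally have "P * (\<Sum>v\<in>?U. A v * \<bar>mean_diff U (wt a) r (occ v)\<bar>) \<le>
      P * ((\<Sum>u\<in>{u \<in> ?N. 0 < x u}. \<bar>h_fun \<beta> \<gamma> (ln (\<gamma> * x u))\<bar> / ?psi (\<gamma> * x u)) / \<alpha>)"
    using P by (intro mult_left_mono) auto
  also have "\<dots> \<le> (1 - \<alpha>) / \<alpha>"
    using contr alpha by (simp add: divide_right_mono)
  finally have rest: "P * (\<Sum>v\<in>?U. A v * \<bar>mean_diff U (wt a) r (occ v)\<bar>) \<le> (1 - \<alpha>) / \<alpha>" .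
  \<comment> \<open>The vertex \<open>r\<close> itself is the first term of the series: it
    contributes at most 1, and 1 + (1 - \<alpha>) / \<alpha> = 1 / \<alpha>.\<close>
  have "P * (A r * \<bar>mean_diff U (wt a) r (occ r)\<bar>) \<le> P * (A r * 1)"
    using own P less.prems(3,7) by (intro mult_left_mono) auto
  also have "\<dots> \<le> 1"
    using less.prems(8)[OF less.prems(3) log_ratio_in_J_int[OF fin less.prems(3,6,5)]]
    by (simp add: P_def mult.commute)
  finally have "P * (A r * \<bar>mean_diff U (wt a) r (occ r)\<bar>) \<le> 1" .
  moreover have "(\<Sum>v\<in>U. A v * \<bar>mean_diff U (wt a) r (occ v)\<bar>) = A r * \<bar>mean_diff U (wt a) r (occ r)\<bar>
      + (\<Sum>v\<in>?U. A v * \<bar>mean_diff U (wt a) r (occ v)\<bar>)"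
    using fin less.prems(3) by (rule sum.remove)
  moreover have "1 + (1 - \<alpha>) / \<alpha> = 1 / \<alpha>" using alpha by (simp add: field_simps)
  ultimately show ?case using rest unfolding P_def[symmetric] by (simp add: distrib_left)
qed

text \<open>The root has no parent, so the contraction condition need not cover it. The recursion is
  unfolded once and \<open>weighted_influence_le\<close> is applied at each child; the sum over at
  most \<open>deg r\<close> children gives the factor on the right.\<close>

lemma total_influence_le:
  assumes "finite U" "U \<subseteq> V" "r \<in> U" "consistent a U" "0 < ratio a U r"
  shows "(\<Sum>v\<in>U - {r}. real (max 1 (deg v)) * \<bar>mean_diff U (wt a) r (occ v)\<bar>)
      \<le> 2 * c / \<alpha> * real (max 1 (deg r))"
proof -
  let ?U = "U - {r}" and ?N = "nb r \<inter> U"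
  let ?om = "\<lambda>v. real (max 1 (deg v))"
  let ?psi = "\<lambda>x. pot_deriv \<Psi> (ereal (ln x))"
  note fin = assms(1)
  obtain M where M: "\<forall>u\<in>?N. M u \<subseteq> ?N - {u}"
    and I: "\<And>v. v \<in> ?U \<Longrightarrow> \<bar>mean_diff U (wt a) r (occ v)\<bar> \<le>
      (\<Sum>u\<in>?N. \<bar>edge_influence (ratio (inc (M u) a) ?U u)\<bar>
        * \<bar>mean_diff ?U (wt (inc (M u) a)) u (occ v)\<bar>)"
    using tree_recursion[OF fin assms(3,5)] by blast
  define x where "x = (\<lambda>u. ratio (inc (M u) a) ?U u)"
  define S where "S = (\<lambda>u. \<Sum>v\<in>?U. ?om v * \<bar>mean_diff ?U (wt (inc (M u) a)) u (occ v)\<bar>)"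
  have x0: "0 \<le> x u" for u using fin by (simp add: x_def ratio_nonneg)
  have NU: "?N \<subseteq> ?U" using nb_irrefl by auto
  have child: "\<bar>edge_influence (x u)\<bar> * S u \<le> 2 * c / \<alpha>" if u: "u \<in> ?N" for u
  proof (cases "x u = 0")
    case True
    then show ?thesis using c_pos alpha by (simp add: edge_influence_def)
  next
    case False
    then have xu: "0 < x u" using x0[of u] by simp
    have cons: "consistent (inc (M u) a) ?U"
      using consistent_remove[OF fin assms(4,3)] M u by blast
    have ch: "inc (M u) a u + card (nb u \<inter> ?U) + 1 \<le> deg u"
      using consistent_child[OF fin assms(4,3)] M u by blast
    have ru: "0 < ratio (inc (M u) a) ?U u" using xu by (simp add: x_def)
    have uU: "u \<in> ?U" "u \<in> V" using u NU assms by auto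
    have J: "ereal (ln (\<gamma> * x u)) \<in> J_int \<beta> \<gamma> lam (deg u - 1)"
      unfolding x_def using fin uU ru ch by (intro log_ratio_in_J_int) auto
    \<comment> \<open>General boundedness between the child \<open>u\<close> and the far end
      \<open>v\<close> gives at most 2 c / \<open>?om v\<close>. With this \<open>b\<close> that
      becomes the condition on the test weights \<open>?om v * b\<close>.\<close>
    define b where "b = \<bar>edge_influence (x u)\<bar> / (2 * c * ?psi (\<gamma> * x u))"
    have b: "0 \<le> b" using psi_pos[of "ln (\<gamma> * x u)"] c_pos by (simp add: b_def)
    have "?psi (\<gamma> * x u) * (\<Sum>v\<in>?U. (?om v * b) * \<bar>mean_diff ?U (wt (inc (M u) a)) u (occ v)\<bar>) \<le> 1 / \<alpha>"
      unfolding x_def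
    proof (rule weighted_influence_le[OF _ _ uU(1) cons ch ru])
      fix v z assume v: "v \<in> ?U" and z: "z \<in> J_int \<beta> \<gamma> lam (deg v - 1)"
      have "enat (deg v - 1) < \<Delta>" "enat (deg u - 1) < \<Delta>"
      proof -
        show "enat (deg u - 1) < \<Delta>" using ch uU children_less[of u "deg u - 1"] by simp
        show "enat (deg v - 1) < \<Delta>"
        \<comment> \<open>For an isolated \<open>v\<close> the subtraction is truncated; the index 0
          is below \<Delta> because \<open>deg u - 1\<close> is.\<close>
        proof (cases "deg v = 0")
          case True
          then show ?thesis using \<open>enat (deg u - 1) < \<Delta>\<close>
            by (metis diff_0_eq_0 gr_zeroI not_less_zero zero_enat_def)
        next
          case False
          then show ?thesis using v assms(2) children_less[of v "deg v - 1"] by auto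
        qed
      qed
      then have "pot_deriv \<Psi> z / ?psi (\<gamma> * x u) * \<bar>h_fun \<beta> \<gamma> (ln (\<gamma> * x u))\<bar>
          \<le> 2 * c / (real (deg u - 1) + real (deg v - 1) + 2)"
        using J z by (intro boundedness_le[OF potential]) auto
      also have "\<dots> \<le> 2 * c / ?om v"
        using c_pos by (intro divide_left_mono) auto
      finally have "?om v * (pot_deriv \<Psi> z / ?psi (\<gamma> * x u) * \<bar>h_fun \<beta> \<gamma> (ln (\<gamma> * x u))\<bar>)
          \<le> ?om v * (2 * c / ?om v)"
        by (intro mult_left_mono) auto
      also have "?om v * (2 * c / ?om v) = 2 * c" by simp
      finally show "?om v * b * pot_deriv \<Psi> z \<le> 1"
        using c_pos psi_pos[of "ln (\<gamma> * x u)"]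
        by (simp add: b_def edge_influence_eq_h_fun[OF xu] divide_simps) (simp add: ac_simps)
    qed (use fin assms b in auto)
    then have "?psi (\<gamma> * x u) * (b * S u) \<le> 1 / \<alpha>"
      by (simp add: S_def sum_distrib_left ac_simps)
    moreover have "?psi (\<gamma> * x u) * (b * S u) = \<bar>edge_influence (x u)\<bar> * S u / (2 * c)"
      using psi_pos[of "ln (\<gamma> * x u)"] c_pos by (simp add: b_def)
    ultimately have "\<bar>edge_influence (x u)\<bar> * S u / (2 * c) \<le> 1 / \<alpha>" by simp
    then have "\<bar>edge_influence (x u)\<bar> * S u \<le> 1 / \<alpha> * (2 * c)"
      using c_pos by (simp only: pos_divide_le_eq mult_pos_pos zero_less_numeral)
    then show ?thesis by simp
  qed
  have "(\<Sum>v\<in>?U. ?om v * \<bar>mean_diff U (wt a) r (occ v)\<bar>)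
      \<le> (\<Sum>v\<in>?U. ?om v * (\<Sum>u\<in>?N. \<bar>edge_influence (x u)\<bar>
        * \<bar>mean_diff ?U (wt (inc (M u) a)) u (occ v)\<bar>))"
    using I by (intro sum_mono mult_left_mono) (auto simp: x_def)
  also have "\<dots> = (\<Sum>u\<in>?N. \<bar>edge_influence (x u)\<bar> * S u)"
    unfolding S_def sum_distrib_left by (subst sum.swap) (simp add: ac_simps)
  also have "\<dots> \<le> (\<Sum>u\<in>?N. 2 * c / \<alpha>)" using child by (intro sum_mono)
  also have "\<dots> = 2 * c / \<alpha> * real (card ?N)" by simp
  also have "\<dots> \<le> 2 * c / \<alpha> * ?om r"
  proof -
    have "card ?N \<le> deg r" using card_mono[of "nb r" ?N] finite_nb card_nb by simp
    then show ?thesis using c_pos alpha by (intro mult_left_mono) auto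
  qed
  finally show ?thesis .
qed

end

section \<open>The heat-bath chain\<close>

definition resample ::
  "('a set \<Rightarrow> real) \<Rightarrow> 'a \<Rightarrow> ('a set \<Rightarrow> real) \<Rightarrow> 'a set \<Rightarrow> real" where
  "resample w v f A = (w (A - {v}) * f (A - {v}) + w (insert v A) * f (insert v A))
     / (w (A - {v}) + w (insert v A))"

definition heat ::
  "'a set \<Rightarrow> ('a set \<Rightarrow> real) \<Rightarrow> ('a set \<Rightarrow> real) \<Rightarrow> 'a set \<Rightarrow> real" where
  "heat U w f A = (\<Sum>v\<in>U. resample w v f A) / real (card U)"

text \<open>\<open>resample w v f\<close> is the conditional expectation of \<open>f\<close> given
  the spins off \<open>v\<close>: it keeps the mean and takes exactly the local variance away from
  the second moment.\<close>

lemma wsum_resample: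
  assumes "finite U" "v \<in> U" and w: "\<And>A. A \<subseteq> U \<Longrightarrow> 0 \<le> w A"
  shows "wsum U w (resample w v f) = wsum U w f"
    and "wsum U w (\<lambda>A. (resample w v f A)\<^sup>2) = wsum U w (\<lambda>A. (f A)\<^sup>2) - dirich v U w f"
proof -
  define m where "m = (\<lambda>A. (w A * f A + w (insert v A) * f (insert v A)) / (w A + w (insert v A)))"
  have pt: "resample w v f A = m A" "resample w v f (insert v A) = m A" if "A \<in> Pow (U - {v})" for A
  proof -
    have "A - {v} = A" "insert v A - {v} = A" using that by auto
    then show "resample w v f A = m A" "resample w v f (insert v A) = m A"
      by (simp_all add: resample_def m_def)
  qed
  have key: "(w A + w (insert v A)) * m A = w A * f A + w (insert v A) * f (insert v A)"
    "(w A + w (insert v A)) * (m A)\<^sup>2 = w A * (f A)\<^sup>2 + w (insert v A) * (f (insert v A))\<^sup>2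
      - w A * w (insert v A) / (w A + w (insert v A)) * (f (insert v A) - f A)\<^sup>2"
    if A: "A \<in> Pow (U - {v})" for A
  proof -
    define a b x y where "a = w A" and "b = w (insert v A)" and "x = f A" and "y = f (insert v A)"
    have ab: "0 \<le> a" "0 \<le> b" using A w assms(2) by (auto simp: a_def b_def subset_Diff_insert)
    have "(a + b) * ((a * x + b * y) / (a + b)) = a * x + b * y \<and>
      (a + b) * ((a * x + b * y) / (a + b))\<^sup>2 = a * x\<^sup>2 + b * y\<^sup>2 - a * b / (a + b) * (y - x)\<^sup>2"
    proof (cases "a + b = 0")
      case True
      then show ?thesis using ab by (simp add: add_nonneg_eq_0_iff)
    next
      case False
      then show ?thesis
        by (simp add: divide_simps) (simp add: power2_eq_square algebra_simps)
    qed
    then show "(w A + w (insert v A)) * m A = w A * f A + w (insert v A) * f (insert v A)"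
    "(w A + w (insert v A)) * (m A)\<^sup>2 = w A * (f A)\<^sup>2 + w (insert v A) * (f (insert v A))\<^sup>2
      - w A * w (insert v A) / (w A + w (insert v A)) * (f (insert v A) - f A)\<^sup>2"
      by (simp_all only: m_def a_def b_def x_def y_def)
  qed
  have "wsum U w (resample w v f) = (\<Sum>A\<in>Pow (U - {v}). (w A + w (insert v A)) * m A)"
    unfolding wsum_def sum_Pow_split[OF assms(1,2)]
    by (intro sum.cong refl) (simp only: pt distrib_right)
  also have "\<dots> = wsum U w f"
    unfolding wsum_def sum_Pow_split[OF assms(1,2)] by (intro sum.cong refl) (simp only: key)
  finally show "wsum U w (resample w v f) = wsum U w f" .
  have "wsum U w (\<lambda>A. (resample w v f A)\<^sup>2) = (\<Sum>A\<in>Pow (U - {v}). (w A + w (insert v A)) * (m A)\<^sup>2)"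
    unfolding wsum_def sum_Pow_split[OF assms(1,2)]
    by (intro sum.cong refl) (simp only: pt distrib_right)
  also have "\<dots> = wsum U w (\<lambda>A. (f A)\<^sup>2) - dirich v U w f"
    unfolding wsum_def sum_Pow_split[OF assms(1,2)] dirich_def sum_subtractf[symmetric]
    by (intro sum.cong refl) (simp only: key)
  finally show "wsum U w (\<lambda>A. (resample w v f A)\<^sup>2) = wsum U w (\<lambda>A. (f A)\<^sup>2) - dirich v U w f" .
qed

lemma wsum_heat:
  assumes "finite U" "U \<noteq> {}" "\<And>A. A \<subseteq> U \<Longrightarrow> 0 \<le> w A"
  shows "wsum U w (heat U w f) = wsum U w f"
proof -
  have n: "real (card U) \<noteq> 0" using assms by simp
  have "wsum U w (heat U w f) = wsum U w (\<lambda>A. \<Sum>v\<in>U. (1 / real (card U)) * resample w v f A)"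
    by (simp add: heat_def[abs_def] sum_divide_distrib)
  also have "\<dots> = (\<Sum>v\<in>U. (1 / real (card U)) * wsum U w (resample w v f))"
    by (simp only: wsum_sum wsum_cmult)
  also have "\<dots> = (\<Sum>v\<in>U. (1 / real (card U)) * wsum U w f)"
    using wsum_resample(1)[OF assms(1) _ assms(3)] by simp
  finally show ?thesis using n by simp
qed

text \<open>A step averages conditional expectations, and the square of an average is at most the
  average of the squares. This direct decay of the variance replaces an eigenvalue argument.\<close>

lemma wvar_heat_le:
  assumes "finite U" "U \<noteq> {}" and w: "\<And>A. A \<subseteq> U \<Longrightarrow> 0 \<le> w A"
  shows "wvar U w (heat U w f) \<le> wvar U w f - dirichlet U w f / real (card U)"
proof -
  let ?n = "real (card U)"
  have n: "0 < ?n" using assms by (simp add: card_gt_0_iff)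
  have "(heat U w f A)\<^sup>2 \<le> (\<Sum>v\<in>U. (1 / ?n) * (resample w v f A)\<^sup>2)" for A
  proof -
    have "(heat U w f A)\<^sup>2 = (\<Sum>v\<in>U. resample w v f A)\<^sup>2 / ?n\<^sup>2"
      by (simp add: heat_def power_divide)
    also have "\<dots> \<le> (\<Sum>v\<in>U. (resample w v f A)\<^sup>2) * ?n / ?n\<^sup>2"
      using sum_squared_le_sum_of_squares[of "\<lambda>v. resample w v f A" U]
      by (intro divide_right_mono) auto
    also have "\<dots> = (\<Sum>v\<in>U. (1 / ?n) * (resample w v f A)\<^sup>2)"
      using n by (simp add: power2_eq_square sum_divide_distrib)
    finally show ?thesis .
  qed
  then have "wsum U w (\<lambda>A. (heat U w f A)\<^sup>2)
      \<le> wsum U w (\<lambda>A. \<Sum>v\<in>U. (1 / ?n) * (resample w v f A)\<^sup>2)"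
    by (intro wsum_mono w)
  also have "\<dots> = (\<Sum>v\<in>U. (1 / ?n) * wsum U w (\<lambda>A. (resample w v f A)\<^sup>2))"
    by (simp only: wsum_sum wsum_cmult)
  also have "\<dots> = (\<Sum>v\<in>U. (1 / ?n) * (wsum U w (\<lambda>A. (f A)\<^sup>2) - dirich v U w f))"
    using wsum_resample(2)[OF assms(1) _ w] by simp
  also have "\<dots> = wsum U w (\<lambda>A. (f A)\<^sup>2) - dirichlet U w f / ?n"
    using n by (simp add: sum_subtractf diff_divide_distrib sum_divide_distrib)
  finally show ?thesis
    using wsum_heat[OF assms(1,2) w] by (simp add: wcov_def power2_eq_square)
qed

lemma wvar_heat_iterate:
  assumes U: "finite U" "U \<noteq> {}" and w: "\<And>A. A \<subseteq> U \<Longrightarrow> 0 \<le> w A" and "1 \<le> C"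
    and poincare: "\<And>f. wvar U w f \<le> C * dirichlet U w f"
  shows "wvar U w ((heat U w ^^ t) f) \<le> (1 - 1 / (real (card U) * C)) ^ t * wvar U w f"
proof (induction t)
  case (Suc t)
  let ?n = "real (card U)" and ?g = "(heat U w ^^ t) f"
  have n: "1 \<le> ?n" using U by (simp add: Suc_le_eq card_gt_0_iff)
  have "wvar U w (heat U w ?g) \<le> wvar U w ?g - dirichlet U w ?g / ?n"
    by (rule wvar_heat_le[OF U w])
  also have "\<dots> \<le> wvar U w ?g - wvar U w ?g / C / ?n"
    using poincare[of ?g] assms(4) n
    by (intro diff_left_mono divide_right_mono) (auto simp: pos_divide_le_eq mult.commute)
  also have "\<dots> = (1 - 1 / (?n * C)) * wvar U w ?g" by (simp add: algebra_simps)
  also have "\<dots> \<le> (1 - 1 / (?n * C)) * ((1 - 1 / (?n * C)) ^ t * wvar U w f)"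
  proof (intro mult_left_mono Suc.IH)
    have "1 * 1 \<le> ?n * C" using n assms(4) by (intro mult_mono) auto
    then show "0 \<le> 1 - 1 / (?n * C)" by (simp add: divide_le_eq)
  qed
  finally show ?case by (simp add: mult.assoc)
qed simp

lemma wmean_heat_iterate:
  assumes "finite U" "U \<noteq> {}" "\<And>A. A \<subseteq> U \<Longrightarrow> 0 \<le> w A"
  shows "wmean U w ((heat U w ^^ t) f) = wmean U w f"
  using wsum_heat[OF assms] by (induction t) (simp_all add: wmean_def)

lemma wvar_pointwise:
  assumes "finite U" "\<And>A. A \<subseteq> U \<Longrightarrow> 0 \<le> w A" "A \<subseteq> U"
  shows "w A * (f A - wmean U w f)\<^sup>2 \<le> wvar U w f"
proof -
  have "w A * (f A - wmean U w f)\<^sup>2 \<le> wsum U w (\<lambda>A. (f A - wmean U w f)\<^sup>2)"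
    unfolding wsum_def using assms by (intro member_le_sum) auto
  then show ?thesis using wvar_eq_dev[of U w f] assms by simp
qed

lemma heat_cong:
  assumes "A \<subseteq> U" "\<And>B. B \<subseteq> U \<Longrightarrow> w B \<noteq> 0 \<Longrightarrow> f B = g B"
  shows "heat U w f A = heat U w g A"
proof -
  have *: "w B * f B = w B * g B" if "B \<subseteq> U" for B using assms(2)[of B] that by auto
  have "resample w v f A = resample w v g A" if "v \<in> U" for v
  proof -
    have "A - {v} \<subseteq> U" "insert v A \<subseteq> U" using assms(1) that by auto
    then show ?thesis by (simp add: resample_def *)
  qed
  then show ?thesis by (simp add: heat_def)
qed

text \<open>Configurations of weight 0 are never entered, so values there do not matter. This is
  used because \<open>glauber_step\<close> is meaningful only on the support of the Gibbs
  distribution.\<close>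

lemma heat_iterate_cong:
  assumes "A \<subseteq> U" "w A \<noteq> 0" "\<And>B. B \<subseteq> U \<Longrightarrow> w B \<noteq> 0 \<Longrightarrow> f B = g B"
  shows "(heat U w ^^ t) f A = (heat U w ^^ t) g A"
  using assms(1,2)
proof (induction t arbitrary: A)
  case 0
  then show ?case using assms(3) by simp
next
  case (Suc t)
  have "heat U w ((heat U w ^^ t) f) A = heat U w ((heat U w ^^ t) g) A"
    by (intro heat_cong Suc.IH Suc.prems(1))
  then show ?case by simp
qed

text \<open>\<open>A \<mapsto> sum \<kappa> A\<close> is a Lyapunov function of the chain.\<close>

lemma heat_drift:
  assumes U: "finite U" "U \<noteq> {}" and w: "\<And>A. A \<subseteq> U \<Longrightarrow> 0 \<le> w A"
    and \<kappa>: "\<And>v. v \<in> U \<Longrightarrow> 0 \<le> \<kappa> v"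
    and B: "\<And>v A. v \<in> U \<Longrightarrow> A \<subseteq> U - {v} \<Longrightarrow> \<kappa> v * w (insert v A) \<le> B * w A"
    and A: "A \<subseteq> U" "w A \<noteq> 0" and b: "0 \<le> b" "0 \<le> B"
    and g: "\<And>A. A \<subseteq> U \<Longrightarrow> w A \<noteq> 0 \<Longrightarrow> \<bar>g A\<bar> \<le> a + b * sum \<kappa> A"
  shows "\<bar>heat U w g A\<bar> \<le> (a + b * B) + b * (1 - 1 / real (card U)) * sum \<kappa> A"
proof -
  let ?n = "real (card U)" and ?D = "sum \<kappa>"
  have n: "0 < ?n" using U by (simp add: card_gt_0_iff)
  have finA: "finite A" using A U finite_subset by blast
  have wg: "\<bar>w B * g B\<bar> \<le> w B * (a + b * ?D B)" if "B \<subseteq> U" for B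
    using w[OF that] g[OF that] by (cases "w B = 0") (auto simp: abs_mult intro: mult_left_mono)
  \<comment> \<open>Resampling \<open>v\<close> removes its summand and restores it with probability
    w1 / (w0 + w1), at an expected cost of at most \<open>B\<close>.\<close>
  have res: "\<bar>resample w v g A\<bar> \<le> a + b * (?D (A - {v}) + B)" if v: "v \<in> U" for v
  proof -
    define w0 w1 where "w0 = w (A - {v})" and "w1 = w (insert v A)"
    have sub: "A - {v} \<subseteq> U" "insert v A \<subseteq> U" "A - {v} \<subseteq> U - {v}" using A v by auto
    have "insert v (A - {v}) = insert v A" by auto
    then have B': "\<kappa> v * w1 \<le> B * w0" using B[OF v sub(3)] by (simp add: w0_def w1_def)
    have w01: "0 \<le> w0" "0 \<le> w1" using w sub by (auto simp: w0_def w1_def)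
    have pos: "0 < w0 + w1"
    proof -
      have "A = A - {v} \<or> A = insert v A" by auto
      then have "w0 = w A \<or> w1 = w A" by (metis w0_def w1_def)
      then show ?thesis using w01 A(2) by auto
    qed
    have D1: "?D (insert v A) = ?D (A - {v}) + \<kappa> v" using finA by (simp add: sum.insert_remove)
    have "\<bar>w0 * g (A - {v}) + w1 * g (insert v A)\<bar>
        \<le> \<bar>w0 * g (A - {v})\<bar> + \<bar>w1 * g (insert v A)\<bar>" by (rule abs_triangle_ineq)
    also have "\<dots> \<le> w0 * (a + b * ?D (A - {v})) + w1 * (a + b * ?D (insert v A))"
      using wg[OF sub(1)] wg[OF sub(2)] unfolding w0_def w1_def by (rule add_mono)
    also have "\<dots> = (w0 + w1) * (a + b * ?D (A - {v})) + b * (\<kappa> v * w1)"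
      unfolding D1 by (simp add: algebra_simps)
    also have "\<dots> \<le> (w0 + w1) * (a + b * ?D (A - {v})) + b * (B * (w0 + w1))"
    proof -
      have "B * w0 \<le> B * (w0 + w1)" using b w01 by (intro mult_left_mono) auto
      then show ?thesis using B' b by (intro add_left_mono mult_left_mono) auto
    qed
    also have "\<dots> = (a + b * (?D (A - {v}) + B)) * (w0 + w1)" by (simp add: algebra_simps)
    finally show ?thesis
      using pos unfolding resample_def w0_def[symmetric] w1_def[symmetric]
      by (simp add: abs_divide pos_divide_le_eq)
  qed
  have D: "(\<Sum>v\<in>U. ?D (A - {v})) = (?n - 1) * ?D A"
  proof -
    have "(\<Sum>v\<in>U. ?D (A - {v})) = (\<Sum>v\<in>U. ?D A - (if v \<in> A then \<kappa> v else 0))"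
      using finA by (intro sum.cong refl) (simp add: sum_diff1)
    also have "\<dots> = ?n * ?D A - ?D (U \<inter> A)" using U(1) by (simp add: sum_subtractf sum.If_cases Int_def)
    also have "\<dots> = (?n - 1) * ?D A" using A by (simp add: Int_absorb1 algebra_simps)
    finally show ?thesis .
  qed
  have "\<bar>heat U w g A\<bar> \<le> (\<Sum>v\<in>U. \<bar>resample w v g A\<bar>) / ?n"
    unfolding heat_def using n by (simp add: abs_divide divide_right_mono)
  also have "\<dots> \<le> (\<Sum>v\<in>U. a + b * (?D (A - {v}) + B)) / ?n"
    using res n by (intro divide_right_mono sum_mono) auto
  also have "\<dots> = (?n * (a + b * B) + b * ((?n - 1) * ?D A)) / ?n"
    unfolding D[symmetric] by (simp add: sum.distrib sum_distrib_left algebra_simps)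
  also have "\<dots> = (a + b * B) + b * (1 - 1 / ?n) * ?D A"
    using n by (simp add: add_divide_distrib diff_divide_distrib algebra_simps)
  finally show ?thesis .
qed

text \<open>A step turns the bound (a, b) into (a + b B, b (1 - 1 / n)); the increments form a
  geometric series of sum at most b B n.\<close>

lemma heat_iterate_drift:
  assumes U: "finite U" "U \<noteq> {}" and w: "\<And>A. A \<subseteq> U \<Longrightarrow> 0 \<le> w A"
    and \<kappa>: "\<And>v. v \<in> U \<Longrightarrow> 0 \<le> \<kappa> v"
    and B: "\<And>v A. v \<in> U \<Longrightarrow> A \<subseteq> U - {v} \<Longrightarrow> \<kappa> v * w (insert v A) \<le> B * w A"
    and A: "A \<subseteq> U" "w A \<noteq> 0" and b: "0 \<le> b" "0 \<le> B"
    and g: "\<And>A. A \<subseteq> U \<Longrightarrow> w A \<noteq> 0 \<Longrightarrow> \<bar>g A\<bar> \<le> a + b * sum \<kappa> A"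
  shows "\<bar>(heat U w ^^ s) g A\<bar>
      \<le> a + b * B * real (card U) + b * (1 - 1 / real (card U)) ^ s * sum \<kappa> A"
proof -
  let ?n = "real (card U)"
  define q where "q = 1 - 1 / ?n"
  have n: "1 \<le> ?n" using U by (simp add: Suc_le_eq card_gt_0_iff)
  have q: "0 \<le> q" using n by (simp add: q_def)
  have "\<bar>(heat U w ^^ s) g A\<bar> \<le> (a + b * B * ?n * (1 - q ^ s)) + b * q ^ s * sum \<kappa> A"
    using A
  proof (induction s arbitrary: A)
    case 0
    then show ?case using g by simp
  next
    case (Suc s)
    have "\<bar>heat U w ((heat U w ^^ s) g) A\<bar>
      \<le> (a + b * B * ?n * (1 - q ^ s) + b * q ^ s * B) + b * q ^ s * (1 - 1 / ?n) * sum \<kappa> A"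
      using q b(1) Suc.prems by (intro heat_drift[OF U w \<kappa> B _ _ _ b(2) Suc.IH]) auto
    moreover have "b * q ^ s * B = b * B * ?n * (q ^ s * (1 - q))" using n by (simp add: q_def)
    then have "a + b * B * ?n * (1 - q ^ s) + b * q ^ s * B = a + b * B * ?n * (1 - q ^ Suc s)"
      by (simp add: algebra_simps)
    moreover have "b * q ^ s * (1 - 1 / ?n) * sum \<kappa> A = b * q ^ Suc s * sum \<kappa> A"
      by (simp add: q_def)
    ultimately show ?case by simp
  qed
  also have "\<dots> \<le> a + b * B * ?n + b * q ^ s * sum \<kappa> A"
  proof -
    have "b * B * ?n * (1 - q ^ s) \<le> b * B * ?n * 1" using q b n by (intro mult_left_mono) auto
    then show ?thesis by simp
  qed
  finally show ?thesis by (simp add: q_def)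
qed

section \<open>The Glauber dynamics as a heat-bath chain on sets\<close>

context two_spin
begin

abbreviation w0 :: "nat set \<Rightarrow> real" where "w0 \<equiv> wt (\<lambda>_. 0)"

abbreviation mu :: "(nat \<Rightarrow> nat) pmf" where "mu \<equiv> gibbs V E \<beta> \<gamma> lam"

abbreviation chain :: "(nat \<Rightarrow> nat) \<Rightarrow> (nat \<Rightarrow> nat) pmf" where
  "chain \<equiv> glauber_step V E \<beta> \<gamma> lam"

definition conf :: "nat set \<Rightarrow> nat \<Rightarrow> nat" where
  "conf S = (\<lambda>v. if v \<in> V then of_bool (v \<in> S) else undefined)"

lemma conf_eq_1_iff: "v \<in> V \<Longrightarrow> conf S v = 1 \<longleftrightarrow> v \<in> S"
  and conf_eq_0_iff: "v \<in> V \<Longrightarrow> conf S v = 0 \<longleftrightarrow> v \<notin> S"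
  by (auto simp: conf_def)

lemma bij_betw_conf: "bij_betw conf (Pow V) (configs V)"
proof (rule bij_betw_byWitness[where f' = "\<lambda>\<sigma>. {v \<in> V. \<sigma> v = 1}"])
  show "\<forall>\<sigma>\<in>configs V. conf {v \<in> V. \<sigma> v = 1} = \<sigma>"
  proof
    fix \<sigma> assume "\<sigma> \<in> configs V"
    then have "\<sigma> v = undefined" if "v \<notin> V" for v using that by (auto simp: configs_def PiE_def extensional_def)
    moreover have "\<sigma> v \<in> {0, 1}" if "v \<in> V" for v using that \<open>\<sigma> \<in> configs V\<close> by (auto simp: configs_def)
    ultimately show "conf {v \<in> V. \<sigma> v = 1} = \<sigma>" by (force simp: conf_def)
  qed
qed (auto simp: conf_def configs_def)

text \<open>Edge by edge, [e \<inter> S = {}] + card (e \<inter> S) = 1 + [e \<subseteq> S]. This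
  trades the edges between zeros, which carry \<gamma>, for the degrees of the ones.\<close>

lemma degree_sum:
  assumes "S \<subseteq> V"
  shows "card {e \<in> E. e \<inter> S = {}} + (\<Sum>v\<in>S. deg v) = card E + ecount S"
proof -
  have finS: "finite S" using assms finite_V finite_subset by blast
  have "(\<Sum>v\<in>S. deg v) = (\<Sum>v\<in>S. \<Sum>e\<in>E. of_bool (v \<in> e))"
    unfolding vdegree_def using finite_E by (intro sum.cong refl) (simp add: Int_def)
  also have "\<dots> = (\<Sum>e\<in>E. \<Sum>v\<in>S. of_bool (v \<in> e))" by (rule sum.swap)
  also have "\<dots> = (\<Sum>e\<in>E. card (e \<inter> S))"
    using finS by (intro sum.cong refl) (simp add: Int_def conj_commute)
  finally have "card {e \<in> E. e \<inter> S = {}} + (\<Sum>v\<in>S. deg v)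
      = (\<Sum>e\<in>E. of_bool (e \<inter> S = {}) + card (e \<inter> S))"
    using finite_E by (simp add: sum.distrib Int_def)
  also have "\<dots> = (\<Sum>e\<in>E. 1 + of_bool (e \<subseteq> S))"
  proof (intro sum.cong refl)
    fix e assume "e \<in> E"
    then obtain x y where e: "e = {x, y}" "x \<noteq> y" using edge_card card_2_iff by metis
    show "of_bool (e \<inter> S = {}) + card (e \<inter> S) = 1 + of_bool (e \<subseteq> S)"
      unfolding e(1) using e(2) by (cases "x \<in> S"; cases "y \<in> S") auto
  qed
  also have "\<dots> = card E + ecount S"
    unfolding sum.distrib using finite_E by (simp add: ecount_def Int_def)
  finally show ?thesis .
qed

lemma spin_weight_conf:
  assumes "S \<subseteq> V"
  shows "spin_weight V E \<beta> \<gamma> lam (conf S) = \<gamma> ^ card E * w0 S"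
proof -
  have sub: "e \<subseteq> V" if "e \<in> E" for e using that graph by (auto simp: simple_graph_def)
  have 1: "mono_edges E 1 (conf S) = ecount S"
    unfolding mono_edges_def ecount_def
    by (intro arg_cong[where f = card] Collect_cong conj_cong refl)
      (metis sub conf_eq_1_iff subset_iff)
  have 0: "mono_edges E 0 (conf S) = card {e \<in> E. e \<inter> S = {}}"
    unfolding mono_edges_def
    by (intro arg_cong[where f = card] Collect_cong conj_cong refl)
      (metis sub conf_eq_0_iff subset_iff disjoint_iff)
  have n: "card {v \<in> V. conf S v = 1} = card S"
    using assms conf_eq_1_iff by (intro arg_cong[where f = card]) auto
  have g: "\<gamma> ^ mono_edges E 0 (conf S) * \<gamma> ^ (\<Sum>v\<in>S. deg v) = \<gamma> ^ card E * \<gamma> ^ ecount S"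
    unfolding 0 using degree_sum[OF assms] by (simp flip: power_add)
  have w: "w0 S = \<beta> ^ ecount S * \<gamma> ^ ecount S * (lam ^ card S / \<gamma> ^ (\<Sum>v\<in>S. deg v))"
    unfolding wt_def fld_def \<rho>_def by (simp add: power_mult_distrib prod_dividef power_sum)
  have "\<gamma> ^ card E * w0 S
      = \<beta> ^ ecount S * lam ^ card S * ((\<gamma> ^ card E * \<gamma> ^ ecount S) / \<gamma> ^ (\<Sum>v\<in>S. deg v))"
    unfolding w by simp
  also have "\<dots> = \<beta> ^ ecount S * lam ^ card S * \<gamma> ^ mono_edges E 0 (conf S)"
    unfolding g[symmetric] using gamma by simp
  finally show ?thesis unfolding spin_weight_def 1 n by simp
qed

lemma partition_fun_eq: "partition_fun V E \<beta> \<gamma> lam = \<gamma> ^ card E * tot V w0"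
proof -
  have "partition_fun V E \<beta> \<gamma> lam = (\<Sum>S\<in>Pow V. spin_weight V E \<beta> \<gamma> lam (conf S))"
    unfolding partition_fun_def by (rule sum.reindex_bij_betw[OF bij_betw_conf, symmetric])
  then show ?thesis by (simp add: spin_weight_conf tot_def sum_distrib_left)
qed

lemma pmf_gibbs_conf:
  assumes "S \<subseteq> V"
  shows "pmf mu (conf S) = w0 S / tot V w0"
proof -
  have "conf S \<in> configs V" using bij_betw_conf assms by (auto simp: bij_betw_def)
  then show ?thesis
    using gamma by (simp add: pmf_gibbs[OF graph beta gamma lam] spin_weight_conf[OF assms] partition_fun_eq)
qed

lemma set_gibbs: "set_pmf mu = conf ` {S. S \<subseteq> V \<and> w0 S \<noteq> 0}"
proof (intro equalityI subsetI)
  fix \<sigma> assume \<sigma>: "\<sigma> \<in> set_pmf mu"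
  then have "\<sigma> \<in> configs V"
    using pmf_gibbs[OF graph beta gamma lam, of \<sigma>] by (auto simp: set_pmf_iff split: if_splits)
  then obtain S where S: "S \<subseteq> V" "\<sigma> = conf S" using bij_betw_conf by (auto simp: bij_betw_def)
  then have "w0 S \<noteq> 0" using \<sigma> pmf_gibbs_conf[of S] by (auto simp: set_pmf_iff)
  with S show "\<sigma> \<in> conf ` {S. S \<subseteq> V \<and> w0 S \<noteq> 0}" by blast
next
  fix \<sigma> assume "\<sigma> \<in> conf ` {S. S \<subseteq> V \<and> w0 S \<noteq> 0}"
  then show "\<sigma> \<in> set_pmf mu"
    using pmf_gibbs_conf tot_wt_pos[OF finite_V, of "\<lambda>_. 0"] by (auto simp: set_pmf_iff)
qed

lemma finite_set_gibbs: "finite (set_pmf mu)"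
  unfolding set_gibbs using finite_V by (intro finite_imageI) (simp add: finite_subset)

lemma prob_gibbs: "measure_pmf.prob mu X = wmean V w0 (\<lambda>S. indicator X (conf S))"
proof -
  have fin: "finite (configs V)" using finite_V by (rule finite_configs)
  have sub: "set_pmf mu \<subseteq> configs V"
    unfolding set_gibbs using bij_betw_conf by (auto simp: bij_betw_def)
  have "measure_pmf.prob mu X = measure_pmf.expectation mu (indicator X)" by simp
  also have "\<dots> = (\<Sum>\<sigma>\<in>configs V. pmf mu \<sigma> *\<^sub>R indicator X \<sigma>)"
    using sub by (intro integral_measure_pmf[OF fin]) auto
  also have "\<dots> = (\<Sum>S\<in>Pow V. pmf mu (conf S) *\<^sub>R indicator X (conf S))"
    by (rule sum.reindex_bij_betw[OF bij_betw_conf, symmetric])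
  finally show ?thesis
    by (simp add: pmf_gibbs_conf wmean_def wsum_def sum_divide_distrib)
qed

text \<open>The conditioning event leaves only the two configurations that differ at
  \<open>v\<close>, so their weights determine the conditional law.\<close>

lemma expectation_update:
  fixes f :: "(nat \<Rightarrow> nat) \<Rightarrow> real"
  assumes S: "S \<subseteq> V" "w0 S \<noteq> 0" and v: "v \<in> V"
  defines "Q \<equiv> cond_pmf mu {\<tau>. \<forall>u\<in>V - {v}. \<tau> u = conf S u}"
  shows "set_pmf Q \<subseteq> set_pmf mu"
    and "measure_pmf.expectation Q f = resample w0 v (f \<circ> conf) S"
proof -
  let ?s = "{\<tau>. \<forall>u\<in>V - {v}. \<tau> u = conf S u}"
  let ?a = "conf (S - {v})" and ?b = "conf (insert v S)"
  have sub: "S - {v} \<subseteq> V" "insert v S \<subseteq> V" using S v by auto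
  have "conf S \<in> set_pmf mu \<inter> ?s" using S by (auto simp: set_gibbs)
  then have ne: "set_pmf mu \<inter> ?s \<noteq> {}" by blast
  show "set_pmf Q \<subseteq> set_pmf mu" unfolding Q_def set_cond_pmf[OF ne] by blast
  have ab: "?a \<in> ?s" "?b \<in> ?s" by (auto simp: conf_def)
  have "?a v \<noteq> ?b v" using v by (simp add: conf_def)
  then have neq: "?a \<noteq> ?b" by metis
  have two: "set_pmf Q \<subseteq> {?a, ?b}"
  proof
    fix \<tau> assume "\<tau> \<in> set_pmf Q"
    then have "\<tau> \<in> set_pmf mu" "\<tau> \<in> ?s" unfolding Q_def set_cond_pmf[OF ne] by auto
    then obtain T where T: "T \<subseteq> V" "\<tau> = conf T" by (auto simp: set_gibbs)
    have "u \<in> T \<longleftrightarrow> u \<in> S" if "u \<in> V - {v}" for u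
      using \<open>\<tau> \<in> ?s\<close> that conf_eq_1_iff[of u T] conf_eq_1_iff[of u S] unfolding T(2) by auto
    then have "T - {v} = S - {v}" using S T by auto
    then have "T = S - {v} \<or> T = insert v S" by blast
    then show "\<tau> \<in> {?a, ?b}" using T by auto
  qed
  define N where "N = measure_pmf.prob mu ?s"
  have pmf: "pmf Q x = pmf mu x / N" if "x \<in> ?s" for x
    unfolding Q_def pmf_cond[OF ne] N_def using that by simp
  \<comment> \<open>The probability \<open>N\<close> of the conditioning event is recovered from the
    total mass 1; \<open>N = 0\<close> would make this mass 0.\<close>
  have "(\<Sum>x\<in>{?a, ?b}. pmf Q x) = 1" using two by (intro sum_pmf_eq_1) auto
  then have one: "pmf mu ?a / N + pmf mu ?b / N = 1" using neq ab pmf by simp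
  then have N: "N = pmf mu ?a + pmf mu ?b" by (cases "N = 0") (auto simp: field_simps)
  have Z: "tot V w0 \<noteq> 0" using tot_wt_pos[OF finite_V, of "\<lambda>_. 0"] by simp
  have "measure_pmf.expectation Q f = (\<Sum>x\<in>{?a, ?b}. pmf Q x *\<^sub>R f x)"
    using two by (intro integral_measure_pmf) auto
  also have "\<dots> = (pmf mu ?a * f ?a + pmf mu ?b * f ?b) / N"
    using neq ab pmf by (simp add: add_divide_distrib)
  also have "\<dots> = ((w0 (S - {v}) * f ?a + w0 (insert v S) * f ?b) / tot V w0)
      / ((w0 (S - {v}) + w0 (insert v S)) / tot V w0)"
    unfolding N pmf_gibbs_conf[OF sub(1)] pmf_gibbs_conf[OF sub(2)] by (simp add: add_divide_distrib)
  also have "\<dots> = resample w0 v (f \<circ> conf) S"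
    using Z by (simp add: resample_def)
  finally show "measure_pmf.expectation Q f = resample w0 v (f \<circ> conf) S" .
qed

lemma set_chain:
  assumes "\<sigma> \<in> set_pmf mu" "V \<noteq> {}"
  shows "set_pmf (chain \<sigma>) \<subseteq> set_pmf mu"
proof -
  obtain S where S: "S \<subseteq> V" "w0 S \<noteq> 0" "\<sigma> = conf S" using assms by (auto simp: set_gibbs)
  have "set_pmf (chain \<sigma>)
      = (\<Union>v\<in>V. set_pmf (cond_pmf mu {\<tau>. \<forall>u\<in>V - {v}. \<tau> u = conf S u}))"
    unfolding glauber_step_def S(3) using assms(2) finite_V by simp
  then show ?thesis using expectation_update(1)[OF S(1,2)] by auto
qed

lemma expectation_chain:
  fixes f :: "(nat \<Rightarrow> nat) \<Rightarrow> real"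
  assumes S: "S \<subseteq> V" "w0 S \<noteq> 0" and "V \<noteq> {}"
  shows "measure_pmf.expectation (chain (conf S)) f = heat V w0 (f \<circ> conf) S"
proof -
  have "measure_pmf.expectation (chain (conf S)) f
    = (\<Sum>v\<in>V. measure_pmf.expectation (cond_pmf mu {\<tau>. \<forall>u\<in>V - {v}. \<tau> u = conf S u}) f
        /\<^sub>R real (card V))"
    unfolding glauber_step_def
  proof (rule pmf_expectation_bind_pmf_of_set[OF assms(3) finite_V])
    fix v assume "v \<in> V"
    then show "finite (set_pmf (cond_pmf mu {\<tau>. \<forall>u\<in>V - {v}. \<tau> u = conf S u}))"
      using expectation_update(1)[OF S] finite_set_gibbs finite_subset by blast
  qed
  then show ?thesis
    using expectation_update(2)[OF S] by (simp add: heat_def divide_inverse_commute sum_distrib_left)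
qed

lemma set_iterate:
  assumes S: "S \<subseteq> V" "w0 S \<noteq> 0" and "V \<noteq> {}"
  shows "set_pmf (iterate_kernel chain t (conf S)) \<subseteq> set_pmf mu"
proof (induction t)
  case 0
  show ?case using S by (auto simp: iterate_kernel_def set_gibbs)
next
  case (Suc t)
  then show ?case using set_chain[OF _ assms(3)] by (auto simp: iterate_kernel_def)
qed

lemma expectation_iterate:
  fixes f :: "(nat \<Rightarrow> nat) \<Rightarrow> real"
  assumes S: "S \<subseteq> V" "w0 S \<noteq> 0" and "V \<noteq> {}"
  shows "measure_pmf.expectation (iterate_kernel chain t (conf S)) f
      = (heat V w0 ^^ t) (f \<circ> conf) S"
proof (induction t arbitrary: f)
  case 0
  show ?case by (simp add: iterate_kernel_def)
next
  case (Suc t)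
  let ?p = "iterate_kernel chain t (conf S)"
  note set = set_iterate[OF assms, of t]
  have step: "iterate_kernel chain (Suc t) (conf S) = bind_pmf ?p chain"
    by (simp add: iterate_kernel_def)
  have fin: "finite (set_pmf (chain \<sigma>))" if "\<sigma> \<in> set_pmf mu" for \<sigma>
    using set_chain[OF that assms(3)] finite_set_gibbs finite_subset by blast
  let ?g = "\<lambda>\<sigma>. measure_pmf.expectation (chain \<sigma>) f"
  have "measure_pmf.expectation (iterate_kernel chain (Suc t) (conf S)) f
      = (\<Sum>\<sigma>\<in>set_pmf mu. pmf ?p \<sigma> *\<^sub>R ?g \<sigma>)"
    unfolding step by (rule pmf_expectation_bind[OF finite_set_gibbs fin set])
  also have "\<dots> = measure_pmf.expectation ?p ?g"
    using set by (intro integral_measure_pmf[symmetric] finite_set_gibbs) auto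
  also have "\<dots> = (heat V w0 ^^ t) (?g \<circ> conf) S" by (rule Suc.IH)
  also have "\<dots> = (heat V w0 ^^ t) (heat V w0 (f \<circ> conf)) S"
    using expectation_chain assms(3) by (intro heat_iterate_cong S) auto
  also have "\<dots> = (heat V w0 ^^ Suc t) (f \<circ> conf) S" by (simp only: funpow_Suc_right o_def)
  finally show "measure_pmf.expectation (iterate_kernel chain (Suc t) (conf S)) f
      = (heat V w0 ^^ Suc t) (f \<circ> conf) S" .
qed

end

section \<open>Mixing time\<close>

lemma tot_scale:
  assumes "\<And>A. A \<subseteq> U \<Longrightarrow> w A = C * w' A" "u \<in> U"
  shows "tot (U - {u}) w = C * tot (U - {u}) w'"
    and "tot (U - {u}) (w \<circ> insert u) = C * tot (U - {u}) (w' \<circ> insert u)"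
  unfolding tot_def sum_distrib_left using assms
  by (auto intro!: sum.cong simp: subset_Diff_insert)

lemma mean_diff_scale:
  assumes "\<And>A. A \<subseteq> U \<Longrightarrow> w A = C * w' A" "u \<in> U" "C \<noteq> 0"
  shows "mean_diff U w u f = mean_diff U w' u f"
proof -
  have "wsum (U - {u}) w f = C * wsum (U - {u}) w' f"
    "wsum (U - {u}) (w \<circ> insert u) (f \<circ> insert u) = C * wsum (U - {u}) (w' \<circ> insert u) (f \<circ> insert u)"
    unfolding wsum_def sum_distrib_left using assms
    by (auto intro!: sum.cong simp: subset_Diff_insert)
  then show ?thesis
    using assms(3) tot_scale[OF assms(1,2)] by (simp add: mean_diff_def wmean_def)
qed

section \<open>The class of pinned systems\<close>

context two_spin
begin

text \<open>\<open>C\<close> absorbs the fields of the vertices pinned to 1. It may be 0: for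
  \<beta> = 0 a pinning can be infeasible, and the class must be closed under it as well.\<close>

definition pinned :: "nat set \<Rightarrow> (nat set \<Rightarrow> real) \<Rightarrow> bool" where
  "pinned U w \<longleftrightarrow> U \<subseteq> V \<and>
     (\<exists>C a. 0 \<le> C \<and> consistent a U \<and> (\<forall>A\<subseteq>U. w A = C * wt a A))"

lemma wt_flip:
  assumes "finite A" "v \<notin> A" "deg v = a v + card (nb v \<inter> A) + q"
  shows "wt a (insert v A) = lam * \<beta> ^ (a v + card (nb v \<inter> A)) * (1 / \<gamma>) ^ q * wt a A"
  using gamma unfolding wt_insert[OF assms(1,2)] wt_inc[OF assms(1)]
  by (simp add: fld_def assms(3) \<rho>_def power_add power_mult_distrib power_one_over)

lemma flip_bound:
  assumes F: "\<And>p q. p + q \<le> deg v \<Longrightarrow> lam * \<beta> ^ p * (1 / \<gamma>) ^ q \<le> F"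
    and "finite A" "v \<notin> A" "a v + card (nb v \<inter> A) \<le> deg v"
  shows "wt a (insert v A) \<le> F * wt a A"
proof -
  obtain q where q: "deg v = a v + card (nb v \<inter> A) + q" using assms(4) le_Suc_ex by blast
  show ?thesis
    unfolding wt_flip[where a = a and q = q, OF assms(2,3) q] using F q by (intro mult_right_mono wt_nonneg) simp
qed

lemma pinned_remove:
  assumes "pinned U w" "u \<in> U"
  shows "pinned (U - {u}) w" "pinned (U - {u}) (w \<circ> insert u)"
proof -
  obtain C a where C: "0 \<le> C" "consistent a U" and w: "\<And>A. A \<subseteq> U \<Longrightarrow> w A = C * wt a A"
    and UV: "U \<subseteq> V" using assms(1) unfolding pinned_def by blast
  have fin: "finite U" using UV finite_V finite_subset by blast
  have "inc {} a = a" by (auto simp: inc_def)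
  then have "consistent a (U - {u})" using consistent_remove[OF fin C(2) assms(2), of "{}"] by simp
  then show "pinned (U - {u}) w"
    unfolding pinned_def using UV C(1) w by blast
  have "consistent (inc (nb u \<inter> U) a) (U - {u})"
    using consistent_remove[OF fin C(2) assms(2), of "nb u \<inter> U"] by simp
  moreover have "(w \<circ> insert u) A = C * fld a u * wt (inc (nb u \<inter> U) a) A" if A: "A \<subseteq> U - {u}" for A
  proof -
    have "finite A" "u \<notin> A" "insert u A \<subseteq> U" using A fin assms(2) by (auto intro: finite_subset)
    moreover have "nb u \<inter> A = nb u \<inter> U \<inter> A" using A by auto
    ultimately show ?thesis by (simp add: w wt_insert wt_inc)
  qed
  moreover have "0 \<le> C * fld a u" using C(1) fld_nonneg by simp
  ultimately show "pinned (U - {u}) (w \<circ> insert u)"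
    unfolding pinned_def using UV by blast
qed

lemma pinned_w0: "pinned V w0"
proof -
  have "consistent (\<lambda>_. 0) V"
    unfolding consistent_def using card_mono[OF finite_nb Int_lower1] card_nb by auto
  then show ?thesis unfolding pinned_def by (intro conjI exI[of _ 1] exI[of _ "\<lambda>_. 0"]) auto
qed

lemma card_le_degree_bound: "card (nb v \<inter> A) \<le> deg v"
  using card_mono[OF finite_nb[of v] Int_lower1, of A] card_nb[of v] by simp

end

context two_spin_potential
begin

lemma si_family_pinned:
  assumes F: "\<And>p q. enat (p + q) \<le> \<Delta> \<Longrightarrow> lam * \<beta> ^ p * (1 / \<gamma>) ^ q \<le> F"
  shows "si_family (2 * c / \<alpha>) F pinned"
  unfolding si_family_def
proof (intro allI impI)
  fix U w assume pin: "pinned U w"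
  obtain C a where C: "0 \<le> C" "consistent a U" and w: "\<And>A. A \<subseteq> U \<Longrightarrow> w A = C * wt a A"
    and UV: "U \<subseteq> V" using pin unfolding pinned_def by blast
  have fin: "finite U" using UV finite_V finite_subset by blast
  have w0: "0 \<le> w A" if "A \<subseteq> U" for A using w[OF that] C(1) wt_nonneg by simp
  have flip: "w (insert v A) \<le> F * w A" if v: "v \<in> U" and A: "A \<subseteq> U - {v}" for v A
  proof -
    have finA: "finite A" "v \<notin> A" "A \<subseteq> U" "insert v A \<subseteq> U" using A v fin by (auto intro: finite_subset)
    have "card (nb v \<inter> A) \<le> card (nb v \<inter> U)" using finA fin by (intro card_mono) auto
    then have "a v + card (nb v \<inter> A) \<le> deg v" using C(2) v unfolding consistent_def by fastforce
    moreover have "lam * \<beta> ^ p * (1 / \<gamma>) ^ q \<le> F" if "p + q \<le> deg v" for p q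
      using F max_degree[of v] v UV that by (meson enat_ord_simps(1) order_trans subsetD)
    ultimately have "wt a (insert v A) \<le> F * wt a A"
      using finA by (intro flip_bound) auto
    then have "C * wt a (insert v A) \<le> C * (F * wt a A)" using C(1) by (intro mult_left_mono)
    then show ?thesis using w finA by (simp add: mult.left_commute)
  qed
  have var: "(\<Sum>u\<in>U. spin_var U w u * (mean_diff U w u f)\<^sup>2) \<le> (1 + 2 * c / \<alpha>) * wvar U w f" for f
  proof (rule influence_bound_imp_variance_bound[OF fin w0])
    show "0 \<le> 2 * c / \<alpha>" using c_pos alpha by simp
    show "0 < real (max 1 (deg v))" for v by simp
    fix u assume u: "u \<in> U" and K: "0 < spin_var U w u"
    note s = tot_scale[OF w u]
    \<comment> \<open>A spin of positive variance excludes an infeasible pinning and, below, odds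
      0.\<close>
    have "C \<noteq> 0" using K s by (auto simp: spin_var_def)
    have "0 < ratio a U u"
    proof -
      have "tot (U - {u}) (wt a \<circ> insert u) \<noteq> 0" using K s by (auto simp: spin_var_def)
      then have "ratio a U u \<noteq> 0"
        unfolding ratio_def using tot_wt_pos[of "U - {u}" a] fin by simp
      then show ?thesis using ratio_nonneg[OF fin, of a u] by simp
    qed
    then have "(\<Sum>v\<in>U - {u}. real (max 1 (deg v)) * \<bar>mean_diff U (wt a) u (occ v)\<bar>)
      \<le> 2 * c / \<alpha> * real (max 1 (deg u))"
      by (intro total_influence_le fin UV u C(2))
    then show "(\<Sum>v\<in>U - {u}. real (max 1 (deg v)) * \<bar>mean_diff U w u (occ v)\<bar>)
      \<le> 2 * c / \<alpha> * real (max 1 (deg u))"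
      using mean_diff_scale[of U w C "wt a" u] w u \<open>C \<noteq> 0\<close> by simp
  qed
  show "(\<forall>A\<subseteq>U. 0 \<le> w A) \<and> (\<forall>v\<in>U. \<forall>A\<subseteq>U - {v}. w (insert v A) \<le> F * w A) \<and>
    (\<forall>f. (\<Sum>u\<in>U. spin_var U w u * (mean_diff U w u f)\<^sup>2) \<le> (1 + 2 * c / \<alpha>) * wvar U w f) \<and>
    (\<forall>u\<in>U. pinned (U - {u}) w \<and> pinned (U - {u}) (w \<circ> insert u))"
    using w0 flip var pinned_remove[OF pin] by blast
qed

end

section \<open>Pointwise bounds on the weights\<close>

lemma wt_lower_bound_aux:
  fixes \<beta> \<gamma> lam L l :: real
  assumes "0 \<le> L" "\<beta> \<noteq> 0 \<Longrightarrow> exp (- L) \<le> \<beta>" "exp (- L) \<le> 1 / \<gamma>" "exp (- l) \<le> lam"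
    and "lam * \<beta> ^ p * (1 / \<gamma>) ^ q \<noteq> 0" "p + q = k"
  shows "exp (- l - L * real k) \<le> lam * \<beta> ^ p * (1 / \<gamma>) ^ q"
proof -
  \<comment> \<open>For \<beta> = 0 the nonvanishing product forces \<open>p = 0\<close>, and both
    sides are 1.\<close>
  have "exp (- L) ^ p \<le> \<beta> ^ p"
    using assms(2,5) by (cases "p = 0") (auto intro!: power_mono)
  moreover have "exp (- L) ^ q \<le> (1 / \<gamma>) ^ q" using assms(3) by (intro power_mono) auto
  moreover have "0 \<le> lam" using assms(4) by (rule order_trans[OF exp_ge_zero])
  ultimately have 1: "exp (- l) * exp (- L) ^ p \<le> lam * \<beta> ^ p"
    and 2: "exp (- L) ^ q \<le> (1 / \<gamma>) ^ q"
    using assms(4) by (auto intro: mult_mono)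
  have "0 \<le> lam * \<beta> ^ p" using 1 by (rule order_trans[rotated]) simp
  then have "exp (- l) * exp (- L) ^ p * exp (- L) ^ q \<le> lam * \<beta> ^ p * (1 / \<gamma>) ^ q"
    by (intro mult_mono[OF 1 2]) auto
  moreover have "exp (- l) * exp (- L) ^ p * exp (- L) ^ q = exp (- l - L * real k)"
    using assms(6) by (simp add: exp_of_nat_mult[symmetric] exp_add[symmetric] algebra_simps
      flip: assms(6))
  ultimately show ?thesis by simp
qed

context two_spin
begin

lemma wt_upper_bound:
  assumes F: "\<And>v p q. v \<in> V \<Longrightarrow> p + q \<le> deg v \<Longrightarrow> lam * \<beta> ^ p * (1 / \<gamma>) ^ q \<le> F" and "1 \<le> F"
    and "S \<subseteq> V"
  shows "w0 S \<le> F ^ card S"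
proof -
  have "finite S" using assms(3) finite_V finite_subset by blast
  then show ?thesis using assms(3)
  proof (induction S rule: finite_induct)
    case (insert v S)
    have "w0 (insert v S) \<le> F * w0 S"
      using insert F card_le_degree_bound by (intro flip_bound) auto
    also have "\<dots> \<le> F * F ^ card S" using insert assms(2) by (intro mult_left_mono) auto
    finally show ?case using insert by simp
  qed (simp add: wt_empty)
qed

lemma tot_upper_bound:
  assumes F: "\<And>v p q. v \<in> V \<Longrightarrow> p + q \<le> deg v \<Longrightarrow> lam * \<beta> ^ p * (1 / \<gamma>) ^ q \<le> F" and "1 \<le> F"
  shows "tot V w0 \<le> (2 * F) ^ card V"
proof -
  have "tot V w0 \<le> (\<Sum>S\<in>Pow V. F ^ card V)"
    unfolding tot_def
  proof (intro sum_mono)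
    fix S assume S: "S \<in> Pow V"
    have "w0 S \<le> F ^ card S" using S by (intro wt_upper_bound assms) auto
    also have "\<dots> \<le> F ^ card V" using S assms(2) finite_V by (intro power_increasing card_mono) auto
    finally show "w0 S \<le> F ^ card V" .
  qed
  also have "\<dots> = (2 * F) ^ card V" using finite_V by (simp add: card_Pow power_mult_distrib)
  finally show ?thesis .
qed

text \<open>The ones are inserted one at a time. Each insertion contributes lam and, per incident
  edge, \<beta> or 1 / \<gamma>; where nonzero, these are at least \<open>exp (- l)\<close> and
  \<open>exp (- L)\<close>.\<close>

lemma wt_lower_bound:
  assumes L: "0 \<le> L" "\<beta> \<noteq> 0 \<Longrightarrow> exp (- L) \<le> \<beta>" "exp (- L) \<le> 1 / \<gamma>" "exp (- l) \<le> lam"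
    and "S \<subseteq> V" "w0 S \<noteq> 0"
  shows "exp (- l * real (card S) - (\<Sum>v\<in>S. L * real (deg v))) \<le> w0 S"
proof -
  have "finite S" using assms(5) finite_V finite_subset by blast
  then show ?thesis using assms(5,6)
  proof (induction S rule: finite_induct)
    case (insert v S)
    let ?j = "card (nb v \<inter> S)"
    obtain q where q: "deg v = ?j + q" using card_le_degree_bound le_Suc_ex by blast
    have step: "w0 (insert v S) = lam * \<beta> ^ ?j * (1 / \<gamma>) ^ q * w0 S"
      using wt_flip[where a = "\<lambda>_. 0" and q = q, OF insert.hyps] q by simp
    with insert.prems have nz: "lam * \<beta> ^ ?j * (1 / \<gamma>) ^ q \<noteq> 0" "w0 S \<noteq> 0" by auto
    have "exp (- l - L * real (deg v)) * exp (- l * real (card S) - (\<Sum>v\<in>S. L * real (deg v)))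
        \<le> lam * \<beta> ^ ?j * (1 / \<gamma>) ^ q * w0 S"
      using wt_lower_bound_aux[OF L nz(1) q[symmetric]] insert nz(2)
      by (intro mult_mono) (auto intro: order_trans[OF exp_ge_zero])
    moreover have "exp (- l - L * real (deg v)) * exp (- l * real (card S) - (\<Sum>v\<in>S. L * real (deg v)))
        = exp (- l * real (card (insert v S)) - (\<Sum>v\<in>insert v S. L * real (deg v)))"
      using insert.hyps by (simp add: exp_add[symmetric] algebra_simps)
    ultimately show ?case unfolding step by simp
  qed (simp add: wt_empty)
qed

end

section \<open>Burn-in and total variation distance\<close>

lemma tv_dist_le:
  assumes "\<And>X. \<bar>measure_pmf.prob p X - measure_pmf.prob q X\<bar> \<le> e"
  shows "tv_dist p q \<le> e"
  unfolding tv_dist_def using assms by (intro cSUP_least) auto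

text \<open>Sets the burn-in length: the Lyapunov function starts at no more than L n^2 and is
  measured in units of K n, so a factor 1 / n has to be gained.\<close>

lemma geometric_drift_le:
  fixes n :: nat
  assumes "1 \<le> n"
  shows "(1 - 1 / real n) ^ n\<^sup>2 \<le> 1 / real n"
proof -
  have n: "1 \<le> real n" using assms by simp
  have "1 - 1 / real n \<le> exp (- (1 / real n))" using exp_ge_add_one_self[of "- (1 / real n)"] by simp
  then have "(1 - 1 / real n) ^ n\<^sup>2 \<le> exp (- (1 / real n)) ^ n\<^sup>2"
    using n by (intro power_mono) auto
  also have "\<dots> = exp (- real n)"
    using n by (simp add: exp_of_nat_mult[symmetric] power2_eq_square)
  also have "\<dots> \<le> 1 / real n"
  proof -
    have "real n \<le> exp (real n)" using exp_ge_add_one_self[of "real n"] by linarith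
    then show ?thesis using n by (simp add: exp_minus field_simps)
  qed
  finally show ?thesis .
qed

context two_spin
begin

text \<open>Burn-in: after \<open>n\<^sup>2\<close> steps the chain has typically reached configurations of probability
  at least \<open>exp (- O(n))\<close>, from where the spectral gap takes over. From an arbitrary start, the
  probability may be as small as \<open>exp (- \<Theta>(n\<^sup>2))\<close> when the degrees are unbounded.\<close>

lemma tv_dist_iterate_le:
  fixes F B L l C :: real and t :: nat
  defines "n \<equiv> card V"
  defines "K \<equiv> 16 * (L + B + 1)"
  assumes V: "V \<noteq> {}" and S: "S \<subseteq> V" "w0 S \<noteq> 0"
    and F: "\<And>v p q. v \<in> V \<Longrightarrow> p + q \<le> deg v \<Longrightarrow> lam * \<beta> ^ p * (1 / \<gamma>) ^ q \<le> F" and "1 \<le> F"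
    and B: "\<And>v p q. v \<in> V \<Longrightarrow> p + q \<le> deg v \<Longrightarrow>
      L * real (deg v) * (lam * \<beta> ^ p * (1 / \<gamma>) ^ (deg v - p)) \<le> B" and "0 \<le> B"
    and L: "0 \<le> L" "\<beta> \<noteq> 0 \<Longrightarrow> exp (- L) \<le> \<beta>" "exp (- L) \<le> 1 / \<gamma>" "exp (- l) \<le> lam"
    and l: "0 \<le> l"
    and C: "1 \<le> C" "\<And>f. wvar V w0 f \<le> C * dirichlet V w0 f"
    and t: "real n * C * (real n * (ln (2 * F) + l + K) + ln 64) \<le> real t"
  shows "tv_dist (iterate_kernel chain (n\<^sup>2 + t) (conf S)) mu \<le> 1 / 4"
proof (rule tv_dist_le)
  fix X :: "(nat \<Rightarrow> nat) set"
  define m where "m = measure_pmf.prob mu X"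
  define f where "f = (\<lambda>S. indicator X (conf S) - m)"
  define g where "g = (heat V w0 ^^ t) f"
  define \<kappa> where "\<kappa> = (\<lambda>v. L * real (deg v))"
  define b where "b = 1 / (K * real n)"
  note fin = finite_V
  have nn: "\<And>A. A \<subseteq> V \<Longrightarrow> 0 \<le> w0 A" by (rule wt_nonneg)
  have n: "1 \<le> n" "1 \<le> real n" using V fin by (auto simp: n_def Suc_le_eq card_gt_0_iff)
  \<comment> \<open>\<open>K\<close> makes the two error terms of the drift at most 1 / 16 each;
    with 1 / 8 from \<open>good\<close> they add up to 1 / 4.\<close>
  have K: "0 < K" "16 \<le> K" "B / K \<le> 1 / 16" "L / K \<le> 1 / 16"
    using L(1) \<open>0 \<le> B\<close> by (auto simp: K_def field_simps)
  have b: "0 \<le> b" using K n by (simp add: b_def)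
  have Z: "0 < tot V w0" by (rule tot_wt_pos[OF fin])
  have m: "m = wmean V w0 (\<lambda>S. indicator X (conf S))" unfolding m_def by (rule prob_gibbs)
  have m01: "0 \<le> m" "m \<le> 1" by (auto simp: m_def)
  have link: "(heat V w0 ^^ s) f S = measure_pmf.prob (iterate_kernel chain s (conf S)) X - m"
    if "S \<subseteq> V" "w0 S \<noteq> 0" for s S
  proof -
    let ?p = "iterate_kernel chain s (conf S)"
    have "finite (set_pmf ?p)"
      using set_iterate[OF that V] finite_set_gibbs finite_subset by blast
    then have "measure_pmf.expectation ?p (\<lambda>\<sigma>. indicator X \<sigma> - m) = measure_pmf.prob ?p X - m"
      by (simp add: Bochner_Integration.integral_diff integrable_measure_pmf_finite)
    moreover have "f = (\<lambda>\<sigma>. indicator X \<sigma> - m) \<circ> conf" by (simp add: f_def o_def)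
    ultimately show ?thesis using expectation_iterate[OF that V] by metis
  qed
  have mean0: "wmean V w0 f = 0"
    using Z m unfolding f_def wmean_def wsum_diff wsum_const by (simp add: diff_divide_distrib)
  have f1: "\<bar>f A\<bar> \<le> 1" for A using m01 by (auto simp: f_def indicator_def)
  have varf: "wvar V w0 f \<le> tot V w0"
  proof -
    have "wvar V w0 f \<le> wsum V w0 (\<lambda>A. (f A - 0)\<^sup>2)" by (intro wvar_le_dev fin nn)
    also have "\<dots> \<le> wsum V w0 (\<lambda>A. 1)"
    proof (intro wsum_mono nn)
      show "(f A - 0)\<^sup>2 \<le> 1" for A using f1[of A] abs_square_le_1[of "f A"] by simp
    qed
    finally show ?thesis by (simp add: wsum_const)
  qed
  have decay: "(1 - 1 / (real n * C)) ^ t \<le> exp (- (real n * (ln (2 * F) + l + K))) / 64"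
  proof -
    have nC: "1 \<le> real n * C" using mult_mono[of 1 "real n" 1 C] n C(1) by simp
    have "1 - 1 / (real n * C) \<le> exp (- (1 / (real n * C)))"
      using exp_ge_add_one_self[of "- (1 / (real n * C))"] by simp
    then have "(1 - 1 / (real n * C)) ^ t \<le> exp (- (1 / (real n * C))) ^ t"
      using nC by (intro power_mono) (auto simp: divide_le_eq)
    also have "\<dots> = exp (- (real t / (real n * C)))" by (simp add: exp_of_nat_mult[symmetric])
    also have "\<dots> \<le> exp (- (real n * (ln (2 * F) + l + K) + ln 64))"
    proof -
      have "0 < real n * C" using nC by simp
      then have "real n * (ln (2 * F) + l + K) + ln 64 \<le> real t / (real n * C)"
        using t by (simp only: pos_le_divide_eq mult.commute)
      then show ?thesis by (simp only: exp_le_cancel_iff neg_le_iff_le)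
    qed
    also have "\<dots> = exp (- (real n * (ln (2 * F) + l + K))) / 64"
      by (simp add: exp_diff exp_minus exp_add field_simps)
    finally show ?thesis .
  qed
  have tot_le: "tot V w0 \<le> exp (real n * ln (2 * F))"
  proof -
    have "tot V w0 \<le> (2 * F) ^ n" unfolding n_def by (intro tot_upper_bound F \<open>1 \<le> F\<close>)
    also have "\<dots> = exp (real n * ln (2 * F))" using \<open>1 \<le> F\<close> by (simp add: exp_of_nat_mult)
    finally show ?thesis .
  qed
  \<comment> \<open>Below the Lyapunov level K n the weight is at least exp (-(l + K) n). The
    variance after \<open>t\<close> steps is at most 1 / 64 of that, whence the \<open>ln 64\<close>
    in the bound on \<open>t\<close> and the value 1 / 8.\<close>
  have good: "\<bar>g A\<bar> \<le> 1 / 8" if A: "A \<subseteq> V" "w0 A \<noteq> 0" "sum \<kappa> A \<le> K * real n" for A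
  proof -
    have pos: "0 < w0 A" using A nn[of A] by simp
    have "wmean V w0 g = wmean V w0 f"
      unfolding g_def using fin V nn by (intro wmean_heat_iterate) auto
    moreover have "w0 A * (g A - wmean V w0 g)\<^sup>2 \<le> wvar V w0 g"
      using fin nn A(1) by (intro wvar_pointwise) auto
    ultimately have "w0 A * (g A)\<^sup>2 \<le> wvar V w0 g" by (simp add: mean0)
    also have "\<dots> \<le> (1 - 1 / (real n * C)) ^ t * wvar V w0 f"
      unfolding g_def n_def by (rule wvar_heat_iterate[OF fin V nn C])
    also have "\<dots> \<le> (exp (- (real n * (ln (2 * F) + l + K))) / 64) * exp (real n * ln (2 * F))"
      using decay varf tot_le wvar_nonneg[of V w0 f] fin nn by (intro mult_mono) auto
    also have "\<dots> = exp (- l * real n - K * real n) / 64"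
      by (simp add: exp_add[symmetric] algebra_simps)
    also have "\<dots> \<le> w0 A / 64"
    proof -
      have "card A \<le> n" unfolding n_def using A fin by (intro card_mono) auto
      then have "l * real (card A) \<le> l * real n" using l by (intro mult_left_mono) auto
      then have "exp (- l * real n - K * real n)
          \<le> exp (- l * real (card A) - (\<Sum>v\<in>A. L * real (deg v)))"
        using A(3) by (simp add: \<kappa>_def)
      also have "\<dots> \<le> w0 A" using A by (intro wt_lower_bound L)
      finally show ?thesis by simp
    qed
    finally have "w0 A * (g A)\<^sup>2 \<le> w0 A * (1 / 64)" by simp
    then have "(g A)\<^sup>2 \<le> (1 / 8)\<^sup>2" using pos by (simp add: power2_eq_square)
    then show ?thesis by (simp add: abs_le_square_iff[symmetric])
  qed
  \<comment> \<open>Above the level the trivial bound 1 is at most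
    \<open>b * sum \<kappa> A\<close>, as in Markov's inequality. So \<open>g\<close> has the form
    that the drift lemma propagates.\<close>
  have g: "\<bar>g A\<bar> \<le> 1 / 8 + b * sum \<kappa> A" if A: "A \<subseteq> V" "w0 A \<noteq> 0" for A
  proof (cases "sum \<kappa> A \<le> K * real n")
    case True
    have "0 \<le> b * sum \<kappa> A"
      using b L(1) by (intro mult_nonneg_nonneg sum_nonneg) (auto simp: \<kappa>_def)
    then show ?thesis using good[OF A True] by linarith
  next
    case False
    have "0 < K * real n" using K n by simp
    then have "1 \<le> b * sum \<kappa> A" using False by (simp add: b_def pos_le_divide_eq)
    moreover have "\<bar>g A\<bar> \<le> 1"
      unfolding g_def link[OF A] using m01 by (smt (verit) measure_nonneg measure_pmf.prob_le_1)
    ultimately show ?thesis by linarith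
  qed
  have drift: "\<kappa> v * w0 (insert v A) \<le> B * w0 A" if v: "v \<in> V" and A: "A \<subseteq> V - {v}" for v A
  proof -
    have finA: "finite A" "v \<notin> A" using A fin by (auto intro: finite_subset)
    let ?j = "card (nb v \<inter> A)"
    obtain q where q: "deg v = ?j + q" using card_le_degree_bound le_Suc_ex by blast
    have "w0 (insert v A) = lam * \<beta> ^ ?j * (1 / \<gamma>) ^ q * w0 A"
      using wt_flip[where a = "\<lambda>_. 0" and q = q, OF finA] q by simp
    then have "\<kappa> v * w0 (insert v A)
        = (L * real (deg v) * (lam * \<beta> ^ ?j * (1 / \<gamma>) ^ (deg v - ?j))) * w0 A"
      by (simp add: \<kappa>_def q)
    also have "\<dots> \<le> B * w0 A"
      using B[OF v, of ?j q] q by (intro mult_right_mono nn) (use A in auto)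
    finally show ?thesis .
  qed
  \<comment> \<open>Functions evolve backwards in time: the \<open>t\<close> steps of variance decay
    sit inside \<open>g\<close>, and the burn-in from \<open>S\<close> is the outer iterate.\<close>
  have "\<bar>(heat V w0 ^^ n\<^sup>2) g S\<bar>
      \<le> 1 / 8 + b * B * real n + b * (1 - 1 / real n) ^ n\<^sup>2 * sum \<kappa> S"
    unfolding n_def
    by (rule heat_iterate_drift[OF fin V nn _ drift S b \<open>0 \<le> B\<close> g]) (use L(1) in \<open>auto simp: \<kappa>_def\<close>)
  also have "\<dots> \<le> 1 / 8 + 1 / 16 + 1 / 16"
  proof (intro add_mono order_refl)
    show "b * B * real n \<le> 1 / 16" using n K by (simp add: b_def)
    have "sum \<kappa> S \<le> (\<Sum>v\<in>S. L * real n)"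
    proof (intro sum_mono)
      fix v
      have "deg v \<le> n" unfolding n_def using card_mono[OF fin nb_subset[of v]] card_nb[of v] by simp
      then show "\<kappa> v \<le> L * real n" unfolding \<kappa>_def using L(1) by (intro mult_left_mono) auto
    qed
    also have "\<dots> \<le> real n * (L * real n)"
      using card_mono[OF fin S(1)] L(1) by (auto simp: n_def intro!: mult_right_mono)
    finally have \<kappa>S: "sum \<kappa> S \<le> real n * (L * real n)" .
    have "b * (1 - 1 / real n) ^ n\<^sup>2 * sum \<kappa> S \<le> b * (1 / real n) * (real n * (L * real n))"
      using b n \<kappa>S geometric_drift_le[OF n(1)] L(1)
      by (intro mult_mono mult_left_mono) (auto simp: \<kappa>_def intro!: sum_nonneg)
    also have "\<dots> = L / K" using n by (simp add: b_def)
    also have "\<dots> \<le> 1 / 16" by (rule K)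
    finally show "b * (1 - 1 / real n) ^ n\<^sup>2 * sum \<kappa> S \<le> 1 / 16" .
  qed
  finally have "\<bar>(heat V w0 ^^ (n\<^sup>2 + t)) f S\<bar> \<le> 1 / 4" by (simp add: g_def funpow_add)
  then show "\<bar>measure_pmf.prob (iterate_kernel chain (n\<^sup>2 + t) (conf S)) X - measure_pmf.prob mu X\<bar> \<le> 1 / 4"
    unfolding link[OF S] m_def .
qed

lemma mixing_time_le:
  assumes "\<And>S. S \<subseteq> V \<Longrightarrow> w0 S \<noteq> 0 \<Longrightarrow> tv_dist (iterate_kernel chain t (conf S)) mu \<le> 1 / 4"
  shows "mixing_time V E \<beta> \<gamma> lam \<le> enat t"
  unfolding mixing_time_def
proof (rule SUP_least)
  fix x assume "x \<in> set_pmf mu"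
  then obtain S where S: "S \<subseteq> V" "w0 S \<noteq> 0" "x = conf S" by (auto simp: set_gibbs)
  show "(INF t\<in>{t. tv_dist (iterate_kernel chain t x) mu \<le> 1 / 4}. enat t) \<le> enat t"
    using assms[OF S(1,2)] S(3) by (intro INF_lower) simp
qed

end

section \<open>Constants independent of the graph\<close>

lemma mult_power_le:
  fixes \<theta> :: real
  assumes "0 \<le> \<theta>" "\<theta> < 1"
  shows "real k * \<theta> ^ k \<le> 1 / (1 - \<theta>)"
proof -
  have "real k * \<theta> ^ k = (\<Sum>i<k. \<theta> ^ k)" by simp
  also have "\<dots> \<le> (\<Sum>i<k. \<theta> ^ i)"
    using assms by (intro sum_mono power_decreasing) auto
  also have "\<dots> = (1 - \<theta> ^ k) / (1 - \<theta>)" using assms sum_gp_strict[of \<theta> k] by simp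
  also have "\<dots> \<le> 1 / (1 - \<theta>)" using assms by (intro divide_right_mono) auto
  finally show ?thesis .
qed

text \<open>With unbounded degrees, general boundedness forces the all-zero configuration to dominate:
  otherwise \<open>ln lam\<close> lies in every \<open>J_int \<beta> \<gamma> lam d\<close>, and \<open>h_fun \<beta> \<gamma> (ln lam)\<close> would
  have to vanish.\<close>

lemma unbounded_degree_cases:
  assumes pot: "general_potential \<infinity> \<beta> \<gamma> lam \<alpha> c \<Psi>"
    and par: "0 \<le> \<beta>" "\<beta> \<le> \<gamma>" "0 < \<gamma>" "0 < lam" and "0 < c"
  shows "\<beta> = 1 \<and> \<gamma> = 1 \<or> \<beta> < 1 \<and> 1 < \<gamma>"
proof (rule ccontr)
  assume neg: "\<not> ?thesis"
  have cases: "1 \<le> \<beta> \<and> 1 \<le> \<gamma> \<or> \<beta> \<le> 1 \<and> \<gamma> \<le> 1" using neg par by linarith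
  have ne: "\<beta> * \<gamma> \<noteq> 1"
  proof
    assume eq: "\<beta> * \<gamma> = 1"
    from cases show False
    proof
      assume "1 \<le> \<beta> \<and> 1 \<le> \<gamma>"
      then have "\<beta> \<le> \<beta> * \<gamma>" "\<gamma> \<le> \<beta> * \<gamma>" using mult_left_mono[of 1 \<gamma> \<beta>] mult_right_mono[of 1 \<beta> \<gamma>] par by auto
      then show False using eq neg \<open>1 \<le> \<beta> \<and> 1 \<le> \<gamma>\<close> by auto
    next
      assume "\<beta> \<le> 1 \<and> \<gamma> \<le> 1"
      then have "\<beta> * \<gamma> \<le> \<beta>" "\<beta> * \<gamma> \<le> \<gamma>" using mult_left_mono[of \<gamma> 1 \<beta>] mult_right_mono[of \<beta> 1 \<gamma>] par by auto
      then show False using eq neg \<open>\<beta> \<le> 1 \<and> \<gamma> \<le> 1\<close> by auto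
    qed
  qed
  have J: "ereal (ln lam) \<in> J_int \<beta> \<gamma> lam d" for d
  proof -
    have ll: "ereal (ln lam) = log_ext lam" using par by (simp add: log_ext_def)
    have "lam * \<beta> ^ d \<le> lam \<and> lam \<le> lam / \<gamma> ^ d \<or> lam / \<gamma> ^ d \<le> lam \<and> lam \<le> lam * \<beta> ^ d"
      using cases
    proof
      assume "1 \<le> \<beta> \<and> 1 \<le> \<gamma>"
      then have "1 \<le> \<beta> ^ d" "1 \<le> \<gamma> ^ d" by auto
      then show ?thesis using par by (simp add: divide_le_eq)
    next
      assume "\<beta> \<le> 1 \<and> \<gamma> \<le> 1"
      then have "\<beta> ^ d \<le> 1" "\<gamma> ^ d \<le> 1" "0 < \<gamma> ^ d" using par by (auto intro: power_le_one)
      then show ?thesis using par by (simp add: le_divide_eq)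
    qed
    moreover have "0 \<le> lam * \<beta> ^ d" "0 \<le> lam / \<gamma> ^ d" using par by auto
    ultimately have "log_ext (lam * \<beta> ^ d) \<le> log_ext lam \<and> log_ext lam \<le> log_ext (lam / \<gamma> ^ d) \<or>
      log_ext (lam / \<gamma> ^ d) \<le> log_ext lam \<and> log_ext lam \<le> log_ext (lam * \<beta> ^ d)"
      using par log_ext_mono by (meson less_imp_le)
    then show ?thesis unfolding ll J_int_def Let_def by (auto simp: min_le_iff_disj le_max_iff_disj)
  qed
  have "0 < pot_deriv \<Psi> (ereal (ln lam))" using pot by (simp add: general_potential_def)
  \<comment> \<open>With equal arguments the quotient of derivatives is 1, and d1 = d2 = d lets the
    bound tend to 0.\<close>
  then have bound: "\<bar>h_fun \<beta> \<gamma> (ln lam)\<bar> \<le> 2 * c / (real d + real d + 2)" for d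
    using boundedness_le[OF pot _ _ J[of d] J[of d]] by simp
  have "0 < \<bar>h_fun \<beta> \<gamma> (ln lam)\<bar>"
  proof -
    have "0 < \<beta> * lam + 1" "0 < lam + \<gamma>" using par by (auto intro: add_nonneg_pos add_pos_pos)
    then show ?thesis using ne par by (simp add: h_fun_def)
  qed
  then obtain d :: nat where "c / \<bar>h_fun \<beta> \<gamma> (ln lam)\<bar> < real d" using reals_Archimedean2 by blast
  with \<open>0 < \<bar>h_fun \<beta> \<gamma> (ln lam)\<bar>\<close> have "c < \<bar>h_fun \<beta> \<gamma> (ln lam)\<bar> * (real d + 1)"
    by (simp add: pos_divide_less_eq algebra_simps)
  moreover have "\<bar>h_fun \<beta> \<gamma> (ln lam)\<bar> * (real d + 1) \<le> c"
    using bound[of d] by (simp add: pos_le_divide_eq algebra_simps)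
  ultimately show False by simp
qed

text \<open>\<open>F\<close> bounds the conditional odds of spin 1, \<open>B\<close> these odds
  times the Lyapunov weight of the vertex. For \<Delta> = \<infinity> both rest on exponential decay
  of the odds in the degree, unless \<beta> = \<gamma> = 1.\<close>

lemma uniform_marginal_bounds:
  assumes pot: "general_potential \<Delta> \<beta> \<gamma> lam \<alpha> c \<Psi>"
    and par: "0 \<le> \<beta>" "\<beta> \<le> \<gamma>" "0 < \<gamma>" "0 < lam" and "0 < c"
  shows "\<exists>F B L. 1 \<le> F \<and> 0 \<le> B \<and> 0 \<le> L \<and> (\<beta> \<noteq> 0 \<longrightarrow> exp (- L) \<le> \<beta>) \<and> exp (- L) \<le> 1 / \<gamma> \<and>
    (\<forall>p q. enat (p + q) \<le> \<Delta> \<longrightarrow> lam * \<beta> ^ p * (1 / \<gamma>) ^ q \<le> F \<and>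
      L * real (p + q) * (lam * \<beta> ^ p * (1 / \<gamma>) ^ q) \<le> B)"
proof -
  define L where "L = \<bar>ln \<beta>\<bar> + \<bar>ln \<gamma>\<bar>"
  have L0: "0 \<le> L" by (simp add: L_def)
  have L1: "exp (- L) \<le> \<beta>" if "\<beta> \<noteq> 0"
  proof -
    have "exp (- L) \<le> exp (ln \<beta>)" unfolding L_def by (subst exp_le_cancel_iff) linarith
    then show ?thesis using that par by simp
  qed
  have L2: "exp (- L) \<le> 1 / \<gamma>"
  proof -
    have "exp (- L) \<le> exp (- ln \<gamma>)" unfolding L_def by (subst exp_le_cancel_iff) linarith
    then show ?thesis using par by (simp add: exp_minus inverse_eq_divide)
  qed
  define M where "M = max \<beta> (1 / \<gamma>)"
  have M: "0 \<le> M" "\<beta> \<le> M" "1 / \<gamma> \<le> M" using par by (auto simp: M_def)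
  have pq: "lam * \<beta> ^ p * (1 / \<gamma>) ^ q \<le> lam * M ^ (p + q)" for p q
  proof -
    have "\<beta> ^ p * (1 / \<gamma>) ^ q \<le> M ^ p * M ^ q"
      using M par by (intro mult_mono power_mono) auto
    then show ?thesis using par by (simp add: power_add mult.assoc)
  qed
  show ?thesis
  proof (cases \<Delta>)
    case (enat D)
    define F where "F = lam * max 1 M ^ D + 1"
    have F: "1 \<le> F" using par by (simp add: F_def)
    have le: "lam * \<beta> ^ p * (1 / \<gamma>) ^ q \<le> F" if "p + q \<le> D" for p q
    proof -
      have "M ^ (p + q) \<le> max 1 M ^ (p + q)" using M by (intro power_mono) auto
      also have "\<dots> \<le> max 1 M ^ D" using that by (intro power_increasing) auto
      finally have "lam * M ^ (p + q) \<le> lam * max 1 M ^ D" using par by (intro mult_left_mono) auto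
      then show ?thesis using pq[of p q] by (simp add: F_def)
    qed
    have "L * real (p + q) * (lam * \<beta> ^ p * (1 / \<gamma>) ^ q) \<le> L * real D * F" if "p + q \<le> D" for p q
      using that le[OF that] L0 par by (intro mult_mono mult_left_mono) auto
    then show ?thesis using F L0 L1 L2 le enat
      by (intro exI[of _ F] exI[of _ "L * real D * F"] exI[of _ L]) auto
  next
    case infinity
    then consider "\<beta> = 1" "\<gamma> = 1" | "\<beta> < 1" "1 < \<gamma>"
      using unbounded_degree_cases[of \<beta> \<gamma> lam \<alpha> c \<Psi>] assms by auto
    then show ?thesis
    proof cases
      case 1
      \<comment> \<open>Without interaction the odds do not decay in the degree, but edges carry no
        weight either: \<open>L = 0\<close> makes the Lyapunov function vanish.\<close>
      then show ?thesis using par by (intro exI[of _ "lam + 1"] exI[of _ 0]) auto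
    next
      case 2
      then have M1: "M < 1" by (simp add: M_def)
      have k: "L * real k * (lam * M ^ k) \<le> L * lam * (1 / (1 - M))" for k
      proof -
        have "L * lam * (real k * M ^ k) \<le> L * lam * (1 / (1 - M))"
          using mult_power_le[OF M(1) M1] L0 par by (intro mult_left_mono) auto
        then show ?thesis by (simp add: ac_simps)
      qed
      have "L * real (p + q) * (lam * \<beta> ^ p * (1 / \<gamma>) ^ q) \<le> L * lam * (1 / (1 - M))" for p q
      proof -
        have "L * real (p + q) * (lam * \<beta> ^ p * (1 / \<gamma>) ^ q) \<le> L * real (p + q) * (lam * M ^ (p + q))"
          using pq L0 by (intro mult_left_mono) auto
        then show ?thesis using k[of "p + q"] by linarith
      qed
      moreover have "lam * \<beta> ^ p * (1 / \<gamma>) ^ q \<le> lam + 1" for p q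
      proof -
        have "lam * M ^ (p + q) \<le> lam * 1"
          using par M M1 by (intro mult_left_mono power_le_one) auto
        then show ?thesis using pq[of p q] by linarith
      qed
      ultimately show ?thesis using L0 L1 L2 M1 par
        by (intro exI[of _ "lam + 1"] exI[of _ "L * lam * (1 / (1 - M))"] exI[of _ L]) auto
    qed
  qed
qed

theorem theorem24:
  fixes \<Delta> :: enat and \<beta> \<gamma> lam \<alpha> c :: real
  assumes "3 \<le> \<Delta>"
    and "0 \<le> \<beta>" and "\<beta> \<le> \<gamma>" and "0 < \<gamma>" and "0 < lam"
    and "0 < \<alpha>" and "\<alpha> < 1" and "0 < c"
    and "\<exists>\<Psi>. general_potential \<Delta> \<beta> \<gamma> lam \<alpha> c \<Psi>"
  shows "\<exists>C::real. \<forall>(V::nat set) (E::nat set set).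
           simple_graph V E \<and> V \<noteq> {} \<and> (\<forall>v\<in>V. enat (vdegree E v) \<le> \<Delta>) \<longrightarrow>
           ereal_of_enat (mixing_time V E \<beta> \<gamma> lam)
             \<le> ereal (C * real (card V) powr (2 + 2 * c / \<alpha>))"
proof -
  obtain \<Psi> where pot: "general_potential \<Delta> \<beta> \<gamma> lam \<alpha> c \<Psi>" using assms by blast
  define \<eta> where "\<eta> = 2 * c / \<alpha>"
  have \<eta>: "0 < \<eta>" using assms by (simp add: \<eta>_def)
  obtain F B L where FBL: "1 \<le> F" "0 \<le> B" "0 \<le> L" "\<beta> \<noteq> 0 \<Longrightarrow> exp (- L) \<le> \<beta>" "exp (- L) \<le> 1 / \<gamma>"
    and F: "\<And>p q. enat (p + q) \<le> \<Delta> \<Longrightarrow> lam * \<beta> ^ p * (1 / \<gamma>) ^ q \<le> F"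
    and B: "\<And>p q. enat (p + q) \<le> \<Delta> \<Longrightarrow> L * real (p + q) * (lam * \<beta> ^ p * (1 / \<gamma>) ^ q) \<le> B"
    using uniform_marginal_bounds[OF pot assms(2-5,8)] by blast
  have "0 \<le> F" using FBL by simp
  obtain C where C: "1 \<le> C" and poincare: "\<And>Q (U :: nat set) w f. si_family \<eta> F Q \<Longrightarrow> finite U \<Longrightarrow>
      U \<noteq> {} \<Longrightarrow> Q U w \<Longrightarrow> wvar U w f \<le> C * real (card U) powr \<eta> * dirichlet U w f"
    using poincare_inequality[OF \<eta> \<open>0 \<le> F\<close>] by blast
  define l where "l = \<bar>ln lam\<bar>"
  have l: "0 \<le> l" "exp (- l) \<le> lam"
  proof -
    have "exp (- l) \<le> exp (ln lam)" unfolding l_def by (subst exp_le_cancel_iff) linarith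
    then show "exp (- l) \<le> lam" using assms(5) by simp
  qed (simp add: l_def)
  define K where "K = ln (2 * F) + l + 16 * (L + B + 1)"
  have K: "0 \<le> K" using FBL l by (simp add: K_def)
  have "ereal_of_enat (mixing_time V E \<beta> \<gamma> lam)
      \<le> ereal ((2 + C * (K + ln 64)) * real (card V) powr (2 + \<eta>))"
    if V: "simple_graph V E" "V \<noteq> {}" "\<forall>v\<in>V. enat (vdegree E v) \<le> \<Delta>" for V E
  proof -
    interpret two_spin_potential V E \<beta> \<gamma> lam \<Delta> \<alpha> c \<Psi>
      using V assms pot by unfold_locales auto
    define n where "n = card V"
    define D where "D = C * real n powr \<eta>"
    have n: "1 \<le> real n" using V finite_V by (simp add: n_def Suc_le_eq card_gt_0_iff)
    have p: "1 \<le> real n powr \<eta>" using n \<eta> by (simp add: ge_one_powr_ge_zero)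
    have D: "1 \<le> D" using mult_mono[of 1 C 1 "real n powr \<eta>"] C p by (simp add: D_def)
    \<comment> \<open>The exponent 2 + \<eta> is made up of \<eta> from \<open>D\<close>, 1 from
      updating one vertex per step and 1 from the logarithm of the smallest relevant
      probability.\<close>
    define t where "t = nat \<lceil>real n * D * (real n * K + ln 64)\<rceil>"
    have t: "real n * D * (real n * K + ln 64) \<le> real t" unfolding t_def by linarith
    have t0: "0 \<le> real n * D * (real n * K + ln 64)" using n D K by simp
    have deg: "enat (p + q) \<le> \<Delta>" if "v \<in> V" "p + q \<le> vdegree E v" for v p q
      using V(3) that by (meson enat_ord_simps(1) order_trans)
    have gap: "wvar V w0 f \<le> D * dirichlet V w0 f" for f
      unfolding D_def n_def
      using poincare[OF si_family_pinned[OF F, folded \<eta>_def] finite_V V(2) pinned_w0] .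
    have "mixing_time V E \<beta> \<gamma> lam \<le> enat (n\<^sup>2 + t)"
    proof (rule mixing_time_le)
      fix S assume S: "S \<subseteq> V" "w0 S \<noteq> 0"
      show "tv_dist (iterate_kernel chain (n\<^sup>2 + t) (conf S)) mu \<le> 1 / 4"
        unfolding n_def
      proof (rule tv_dist_iterate_le[OF V(2) S])
        fix v p q assume v: "v \<in> V" and pq: "p + q \<le> vdegree E v"
        show "lam * \<beta> ^ p * (1 / \<gamma>) ^ q \<le> F" using F deg[OF v pq] .
        show "L * real (vdegree E v) * (lam * \<beta> ^ p * (1 / \<gamma>) ^ (vdegree E v - p)) \<le> B"
          using B[of p "vdegree E v - p"] deg[OF v, of p "vdegree E v - p"] pq by simp
      next
        show "real (card V) * D * (real (card V) * (ln (2 * F) + l + 16 * (L + B + 1)) + ln 64) \<le> real t"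
          using t by (simp add: K_def n_def)
      qed (use FBL l D gap in auto)
    qed
    then have "ereal_of_enat (mixing_time V E \<beta> \<gamma> lam) \<le> ereal (real (n\<^sup>2 + t))"
      by (metis ereal_of_enat_le_iff ereal_of_enat_simps(1))
    also have "\<dots> \<le> ereal ((2 + C * (K + ln 64)) * real n powr (2 + \<eta>))"
    proof -
      have pw: "real n powr (2 + \<eta>) = (real n)\<^sup>2 * real n powr \<eta>"
        using n by (simp add: powr_add powr_numeral)
      have n2: "1 \<le> (real n)\<^sup>2" using n by (simp add: one_le_power)
      have a: "(real n)\<^sup>2 \<le> (real n)\<^sup>2 * real n powr \<eta>"
        using mult_left_mono[OF p, of "(real n)\<^sup>2"] by simp
      have "real t \<le> real n * D * (real n * K + ln 64) + 1" using t0 unfolding t_def by linarith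
      also have "\<dots> \<le> real n * D * (real n * K + real n * ln 64) + (real n)\<^sup>2 * real n powr \<eta>"
      proof (rule add_mono)
        have "1 * ln 64 \<le> real n * ln (64 :: real)" using n by (intro mult_right_mono) auto
        then show "real n * D * (real n * K + ln 64) \<le> real n * D * (real n * K + real n * ln 64)"
          using n D by (intro mult_left_mono add_left_mono) auto
      qed (use a n2 in linarith)
      \<comment> \<open>The 1 pays for rounding \<open>t\<close> up; the burn-in adds another and
        completes the constant.\<close>
      also have "\<dots> = (1 + C * (K + ln 64)) * ((real n)\<^sup>2 * real n powr \<eta>)"
        by (simp add: D_def power2_eq_square algebra_simps)
      finally show ?thesis using a unfolding pw by (simp add: algebra_simps)
    qed
    finally show ?thesis by (simp add: n_def)
  qed
  then show ?thesis unfolding \<eta>_def by blast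
qed

end
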